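(* Let $(B,g_B)$ and $(F,g_F)$ be two non-degenerate semi-Riemannian manifolds, $b\in C^\infty(B\times F)$, and suppose $db=0$ at all points where $b=0$. Let $P\in\Gamma(TF)$ and let $\widehat R$ be the semi-symmetric non-metric curvature, with respect to $P$, of the twisted product $B\times_bF$. For all $X,Y,Z,T\in\Gamma(TB)$ and $U,V,W,Q\in\Gamma(TF)$: (1) $\widehat R(X,Y,Z,T)=R_B(X,Y,Z,T)$; (2) $\widehat R(X,Y,Z,W)=b^2g_F(W,P)\big(\mathcal K_B(X,Z,Y)-\mathcal K_B(Y,Z,X)\big)$; (3) $\widehat R(X,Y,W,Z)=2bg_F(W,P)\big(X(b)g_B(Y,Z)-Y(b)g_B(X,Z)\big)$; (4) $\widehat R(Z,W,X,Y)=0$; (5) $\widehat R(X,Y,V,W)=\widehat R(V,W,X,Y)=0$; (6) $\widehat R(X,V,W,Y)=-\widehat R(V,X,W,Y)=-bXY(b)g_F(V,W)+bg_B^*(\nabla^\flat_XY,db)g_F(V,W)-2bV(b)g_B(X,Y)g_F(W,P)-b^2V(g_F(W,P))g_B(X,Y)$; (7) $\widehat R(X,V,Y,W)=-\widehat R(V,X,Y,W)=bXY(b)g_F(V,W)-bg_B^*(\nabla^\flat_XY,db)g_F(V,W)$; (8) $\widehat R(X,V,U,W)=-\widehat R(V,X,U,W)=bXU(b)g_F(W,V)-X(b)U(b)g_F(W,V)-bXW(b)g_F(V,U)+X(b)W(b)g_F(V,U)+2b^3X(b)\big(g_F(U,P)g_F(V,W)+g_F(W,P)g_F(U,V)\big)$;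 (9) $\widehat R(U,W,X,V)=-\widehat R(U,W,V,X)=bXU(b)g_F(W,V)-X(b)U(b)g_F(W,V)-bXW(b)g_F(V,U)+X(b)W(b)g_F(V,U)$; (10) $\widehat R(U,V,W,Q)=b^2R_F(U,V,W,Q)+\big(b^2g_B^*(db,db)+g_F^*(db,db)\big)\big(g_F(U,W)g_F(V,Q)-g_F(V,W)g_F(U,Q)\big)+\big(bUW(b)-2U(b)W(b)-bg_F^*(\nabla^\flat_UW,db)\big)g_F(V,Q)+\big(bVQ(b)-2V(b)Q(b)-bg_F^*(\nabla^\flat_VQ,db)\big)g_F(U,W)-\big(bVW(b)-2V(b)W(b)-bg_F^*(\nabla^\flat_VW,db)\big)g_F(U,Q)-\big(bUQ(b)-2U(b)Q(b)-bg_F^*(\nabla^\flat_UQ,db)\big)g_F(V,W)+2b^3U(b)\big(g_F(W,P)g_F(V,Q)+g_F(Q,P)g_F(V,W)\big)-2b^3V(b)\big(g_F(W,P)g_F(U,Q)+g_F(Q,P)g_F(U,W)\big)+b^4U(g_F(W,P))g_F(V,Q)-b^4V(g_F(W,P))g_F(U,Q)+b^4g_F(P,Q)\big(\mathcal K_F(U,W,V)-\mathcal K_F(V,W,U)\big)$.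
   Context: A singular semi-Riemannian manifold $(M,g)$ is a smooth manifold with a smooth symmetric bilinear form $g$ on $TM$, possibly degenerate and of variable signature; it is non-degenerate if $g$ is non-degenerate everywhere. Its Koszul form is $\mathcal K(X,Y,Z)=\frac12\{X(g(Y,Z))+Y(g(Z,X))-Z(g(X,Y))-g(X,[Y,Z])+g(Y,[Z,X])+g(Z,[X,Y])\}$, and $(\nabla^\flat_XY)(Z)=\mathcal K(X,Y,Z)$. Contraction: let $T_p^\bullet M=\{g_p(v,\cdot):v\in T_pM\}\subset T_p^*M$ with inner product $g_p^\bullet(g_p(v,\cdot),g_p(w,\cdot))=g_p(v,w)$. For 1-forms $\omega,\tau$ with values in $T^\bullet M$, $\omega(\bullet)\tau(\bullet)$ is the function $p\mapsto g^\bullet_p(\omega_p,\tau_p)$ on the dense open set where the rank of $g$ is locally constant; it is called smooth if it extends (uniquely) to a smooth function on $M$, and then the same symbol denotes the extension. $(M,g)$ is radical-stationary if $\mathcal K(X,Y,\cdot)$ takes values in $T^\bullet M$ for all vector fields $X,Y$, and semi-regular if moreover all $\mathcal K(X,Y,\bullet)\mathcal K(Z,T,\bullet)$ are smooth. On a semi-regular manifold $R(X,Y,Z,T)=X(\mathcal K(Y,Z,T))-Y(\mathcal K(X,Z,T))-\mathcal K([X,Y],Z,T)+\mathcal K(X,Z,\bullet)\mathcal K(Y,T,\bullet)-\mathcal K(Y,Z,\bullet)\mathcal K(X,T,\bullet)$. For a vector field $P$ on $M$, the semi-symmetric non-metric Koszul form is $\widehat{\mathcal K}(X,Y,Z)=\mathcal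 K(X,Y,Z)+g(Y,P)g(X,Z)$. The semi-symmetric non-metric curvature is $\widehat R(X,Y,Z,T)=(\widehat\nabla_X\widehat\nabla^\flat_YZ)(T)-(\widehat\nabla_Y\widehat\nabla^\flat_XZ)(T)-(\widehat\nabla^\flat_{[X,Y]}Z)(T)$ with $(\widehat\nabla^\flat_XY)(Z)=\widehat{\mathcal K}(X,Y,Z)$ and $(\widehat\nabla_X\omega)(T)=X(\omega(T))-(\widehat\nabla^\flat_XT)(\bullet)\,\omega(\bullet)$; that is, the formula for $R$ with $\mathcal K$ replaced everywhere by $\widehat{\mathcal K}$. Equivalently, $\widehat R(X,Y,Z,T)=R(X,Y,Z,T)+X(g(Z,P))g(Y,T)-Y(g(Z,P))g(X,T)-\widehat{\mathcal K}(Y,Z,X)g(P,T)+\widehat{\mathcal K}(X,Z,Y)g(P,T)$. The twisted product $B\times_bF$ with twisting function $b:B\times F\to\mathbb R$ (smooth, possibly vanishing) is $B\times F$ with $g=\pi_B^*(g_B)+b^2\pi_F^*(g_F)$, $\pi_B,\pi_F$ the canonical projections. Under the hypotheses of the claim it is semi-regular. Vector fields in $\Gamma(TB)$, $\Gamma(TF)$ are identified with their lifts to the product, and functions and tensors on the factors with their pullbacks. Subscripts $B$, $F$ denote objects of that factor. $g_B^*$, $g_F^*$ are the inverse metrics of $g_B$, $g_F$ applied to the restrictions of 1-forms to $TB$, resp. $TF$; in $g_B^*(\nabla^\flat_XY,db)$ one has $\nabla^\flat_XY=\mathcal K_B(X,Y,\cdot)$, and in $g_F^*(\nabla^\flat_UW,db)$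 one has $\nabla^\flat_UW=\mathcal K_F(U,W,\cdot)$. $XY(f)$ means $X(Y(f))$. *)

theory Defs
  imports "HOL-Analysis.Analysis" "HOL-Library.Function_Algebras"
begin

section \<open>Smooth manifolds\<close>

primrec Ck_on :: "nat \<Rightarrow> 'a::real_normed_vector set \<Rightarrow> ('a \<Rightarrow> 'b::real_normed_vector) \<Rightarrow> bool"
where
  "Ck_on 0 S f \<longleftrightarrow> continuous_on S f"
| "Ck_on (Suc k) S f \<longleftrightarrow>
     (\<forall>x\<in>S. f differentiable (at x)) \<and> (\<forall>v. Ck_on k S (\<lambda>x. frechet_derivative f (at x) v))"

definition smooth_on :: "'a::real_normed_vector set \<Rightarrow> ('a \<Rightarrow> 'b::real_normed_vector) \<Rightarrow> bool"
  where "smooth_on S f \<longleftrightarrow> (\<forall>k. Ck_on k S f)"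

text \<open>The points of a manifold form the whole type \<open>'m\<close>; a chart is a pair of its domain
  and its coordinate map, which is irrelevant outside the domain.  Atlases need not be maximal.\<close>

type_synonym ('m, 'e) atlas = "('m set \<times> ('m \<Rightarrow> 'e)) set"

definition smooth_manifold ::
  "('m::{t2_space, second_countable_topology}, 'e::euclidean_space) atlas \<Rightarrow> bool"
where
  "smooth_manifold A \<longleftrightarrow>
     (\<Union>(U, \<phi>)\<in>A. U) = UNIV \<and>
     (\<forall>(U, \<phi>)\<in>A. open U \<and> open (\<phi> ` U) \<and> homeomorphism U (\<phi> ` U) \<phi> (inv_into U \<phi>)) \<and>
     (\<forall>(U, \<phi>)\<in>A. \<forall>(V, \<psi>)\<in>A. smooth_on (\<phi> ` (U \<inter> V)) (\<psi> \<circ> inv_into U \<phi>))"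

definition prod_atlas :: "('m, 'e) atlas \<Rightarrow> ('n, 'f) atlas \<Rightarrow> ('m \<times> 'n, 'e \<times> 'f) atlas"
where
  "prod_atlas A B = (\<lambda>((U, \<phi>), (V, \<psi>)). (U \<times> V, map_prod \<phi> \<psi>)) ` (A \<times> B)"

definition smooth_funs :: "('m, 'e::euclidean_space) atlas \<Rightarrow> ('m \<Rightarrow> real) set"
where
  "smooth_funs A = {f. \<forall>(U, \<phi>)\<in>A. smooth_on (\<phi> ` U) (f \<circ> inv_into U \<phi>)}"

text \<open>A tangent vector at \<open>p\<close> is a derivation at \<open>p\<close> of the algebra of smooth functions.  As HOL
  functions are total, it is required to vanish on non-smooth functions, so that equality of
  tangent vectors is equality of derivations.\<close>

type_synonym 'm tvec = "('m \<Rightarrow> real) \<Rightarrow> real"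
type_synonym 'm vfield = "'m \<Rightarrow> 'm tvec"
type_synonym 'm covec = "'m tvec \<Rightarrow> real"
type_synonym 'm metric = "'m \<Rightarrow> 'm tvec \<Rightarrow> 'm tvec \<Rightarrow> real"
type_synonym 'm oneform = "'m vfield \<Rightarrow> 'm \<Rightarrow> real"

definition tangent :: "('m, 'e::euclidean_space) atlas \<Rightarrow> 'm \<Rightarrow> 'm tvec set"
where
  "tangent A p = {v.
     (\<forall>f. f \<notin> smooth_funs A \<longrightarrow> v f = 0) \<and>
     (\<forall>f\<in>smooth_funs A. \<forall>h\<in>smooth_funs A. \<forall>a c.
        v (\<lambda>x. a * f x + c * h x) = a * v f + c * v h) \<and>
     (\<forall>f\<in>smooth_funs A. \<forall>h\<in>smooth_funs A.
        v (\<lambda>x. f x * h x) = v f * h p + f p * v h)}"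

definition der :: "'m vfield \<Rightarrow> ('m \<Rightarrow> real) \<Rightarrow> 'm \<Rightarrow> real"
  where "der X f = (\<lambda>p. X p f)"

definition vector_fields :: "('m, 'e::euclidean_space) atlas \<Rightarrow> 'm vfield set"
where
  "vector_fields A =
     {X. (\<forall>p. X p \<in> tangent A p) \<and> (\<forall>f\<in>smooth_funs A. der X f \<in> smooth_funs A)}"

definition lie_bracket :: "'m vfield \<Rightarrow> 'm vfield \<Rightarrow> 'm vfield"
  where "lie_bracket X Y = (\<lambda>p f. X p (der Y f) - Y p (der X f))"

text \<open>The differential at a point of a smooth map \<open>h\<close> into the manifold with atlas \<open>A'\<close>.\<close>

definition differential ::
  "('n, 'f::euclidean_space) atlas \<Rightarrow> ('m \<Rightarrow> 'n) \<Rightarrow> 'm tvec \<Rightarrow> 'n tvec"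
where
  "differential A' h v = (\<lambda>f. if f \<in> smooth_funs A' then v (f \<circ> h) else 0)"

text \<open>The differential \<open>df\<close> of a function at \<open>p\<close>.\<close>

definition diff_fun :: "('m, 'e::euclidean_space) atlas \<Rightarrow> ('m \<Rightarrow> real) \<Rightarrow> 'm \<Rightarrow> 'm covec"
  where "diff_fun A f p = (\<lambda>v. if v \<in> tangent A p then v f else 0)"

text \<open>A one-form acts on vector fields; its value at \<open>p\<close> is the covector sending \<open>Z p\<close> to
  \<open>\<omega> Z p\<close>, which for a tensorial \<open>\<omega>\<close> does not depend on the extension \<open>Z\<close>.\<close>

definition value_at :: "('m, 'e::euclidean_space) atlas \<Rightarrow> 'm oneform \<Rightarrow> 'm \<Rightarrow> 'm covec"
where
  "value_at A \<omega> p = (\<lambda>z. if z \<in> tangent A p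
     then THE c. \<exists>Z\<in>vector_fields A. Z p = z \<and> c = \<omega> Z p else 0)"


section \<open>Singular semi-Riemannian manifolds\<close>

definition ip :: "'m metric \<Rightarrow> 'm vfield \<Rightarrow> 'm vfield \<Rightarrow> 'm \<Rightarrow> real"
  where "ip g X Y = (\<lambda>p. g p (X p) (Y p))"

definition singular_semi_riemannian ::
  "('m::{t2_space, second_countable_topology}, 'e::euclidean_space) atlas \<Rightarrow> 'm metric \<Rightarrow> bool"
where
  "singular_semi_riemannian A g \<longleftrightarrow>
     smooth_manifold A \<and>
     (\<forall>p. \<forall>v\<in>tangent A p. \<forall>w\<in>tangent A p. g p v w = g p w v) \<and>
     (\<forall>p. \<forall>u\<in>tangent A p. \<forall>v\<in>tangent A p. \<forall>w\<in>tangent A p. \<forall>a c.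
        g p (\<lambda>f. a * u f + c * v f) w = a * g p u w + c * g p v w) \<and>
     (\<forall>X\<in>vector_fields A. \<forall>Y\<in>vector_fields A. ip g X Y \<in> smooth_funs A)"

definition non_degenerate :: "('m, 'e::euclidean_space) atlas \<Rightarrow> 'm metric \<Rightarrow> bool"
where
  "non_degenerate A g \<longleftrightarrow>
     (\<forall>p. \<forall>v\<in>tangent A p. (\<forall>w\<in>tangent A p. g p v w = 0) \<longrightarrow> v = (\<lambda>f. 0))"

definition koszul :: "'m metric \<Rightarrow> 'm vfield \<Rightarrow> 'm vfield \<Rightarrow> 'm oneform"
where
  "koszul g X Y Z = (\<lambda>p. 1/2 *
     (der X (ip g Y Z) p + der Y (ip g Z X) p - der Z (ip g X Y) p
      - ip g X (lie_bracket Y Z) p + ip g Y (lie_bracket Z X) p + ip g Z (lie_bracket X Y) p))"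


subsection \<open>Contraction\<close>

definition flat :: "('m, 'e::euclidean_space) atlas \<Rightarrow> 'm metric \<Rightarrow> 'm \<Rightarrow> 'm tvec \<Rightarrow> 'm covec"
  where "flat A g p v = (\<lambda>w. if w \<in> tangent A p then g p v w else 0)"

definition bullet_space :: "('m, 'e::euclidean_space) atlas \<Rightarrow> 'm metric \<Rightarrow> 'm \<Rightarrow> 'm covec set"
  where "bullet_space A g p = flat A g p ` tangent A p"

text \<open>If \<open>g\<close> is non-degenerate, \<open>bullet_space A g p\<close> is the whole cotangent space and
  \<open>bullet_inner A g p\<close> is the inverse metric.\<close>

definition bullet_inner ::
  "('m, 'e::euclidean_space) atlas \<Rightarrow> 'm metric \<Rightarrow> 'm \<Rightarrow> 'm covec \<Rightarrow> 'm covec \<Rightarrow> real"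
where
  "bullet_inner A g p \<alpha> \<beta> = (THE c. \<exists>v\<in>tangent A p. \<exists>w\<in>tangent A p.
     \<alpha> = flat A g p v \<and> \<beta> = flat A g p w \<and> c = g p v w)"

text \<open>The rank of \<open>g\<close> at \<open>p\<close>; the first argument of \<open>vector_space.dim\<close> is the scalar
  multiplication of covectors, whose addition is the pointwise one.\<close>

definition metric_rank :: "('m, 'e::euclidean_space) atlas \<Rightarrow> 'm metric \<Rightarrow> 'm \<Rightarrow> nat"
where
  "metric_rank A g p =
     vector_space.dim (\<lambda>(c::real) (\<alpha>::'m covec) v. c * \<alpha> v) (bullet_space A g p)"

definition regular_points ::
  "('m::topological_space, 'e::euclidean_space) atlas \<Rightarrow> 'm metric \<Rightarrow> 'm set"
where
  "regular_points A g =
     {p. \<exists>S. open S \<and> p \<in> S \<and> (\<forall>q\<in>S. metric_rank A g q = metric_rank A g p)}"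

text \<open>The smooth function on the whole manifold extending the pointwise contraction of two
  one-forms with values in the spaces \<open>bullet_space\<close>; meaningful if such an extension exists.\<close>

definition contraction ::
  "('m::topological_space, 'e::euclidean_space) atlas \<Rightarrow> 'm metric \<Rightarrow>
   'm oneform \<Rightarrow> 'm oneform \<Rightarrow> 'm \<Rightarrow> real"
where
  "contraction A g \<omega> \<tau> = (THE h. h \<in> smooth_funs A \<and>
     (\<forall>p\<in>regular_points A g. h p = bullet_inner A g p (value_at A \<omega> p) (value_at A \<tau> p)))"


subsection \<open>Curvature\<close>

text \<open>The curvature formula, for an arbitrary form \<open>K\<close> in place of the Koszul form.\<close>

definition curvature_of ::
  "('m::topological_space, 'e::euclidean_space) atlas \<Rightarrow> 'm metric \<Rightarrow>
   ('m vfield \<Rightarrow> 'm vfield \<Rightarrow> 'm oneform) \<Rightarrow>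
   'm vfield \<Rightarrow> 'm vfield \<Rightarrow> 'm vfield \<Rightarrow> 'm vfield \<Rightarrow> 'm \<Rightarrow> real"
where
  "curvature_of A g K X Y Z T = (\<lambda>p.
     der X (K Y Z T) p - der Y (K X Z T) p - K (lie_bracket X Y) Z T p
     + contraction A g (K X Z) (K Y T) p - contraction A g (K Y Z) (K X T) p)"

definition riemann ::
  "('m::topological_space, 'e::euclidean_space) atlas \<Rightarrow> 'm metric \<Rightarrow>
   'm vfield \<Rightarrow> 'm vfield \<Rightarrow> 'm vfield \<Rightarrow> 'm vfield \<Rightarrow> 'm \<Rightarrow> real"
  where "riemann A g = curvature_of A g (koszul g)"

definition ssnm_koszul :: "'m metric \<Rightarrow> 'm vfield \<Rightarrow> 'm vfield \<Rightarrow> 'm vfield \<Rightarrow> 'm oneform"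
  where "ssnm_koszul g P X Y Z = (\<lambda>p. koszul g X Y Z p + ip g Y P p * ip g X Z p)"

definition ssnm_curvature ::
  "('m::topological_space, 'e::euclidean_space) atlas \<Rightarrow> 'm metric \<Rightarrow> 'm vfield \<Rightarrow>
   'm vfield \<Rightarrow> 'm vfield \<Rightarrow> 'm vfield \<Rightarrow> 'm vfield \<Rightarrow> 'm \<Rightarrow> real"
  where "ssnm_curvature A g P = curvature_of A g (ssnm_koszul g P)"


section \<open>Twisted products\<close>

definition twisted_metric ::
  "('m, 'e::euclidean_space) atlas \<Rightarrow> ('n, 'f::euclidean_space) atlas \<Rightarrow>
   'm metric \<Rightarrow> 'n metric \<Rightarrow> ('m \<times> 'n \<Rightarrow> real) \<Rightarrow> ('m \<times> 'n) metric"
where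
  "twisted_metric AB AF gB gF b = (\<lambda>(p, q) v w.
     gB p (differential AB fst v) (differential AB fst w)
     + (b (p, q))\<^sup>2 * gF q (differential AF snd v) (differential AF snd w))"

text \<open>The lift of a vector field on a factor, through the inclusions of that factor as a slice.\<close>

definition lift_base ::
  "('m, 'e::euclidean_space) atlas \<Rightarrow> ('n, 'f::euclidean_space) atlas \<Rightarrow>
   'm vfield \<Rightarrow> ('m \<times> 'n) vfield"
where
  "lift_base AB AF X = (\<lambda>(p, q). differential (prod_atlas AB AF) (\<lambda>p'. (p', q)) (X p))"

definition lift_fibre ::
  "('m, 'e::euclidean_space) atlas \<Rightarrow> ('n, 'f::euclidean_space) atlas \<Rightarrow>
   'n vfield \<Rightarrow> ('m \<times> 'n) vfield"
where
  "lift_fibre AB AF U = (\<lambda>(p, q). differential (prod_atlas AB AF) (\<lambda>q'. (p, q')) (U q))"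

text \<open>The restrictions of \<open>db\<close> at \<open>(p, q)\<close> to the tangent spaces of the factors, that is, the
  differentials of \<open>b\<close> along the slices through \<open>(p, q)\<close>.\<close>

definition db_base ::
  "('m, 'e::euclidean_space) atlas \<Rightarrow> ('m \<times> 'n \<Rightarrow> real) \<Rightarrow> 'm \<Rightarrow> 'n \<Rightarrow> 'm covec"
  where "db_base AB b p q = diff_fun AB (\<lambda>p'. b (p', q)) p"

definition db_fibre ::
  "('n, 'f::euclidean_space) atlas \<Rightarrow> ('m \<times> 'n \<Rightarrow> real) \<Rightarrow> 'm \<Rightarrow> 'n \<Rightarrow> 'n covec"
  where "db_fibre AF b p q = diff_fun AF (\<lambda>q'. b (p, q')) q"

end

theory Submission
  imports Defs
begin

text \<open>
  Wherever \<open>b \<noteq> 0\<close>, the form \<open>K(\<xi>, \<eta>, \<bullet>)\<close> of lifted fields is the flat of a vector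
  \<open>a + c + d / b\<close>, where \<open>a\<close> is tangent to \<open>B\<close>, \<open>c\<close> and \<open>d\<close> are tangent to \<open>F\<close>, all three depend
  smoothly on the point and \<open>d\<close> vanishes with \<open>b\<close> because \<open>db\<close> does.  Hence contractions, which
  contain the factor \<open>b\<^sup>2\<close> in the fibre directions, are polynomials in \<open>b\<close> and metric products of
  such components.  These polynomials are smooth and agree with the pointwise contraction
  everywhere, and the regular points are dense, so they are the contractions.  The curvature formulas
  are then polynomial identities, given that \<open>K\<close> is metric and torsion-free on both factors.

  The smoothness of \<open>a\<close>, \<open>c\<close> and \<open>d\<close> comes from Levi-Civita derivatives and partial gradients of \<open>b\<close>,
  which exist because a non-degenerate metric raises indices smoothly: tangent vectors are
  combinations of coordinate derivations by Hadamard's lemma, and the coefficients solve a linear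
  system with smooth coefficients.
\<close>

section \<open>Calculus of smooth maps\<close>

text \<open>The obstacle is the set where \<open>b\<close> vanishes: the metric degenerates there,
  and a form no longer determines a vector. The three parts keep the powers of \<open>b\<close>
  apart. On fibre vectors the form is \<open>b^2 g_F(c, .) + b g_F(d, .)\<close>, so only
  \<open>d\<close> is divided by \<open>b\<close>, and the product of two such quotients, weighted
  by \<open>b^2\<close>, is \<open>g_F(d, d')\<close>. At a zero of \<open>b\<close> the fibre
  contributes nothing to the pointwise contraction, so \<open>g_F(d, d')\<close> has to be 0 there
  as well; this is the purpose of the hypothesis on \<open>db\<close>. A second obstacle is the
  notion of tangent vector: a derivation of globally defined smooth functions, set to 0 on all
  others. Coordinates, reciprocals and Hadamard coefficients live only near a point and must be
  replaced by global smooth functions with the same germ, which is why bump functions come up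
  throughout. Finally, the partial gradients of \<open>b\<close> depend on both points, so they are
  fields along the projections and not fields on a factor.\<close>

lemma Ck_on_subset: "Ck_on k S f \<Longrightarrow> T \<subseteq> S \<Longrightarrow> Ck_on k T f"
  by (induction k arbitrary: f) (auto intro: continuous_on_subset)

text \<open>Openness matters: \<open>frechet_derivative\<close> is taken with respect to the full
  filter \<open>at x\<close>, so equality on \<open>S\<close> transfers derivatives only at interior
  points.\<close>

lemma Ck_on_cong:
  assumes "open S" and "Ck_on k S f" and "\<And>x. x \<in> S \<Longrightarrow> f x = g x"
  shows "Ck_on k S g"
  using assms(2,3)
proof (induction k arbitrary: f g)
  case 0
  then show ?case using continuous_on_cong[of S S f g] by simp
next
  case (Suc k)
  have d: "(g has_derivative frechet_derivative f (at x)) (at x)" if "x \<in> S" for x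
  proof -
    have "(f has_derivative frechet_derivative f (at x)) (at x)"
      using Suc.prems(1) that by (simp add: frechet_derivative_works)
    then show ?thesis
      by (rule has_derivative_transform_within_open[OF _ assms(1) that]) (use Suc.prems in auto)
  qed
  have "frechet_derivative g (at x) = frechet_derivative f (at x)" if "x \<in> S" for x
    using d[OF that] frechet_derivative_at by metis
  then show ?case
    using Suc.prems(1) d Suc.IH[of "\<lambda>x. frechet_derivative f (at x) _" "\<lambda>x. frechet_derivative g (at x) _"]
    by (auto simp: differentiable_def)
qed

lemma Ck_on_local:
  assumes "\<And>x. x \<in> S \<Longrightarrow> \<exists>T. open T \<and> x \<in> T \<and> Ck_on k T f"
  shows "Ck_on k S f"
  using assms
proof (induction k arbitrary: f)
  case 0
  have "isCont f x" if "x \<in> S" for x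
    using 0[OF that] continuous_on_eq_continuous_at by fastforce
  then show ?case by (simp add: continuous_at_imp_continuous_on)
next
  case (Suc k)
  show ?case
  proof (simp, intro conjI ballI allI)
    show "f differentiable at x" if "x \<in> S" for x
      using Suc.prems[OF that] by auto
    show "Ck_on k S (\<lambda>x. frechet_derivative f (at x) v)" for v
      using Suc.prems by (intro Suc.IH) fastforce
  qed
qed

lemma Ck_on_Suc_imp: "Ck_on (Suc k) S f \<Longrightarrow> Ck_on k S f"
proof (induction k arbitrary: f)
  case 0
  then show ?case
    by (auto intro!: continuous_at_imp_continuous_on differentiable_imp_continuous_within)
next
  case (Suc k)
  then show ?case by (metis Ck_on.simps(2))
qed

text \<open>By uniqueness of the derivative, an explicit family \<open>D\<close> may stand in for
  the choice term \<open>frechet_derivative\<close>; the inductive closure proofs below supply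
  \<open>D\<close> by the rules of differentiation.\<close>

lemma Ck_on_SucI:
  assumes "open S" and "\<And>x. x \<in> S \<Longrightarrow> (f has_derivative D x) (at x)"
    and "\<And>v. Ck_on k S (\<lambda>x. D x v)"
  shows "Ck_on (Suc k) S f"
proof -
  have "D x = frechet_derivative f (at x)" if "x \<in> S" for x
    using frechet_derivative_at[OF assms(2)[OF that]] .
  then show ?thesis
    using assms Ck_on_cong[OF assms(1,3)] by (auto simp: differentiable_def)
qed

lemma Ck_on_derivative:
  "Ck_on (Suc k) S f \<Longrightarrow> x \<in> S \<Longrightarrow> (f has_derivative frechet_derivative f (at x)) (at x)"
  by (simp add: frechet_derivative_works)

lemma Ck_on_const: "open S \<Longrightarrow> Ck_on k S (\<lambda>x. c)"
proof (induction k arbitrary: c)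
  case (Suc k)
  show ?case
    by (rule Ck_on_SucI[where D = "\<lambda>_ _. 0"]) (use Suc in auto)
qed auto

lemma Ck_on_bounded_linear: "open S \<Longrightarrow> bounded_linear L \<Longrightarrow> Ck_on k S L"
proof (induction k)
  case (Suc k)
  then show ?case
    by (intro Ck_on_SucI[where D = "\<lambda>_. L"])
      (auto simp: Ck_on_const bounded_linear_imp_has_derivative)
qed (auto intro: linear_continuous_on)

lemma Ck_on_add:
  "open S \<Longrightarrow> Ck_on k S f \<Longrightarrow> Ck_on k S g \<Longrightarrow> Ck_on k S (\<lambda>x. f x + g x)"
proof (induction k arbitrary: f g)
  case (Suc k)
  show ?case
    by (rule Ck_on_SucI[where D =
          "\<lambda>x v. frechet_derivative f (at x) v + frechet_derivative g (at x) v"])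
      (use Suc in \<open>auto intro!: derivative_intros simp: frechet_derivative_works[symmetric]\<close>)
qed (simp add: continuous_on_add)

lemma Ck_on_bilinear:
  assumes "bounded_bilinear bop" and "open S"
  shows "Ck_on k S f \<Longrightarrow> Ck_on k S g \<Longrightarrow> Ck_on k S (\<lambda>x. bop (f x) (g x))"
proof (induction k arbitrary: f g)
  case 0
  then show ?case using bounded_bilinear.continuous_on[OF assms(1)] by auto
next
  case (Suc k)
  show ?case
  proof (rule Ck_on_SucI[OF assms(2)])
    show "((\<lambda>x. bop (f x) (g x)) has_derivative
        (\<lambda>v. bop (f x) (frechet_derivative g (at x) v)
            + bop (frechet_derivative f (at x) v) (g x))) (at x)" if "x \<in> S" for x
      using Suc.prems that
      by (intro bounded_bilinear.FDERIV[OF assms(1)]) (auto simp: frechet_derivative_works[symmetric])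
    show "Ck_on k S (\<lambda>x. bop (f x) (frechet_derivative g (at x) v)
            + bop (frechet_derivative f (at x) v) (g x))" for v
      using Suc.prems Ck_on_Suc_imp[OF Suc.prems(1)] Ck_on_Suc_imp[OF Suc.prems(2)]
      by (intro Ck_on_add[OF assms(2)] Suc.IH) auto
  qed
qed

lemma Ck_on_sum:
  "open S \<Longrightarrow> (\<And>i. i \<in> I \<Longrightarrow> Ck_on k S (f i)) \<Longrightarrow> Ck_on k S (\<lambda>x. \<Sum>i\<in>I. f i x)"
  by (induction I rule: infinite_finite_induct) (auto intro: Ck_on_const Ck_on_add)

lemma Ck_on_linear_compose:
  assumes "bounded_linear L" and "open S"
  shows "Ck_on k S f \<Longrightarrow> Ck_on k S (\<lambda>x. L (f x))"
proof (induction k arbitrary: f)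
  case 0
  then show ?case using bounded_linear.continuous_on[OF assms(1)] by auto
next
  case (Suc k)
  show ?case
  proof (rule Ck_on_SucI[OF assms(2)])
    show "((\<lambda>x. L (f x)) has_derivative (\<lambda>v. L (frechet_derivative f (at x) v))) (at x)"
      if "x \<in> S" for x
      using Suc.prems that
      by (intro bounded_linear.has_derivative[OF assms(1)]) (auto simp: frechet_derivative_works[symmetric])
    show "Ck_on k S (\<lambda>x. L (frechet_derivative f (at x) v))" for v
      using Suc by simp
  qed
qed

lemma Ck_on_componentwise:
  fixes f :: "'a::real_normed_vector \<Rightarrow> 'b::euclidean_space"
  assumes "open S" and "\<And>i. i \<in> Basis \<Longrightarrow> Ck_on k S (\<lambda>x. f x \<bullet> i)"
  shows "Ck_on k S f"
proof -
  have "Ck_on k S (\<lambda>x. \<Sum>i\<in>Basis. (f x \<bullet> i) *\<^sub>R i)"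
    by (rule Ck_on_sum[OF assms(1)])
      (use Ck_on_linear_compose[OF bounded_linear_scaleR_left assms(1) assms(2)] in auto)
  then show ?thesis by (simp add: euclidean_representation)
qed

lemma has_derivative_Basis:
  fixes f :: "'a::euclidean_space \<Rightarrow> 'b::real_normed_vector"
  assumes "(f has_derivative D) (at x)"
  shows "D v = (\<Sum>i\<in>Basis. (v \<bullet> i) *\<^sub>R D i)"
proof -
  interpret linear D using assms by (rule has_derivative_linear)
  have "D v = D (\<Sum>i\<in>Basis. (v \<bullet> i) *\<^sub>R i)"
    by (simp add: euclidean_representation)
  then show ?thesis by (simp add: sum scale)
qed

text \<open>The chain rule differentiates \<open>f\<close> at \<open>g x\<close> in a direction that
  moves with \<open>x\<close>, whereas \<open>Ck_on\<close> and the induction hypothesis speak of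
  fixed directions. Expanding the moving direction in the basis gives a finite sum of products to
  which the hypothesis applies.\<close>

lemma Ck_on_compose:
  fixes f :: "'b::euclidean_space \<Rightarrow> 'c::real_normed_vector"
    and g :: "'a::real_normed_vector \<Rightarrow> 'b"
  assumes "open S" and "g ` S \<subseteq> T"
  shows "Ck_on k S g \<Longrightarrow> Ck_on k T f \<Longrightarrow> Ck_on k S (\<lambda>x. f (g x))"
proof (induction k arbitrary: f)
  case 0
  then show ?case using assms(2) continuous_on_compose2 by (metis Ck_on.simps(1))
next
  case (Suc k)
  define D where "D x v = (\<Sum>i\<in>Basis. (frechet_derivative g (at x) v \<bullet> i) *\<^sub>R
      frechet_derivative f (at (g x)) i)" for x v
  have "Ck_on (Suc k) S (\<lambda>x. f (g x))"
  proof (rule Ck_on_SucI[OF assms(1)])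
    fix x assume x: "x \<in> S"
    have f': "(f has_derivative frechet_derivative f (at (g x))) (at (g x))"
      using Suc.prems x assms(2) Ck_on_derivative by blast
    have comp: "((\<lambda>x. f (g x)) has_derivative
        (\<lambda>v. frechet_derivative f (at (g x)) (frechet_derivative g (at x) v))) (at x)"
      by (rule has_derivative_compose[OF Ck_on_derivative[OF Suc.prems(1) x] f'])
    have "D x = (\<lambda>v. frechet_derivative f (at (g x)) (frechet_derivative g (at x) v))"
      unfolding D_def by (intro ext) (rule has_derivative_Basis[OF f', symmetric])
    then show "((\<lambda>x. f (g x)) has_derivative D x) (at x)"
      using comp by simp
  next
    fix v
    have g: "Ck_on k S g" using Suc.prems(1) by (rule Ck_on_Suc_imp)
    show "Ck_on k S (\<lambda>x. D x v)" unfolding D_def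
    proof (intro Ck_on_sum Ck_on_bilinear[OF bounded_bilinear_scaleR] assms(1))
      show "Ck_on k S (\<lambda>x. frechet_derivative f (at (g x)) i)" for i
        using Suc.IH[OF g, of "\<lambda>y. frechet_derivative f (at y) i"] Suc.prems(2) by simp
      show "Ck_on k S (\<lambda>x. frechet_derivative g (at x) v \<bullet> i)" for i
        using Suc.prems(1) by (intro Ck_on_linear_compose[OF bounded_linear_inner_left assms(1)]) simp
    qed
  qed
  then show ?case .
qed

text \<open>The derivative of \<open>1 / f\<close> is a product of \<open>1 / f\<close> twice with
  the derivative of \<open>f\<close>, so one order less of \<open>1 / f\<close> is enough for the
  induction.\<close>

lemma Ck_on_inverse:
  fixes f :: "'a::real_normed_vector \<Rightarrow> real"
  assumes "open S" and "\<And>x. x \<in> S \<Longrightarrow> f x \<noteq> 0"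
  shows "Ck_on k S f \<Longrightarrow> Ck_on k S (\<lambda>x. inverse (f x))"
proof (induction k)
  case 0
  then show ?case using assms by (simp add: continuous_on_inverse)
next
  case (Suc k)
  have i: "Ck_on k S (\<lambda>x. inverse (f x))" using Suc Ck_on_Suc_imp by blast
  show ?case
  proof (rule Ck_on_SucI[OF assms(1)])
    show "((\<lambda>x. inverse (f x)) has_derivative
       (\<lambda>v. - (inverse (f x) * frechet_derivative f (at x) v * inverse (f x)))) (at x)"
      if "x \<in> S" for x
      using Suc.prems that assms(2)
      by (intro Deriv.has_derivative_inverse) (auto simp: frechet_derivative_works[symmetric])
    show "Ck_on k S (\<lambda>x. - (inverse (f x) * frechet_derivative f (at x) v * inverse (f x)))" for v
      using Suc.prems i
      by (intro Ck_on_linear_compose[OF bounded_linear_minus[OF bounded_linear_ident]]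
          Ck_on_bilinear[OF bounded_bilinear_mult] assms(1)) auto
  qed
qed

section \<open>Closure properties for all orders at once\<close>

lemma smooth_on_subset: "smooth_on S f \<Longrightarrow> T \<subseteq> S \<Longrightarrow> smooth_on T f"
  unfolding smooth_on_def using Ck_on_subset by blast

lemma smooth_on_cong:
  "open S \<Longrightarrow> smooth_on S f \<Longrightarrow> (\<And>x. x \<in> S \<Longrightarrow> f x = g x) \<Longrightarrow> smooth_on S g"
  unfolding smooth_on_def using Ck_on_cong by blast

lemma smooth_on_local:
  "(\<And>x. x \<in> S \<Longrightarrow> \<exists>T. open T \<and> x \<in> T \<and> smooth_on T f) \<Longrightarrow> smooth_on S f"
  unfolding smooth_on_def using Ck_on_local by metis

lemma smooth_on_const: "open S \<Longrightarrow> smooth_on S (\<lambda>x. c)"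
  unfolding smooth_on_def using Ck_on_const by blast

lemma smooth_on_bounded_linear: "open S \<Longrightarrow> bounded_linear L \<Longrightarrow> smooth_on S L"
  unfolding smooth_on_def using Ck_on_bounded_linear by blast

lemma smooth_on_add:
  "open S \<Longrightarrow> smooth_on S f \<Longrightarrow> smooth_on S g \<Longrightarrow> smooth_on S (\<lambda>x. f x + g x)"
  unfolding smooth_on_def using Ck_on_add by blast

lemma smooth_on_mult:
  fixes f g :: "'a::real_normed_vector \<Rightarrow> real"
  shows "open S \<Longrightarrow> smooth_on S f \<Longrightarrow> smooth_on S g \<Longrightarrow> smooth_on S (\<lambda>x. f x * g x)"
  unfolding smooth_on_def using Ck_on_bilinear[OF bounded_bilinear_mult] by blast

lemma smooth_on_inner:
  fixes f g :: "'a::real_normed_vector \<Rightarrow> 'b::real_inner"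
  shows "open S \<Longrightarrow> smooth_on S f \<Longrightarrow> smooth_on S g \<Longrightarrow> smooth_on S (\<lambda>x. f x \<bullet> g x)"
  unfolding smooth_on_def using Ck_on_bilinear[OF bounded_bilinear_inner] by blast

lemma smooth_on_inverse:
  fixes f :: "'a::real_normed_vector \<Rightarrow> real"
  shows "open S \<Longrightarrow> smooth_on S f \<Longrightarrow> (\<And>x. x \<in> S \<Longrightarrow> f x \<noteq> 0) \<Longrightarrow> smooth_on S (\<lambda>x. inverse (f x))"
  unfolding smooth_on_def using Ck_on_inverse by blast

lemma smooth_on_compose:
  fixes f :: "'b::euclidean_space \<Rightarrow> 'c::real_normed_vector"
    and g :: "'a::real_normed_vector \<Rightarrow> 'b"
  shows "open S \<Longrightarrow> g ` S \<subseteq> T \<Longrightarrow> smooth_on S g \<Longrightarrow> smooth_on T f \<Longrightarrow> smooth_on S (\<lambda>x. f (g x))"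
  unfolding smooth_on_def using Ck_on_compose by blast

lemma smooth_on_Pair:
  fixes f :: "'a::real_normed_vector \<Rightarrow> 'b::euclidean_space" and g :: "'a \<Rightarrow> 'c::euclidean_space"
  assumes "open S" and "smooth_on S f" and "smooth_on S g"
  shows "smooth_on S (\<lambda>x. (f x, g x))"
  unfolding smooth_on_def
proof (rule allI, rule Ck_on_componentwise[OF assms(1)])
  fix k :: nat and i :: "'b \<times> 'c"
  have "Ck_on k S (\<lambda>x. f x \<bullet> fst i + g x \<bullet> snd i)"
    using assms(2,3) unfolding smooth_on_def
    by (intro Ck_on_add[OF assms(1)]
        Ck_on_linear_compose[OF bounded_linear_inner_left[of "fst i"] assms(1)]
        Ck_on_linear_compose[OF bounded_linear_inner_left[of "snd i"] assms(1)]) simp_all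
  then show "Ck_on k S (\<lambda>x. (f x, g x) \<bullet> i)"
    by (simp only: inner_prod_def fst_conv snd_conv)
qed

lemma smooth_on_frechet:
  assumes "smooth_on S f"
  shows "smooth_on S (\<lambda>x. frechet_derivative f (at x) v)"
  using assms unfolding smooth_on_def by (metis Ck_on.simps(2))

lemma smooth_on_has_derivative:
  "smooth_on S f \<Longrightarrow> x \<in> S \<Longrightarrow> (f has_derivative frechet_derivative f (at x)) (at x)"
  unfolding smooth_on_def by (metis Ck_on_derivative)

lemma smooth_on_imp_continuous_on: "smooth_on S f \<Longrightarrow> continuous_on S f"
  unfolding smooth_on_def by (metis Ck_on.simps(1))

subsection \<open>Bump functions\<close>

text \<open>The functions \<open>exp(-1/t) / t^n\<close>, continued by 0. Their span is closed under
  differentiation, while \<open>n = 0\<close> alone is not; smoothness follows by an induction over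
  all \<open>n\<close> simultaneously.\<close>

definition flat_exp :: "nat \<Rightarrow> real \<Rightarrow> real"
  where "flat_exp n t = (if t \<le> 0 then 0 else exp (- inverse t) * inverse t ^ n)"

text \<open>A single term \<open>u^(n+1) / (n+1)!\<close> of the exponential series bounds
  \<open>exp u\<close> from below at \<open>u = 1/t\<close>. The resulting linear bound controls the
  difference quotient at 0.\<close>

lemma flat_exp_bound: "\<bar>flat_exp n t\<bar> \<le> fact (Suc n) * \<bar>t\<bar>"
proof (cases "t \<le> 0")
  case False
  define u where "u = inverse t"
  have u: "u > 0" "t = inverse u" using False by (auto simp: u_def)
  have "(\<Sum>k\<in>{Suc n}. u ^ k /\<^sub>R fact k) \<le> (\<Sum>k. u ^ k /\<^sub>R fact k)"
    using u(1) summable_exp_generic[of u] by (intro sum_le_suminf) auto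
  then have "u ^ Suc n \<le> fact (Suc n) * exp u"
    by (simp add: exp_def field_simps del: fact_Suc)
  then have "exp (- u) * u ^ n \<le> fact (Suc n) * inverse u"
    using u(1) by (simp add: exp_minus field_simps del: fact_Suc)
  then show ?thesis using False u by (simp add: flat_exp_def abs_mult del: fact_Suc flip: u_def)
qed (simp add: flat_exp_def mult_nonneg_nonpos)

lemma flat_exp_deriv:
  "(flat_exp n has_real_derivative flat_exp (n + 2) t - real n * flat_exp (n + 1) t) (at t)"
proof -
  consider "t < 0" | "t > 0" | "t = 0" by linarith
  then show ?thesis
  proof cases
    case 1
    have "((\<lambda>t. 0) has_real_derivative flat_exp (n + 2) t - real n * flat_exp (n + 1) t) (at t)"
      using 1 by (simp add: flat_exp_def)
    then show ?thesis
      by (rule has_field_derivative_transform_within_open[where S = "{..<0}"])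
        (use 1 in \<open>auto simp: flat_exp_def\<close>)
  next
    case 2
    have "((\<lambda>t. exp (- inverse t) * inverse t ^ n) has_real_derivative
        exp (- inverse t) * inverse t ^ 2 * inverse t ^ n
        - exp (- inverse t) * (real n * inverse t ^ (n - 1) * inverse t ^ 2)) (at t)"
      using 2 by (auto intro!: derivative_eq_intros simp: power2_eq_square algebra_simps)
    also have "exp (- inverse t) * inverse t ^ 2 * inverse t ^ n
        - exp (- inverse t) * (real n * inverse t ^ (n - 1) * inverse t ^ 2)
        = flat_exp (n + 2) t - real n * flat_exp (n + 1) t"
      using 2 by (cases n) (simp_all add: flat_exp_def power2_eq_square)
    finally show ?thesis
      by (rule has_field_derivative_transform_within_open[where S = "{0<..}"])
        (use 2 in \<open>auto simp: flat_exp_def\<close>)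
  next
    case 3
    have "((\<lambda>h. fact (Suc (Suc n)) * \<bar>h\<bar>) \<longlongrightarrow> fact (Suc (Suc n)) * \<bar>0\<bar>) (at (0::real))"
      by (intro tendsto_intros)
    then have z: "((\<lambda>h. fact (Suc (Suc n)) * \<bar>h\<bar>) \<longlongrightarrow> 0) (at (0::real))" by simp
    have "\<forall>\<^sub>F h in at 0. norm ((flat_exp n (0 + h) - flat_exp n 0) / h) \<le> fact (Suc (Suc n)) * \<bar>h\<bar>"
    proof (rule always_eventually, rule allI)
      fix h
      \<comment> \<open>Division by \<open>h\<close> raises the exponent by one, so the quotient
        stays in the family and the bound sends it to 0.\<close>
      have "(flat_exp n (0 + h) - flat_exp n 0) / h = flat_exp (Suc n) h"
        by (simp add: flat_exp_def field_simps)
      then show "norm ((flat_exp n (0 + h) - flat_exp n 0) / h) \<le> fact (Suc (Suc n)) * \<bar>h\<bar>"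
        using flat_exp_bound[of "Suc n" h] by simp
    qed
    then have "((\<lambda>h. (flat_exp n (0 + h) - flat_exp n 0) / h) \<longlongrightarrow> 0) (at 0)"
      using z by (rule Lim_null_comparison)
    then show ?thesis using 3 by (simp add: DERIV_def flat_exp_def)
  qed
qed

lemma smooth_flat_exp: "smooth_on UNIV (flat_exp n)"
proof -
  have "Ck_on k UNIV (flat_exp n)" for k
  proof (induction k arbitrary: n)
    case 0
    show ?case
      using DERIV_isCont[OF flat_exp_deriv] by (simp add: continuous_at_imp_continuous_on)
  next
    case (Suc k)
    have "Ck_on k UNIV (\<lambda>x. flat_exp (n + 2) x + (- real n) * flat_exp (n + 1) x)"
      by (intro Ck_on_add Ck_on_bilinear[OF bounded_bilinear_mult] Ck_on_const Suc open_UNIV)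
    then have *: "Ck_on k UNIV (\<lambda>x. (flat_exp (n + 2) x - real n * flat_exp (n + 1) x) * v)" for v
      by (intro Ck_on_bilinear[OF bounded_bilinear_mult] Ck_on_const) simp_all
    show ?case
      by (rule Ck_on_SucI[OF open_UNIV _ *])
        (use flat_exp_deriv in \<open>auto simp: has_field_derivative_def\<close>)
  qed
  then show ?thesis by (simp add: smooth_on_def)
qed

text \<open>The usual quotient of \<open>e(2r - t)\<close> by \<open>e(2r - t) + e(t - r)\<close>.
  Since \<open>r > 0\<close>, at least one of the two arguments is positive, so the denominator
  never vanishes.\<close>

lemma smooth_cutoff:
  fixes r :: real
  assumes "0 < r"
  shows "\<exists>s::real \<Rightarrow> real. smooth_on UNIV s \<and> (\<forall>t\<le>r. s t = 1) \<and> (\<forall>t\<ge>2 * r. s t = 0)"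
proof -
  let ?e = "flat_exp 0"
  define s where "s t = ?e (2 * r - t) * inverse (?e (2 * r - t) + ?e (t - r))" for t
  have nn: "?e t \<ge> 0" and pos: "t > 0 \<Longrightarrow> ?e t > 0" for t by (auto simp: flat_exp_def)
  have ne: "?e (2 * r - t) + ?e (t - r) \<noteq> 0" for t
  proof (cases "t < 2 * r")
    case True
    then show ?thesis using pos[of "2 * r - t"] nn[of "t - r"] by simp
  next
    case False
    then show ?thesis using pos[of "t - r"] nn[of "2 * r - t"] assms by simp
  qed
  have lin: "smooth_on UNIV (\<lambda>t::real. c * t + d)" for c d
    by (intro smooth_on_add smooth_on_const smooth_on_bounded_linear bounded_linear_mult_right open_UNIV)
  have "smooth_on UNIV (\<lambda>t. ?e (c * t + d))" for c d
    by (rule smooth_on_compose[OF open_UNIV _ lin smooth_flat_exp]) simp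
  from this[of "-1" "2 * r"] this[of 1 "-r"]
  have "smooth_on UNIV (\<lambda>t. ?e (2 * r - t))" "smooth_on UNIV (\<lambda>t. ?e (t - r))"
    by (simp_all add: algebra_simps)
  then have "smooth_on UNIV s" unfolding s_def
    by (intro smooth_on_mult smooth_on_inverse smooth_on_add open_UNIV ne)
  moreover have "s t = 1" if "t \<le> r" for t
    using that ne[of t] by (simp add: s_def flat_exp_def)
  moreover have "s t = 0" if "t \<ge> 2 * r" for t
    using that by (simp add: s_def flat_exp_def)
  ultimately show ?thesis by blast
qed

text \<open>The cutoff is applied to the squared distance, which is smooth at the centre too. With
  parameter \<open>r^2/4\<close> it is 1 up to squared distance \<open>r^2/4\<close> and 0 from
  \<open>r^2/2\<close> on, well below \<open>r^2\<close>.\<close>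

lemma smooth_bump_ball:
  fixes a :: "'a::euclidean_space"
  assumes "0 < r"
  shows "\<exists>\<rho>::'a \<Rightarrow> real. smooth_on UNIV \<rho> \<and> (\<forall>x\<in>ball a (r / 2). \<rho> x = 1) \<and> (\<forall>x. x \<notin> cball a r \<longrightarrow> \<rho> x = 0)"
proof -
  obtain s :: "real \<Rightarrow> real" where s: "smooth_on UNIV s" "\<And>t. t \<le> r\<^sup>2 / 4 \<Longrightarrow> s t = 1"
    "\<And>t. t \<ge> r\<^sup>2 / 2 \<Longrightarrow> s t = 0"
    using smooth_cutoff[of "r\<^sup>2 / 4"] assms by auto
  have lin: "smooth_on UNIV (\<lambda>x. x + (- a))"
    by (intro smooth_on_add smooth_on_const smooth_on_bounded_linear bounded_linear_ident open_UNIV)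
  have "smooth_on UNIV (\<lambda>x. s ((x + (- a)) \<bullet> (x + (- a))))"
    by (rule smooth_on_compose[OF open_UNIV _ smooth_on_inner[OF open_UNIV lin lin] s(1)]) simp
  moreover have "s ((x + (- a)) \<bullet> (x + (- a))) = 1" if "x \<in> ball a (r / 2)" for x
  proof -
    have "(norm (x - a))\<^sup>2 \<le> (r / 2)\<^sup>2"
      using that by (intro power_mono) (auto simp: dist_norm norm_minus_commute)
    then show ?thesis
      by (intro s(2)) (simp add: power2_norm_eq_inner power_divide)
  qed
  moreover have "s ((x + (- a)) \<bullet> (x + (- a))) = 0" if "x \<notin> cball a r" for x
  proof -
    have "r\<^sup>2 \<le> (norm (x - a))\<^sup>2"
      using that assms by (intro power_mono) (auto simp: dist_norm norm_minus_commute)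
    then have "r\<^sup>2 / 2 \<le> (x - a) \<bullet> (x - a)"
      using inner_ge_zero[of "x - a"] unfolding power2_norm_eq_inner by linarith
    then show ?thesis
      by (intro s(3)) simp
  qed
  ultimately show ?thesis by blast
qed

subsection \<open>Hadamard's lemma\<close>

lemma ray_in_ball:
  fixes a :: "'a::real_normed_vector"
  assumes "y \<in> ball a r" and "t \<in> cbox 0 (1 :: real)"
  shows "a + t *\<^sub>R (y - a) \<in> ball a r"
proof -
  have "\<bar>t\<bar> * norm (y - a) \<le> 1 * norm (y - a)"
    using assms(2) by (intro mult_right_mono) auto
  then show ?thesis using assms(1) by (auto simp: dist_norm norm_minus_commute)
qed

text \<open>Differentiation under the integral sign brings out a factor \<open>t\<close> by the
  chain rule, so the statement carries a weight \<open>t^m\<close> with arbitrary \<open>m\<close>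
  for the induction on \<open>k\<close> to close.\<close>

lemma Ck_on_ray_integral:
  fixes a :: "'a::euclidean_space" and h :: "'a \<Rightarrow> real"
  assumes "smooth_on (ball a r) h"
  shows "Ck_on k (ball a r) (\<lambda>y. integral (cbox 0 1) (\<lambda>t. t ^ m * h (a + t *\<^sub>R (y - a))))"
  using assms
proof (induction k arbitrary: h m)
  note ray = ray_in_ball[of _ a r]
  have cont: "continuous_on (ball a r \<times> cbox 0 1) (\<lambda>(y, t). t ^ n * f (a + t *\<^sub>R (y - a)))"
    if "smooth_on (ball a r) f" for f :: "'a \<Rightarrow> real" and n
  proof -
    have "continuous_on (ball a r \<times> cbox 0 1) (\<lambda>p. f (a + snd p *\<^sub>R (fst p - a)))"
      by (rule continuous_on_compose2[OF smooth_on_imp_continuous_on[OF that]])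
        (use ray in \<open>auto intro!: continuous_intros\<close>)
    then show ?thesis
      unfolding split_beta by (intro continuous_intros) auto
  qed
  {
    case 0
    show ?case
      using integral_continuous_on_param[OF cont[OF 0]] by simp
  next
    case (Suc k)
    note h = Suc.prems
    let ?D = "\<lambda>x. frechet_derivative h (at x)"
    \<comment> \<open>The Leibniz rule wants the derivative as a bounded linear function that
      depends continuously on \<open>(y, t)\<close>; it is assembled from inner products with basis
      vectors, with partial derivatives as coefficients.\<close>
    define fx where "fx y t = (\<Sum>i\<in>Basis. (t ^ Suc m * ?D (a + t *\<^sub>R (y - a)) i) *\<^sub>R blinfun_inner_left i)"
      for y and t :: real
    have D_lin: "bounded_linear (?D x)" if "x \<in> ball a r" for x
      using smooth_on_has_derivative[OF h that] has_derivative_bounded_linear by blast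
    have fx_apply: "blinfun_apply (fx y t) v = t ^ Suc m * ?D (a + t *\<^sub>R (y - a)) v"
      if "y \<in> ball a r" "t \<in> cbox 0 1" for y t v
      using has_derivative_Basis[OF smooth_on_has_derivative[OF h ray[OF that]], of v]
      by (simp add: fx_def blinfun.sum_left blinfun.scaleR_left sum_distrib_left mult_ac inner_commute)
    show ?case
    proof (rule Ck_on_SucI[OF open_ball])
      fix v
      show "Ck_on k (ball a r) (\<lambda>y. integral (cbox 0 1)
          (\<lambda>t. t ^ Suc m * (\<lambda>x. ?D x v) (a + t *\<^sub>R (y - a))))"
        by (rule Suc.IH[OF smooth_on_frechet[OF h]])
    next
      fix y assume y: "y \<in> ball a r"
      have c: "continuous_on (ball a r \<times> cbox 0 1) (\<lambda>(y, t). fx y t)"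
        unfolding fx_def split_beta
        by (intro continuous_on_sum continuous_on_scaleR continuous_on_const
            cont[OF smooth_on_frechet[OF h], unfolded split_beta])
      have int: "(\<lambda>t. t ^ m * h (a + t *\<^sub>R (y - a))) integrable_on cbox 0 1" if "y \<in> ball a r" for y
        by (intro integrable_continuous continuous_on_compose2[OF cont[OF h, of m], where f = "\<lambda>t. (y, t)", simplified])
          (use that in \<open>auto intro!: continuous_intros\<close>)
      have "((\<lambda>y. integral (cbox 0 1) (\<lambda>t. t ^ m * h (a + t *\<^sub>R (y - a)))) has_derivative
          blinfun_apply (integral (cbox 0 1) (fx y))) (at y within ball a r)"
      proof (rule leibniz_rule[OF _ int c y convex_ball])
        fix y t assume yt: "y \<in> ball a r" "t \<in> cbox (0::real) 1"
        have "((\<lambda>y. a + t *\<^sub>R (y - a)) has_derivative (\<lambda>v. t *\<^sub>R v)) (at y)"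
          by (auto intro!: derivative_eq_intros)
        from has_derivative_compose[OF this smooth_on_has_derivative[OF h ray[OF yt]]]
        have "((\<lambda>y. t ^ m * h (a + t *\<^sub>R (y - a))) has_derivative
            (\<lambda>v. t ^ m * ?D (a + t *\<^sub>R (y - a)) (t *\<^sub>R v))) (at y)"
          by (rule has_derivative_mult_right)
        moreover have "(\<lambda>v. t ^ m * ?D (a + t *\<^sub>R (y - a)) (t *\<^sub>R v)) = blinfun_apply (fx y t)"
          using fx_apply[OF yt] bounded_linear.linear[OF D_lin[OF ray[OF yt]]]
          by (auto simp: linear_cmul)
        ultimately show "((\<lambda>y. t ^ m * h (a + t *\<^sub>R (y - a))) has_derivative blinfun_apply (fx y t))
            (at y within ball a r)"
          using has_derivative_at_withinI by metis
      qed
      moreover have "blinfun_apply (integral (cbox 0 1) (fx y)) v =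
          integral (cbox 0 1) (\<lambda>t. t ^ Suc m * (\<lambda>x. ?D x v) (a + t *\<^sub>R (y - a)))" for v
      proof -
        have "fx y integrable_on cbox 0 1"
          by (intro integrable_continuous continuous_on_compose2[OF c, where f = "\<lambda>t. (y, t)", simplified])
            (use y in \<open>auto intro!: continuous_intros\<close>)
        then have "blinfun_apply (integral (cbox 0 1) (fx y)) v = integral (cbox 0 1) (\<lambda>t. fx y t v)"
          by (rule blinfun_apply_integral)
        also have "\<dots> = integral (cbox 0 1) (\<lambda>t. t ^ Suc m * (\<lambda>x. ?D x v) (a + t *\<^sub>R (y - a)))"
          by (rule Henstock_Kurzweil_Integration.integral_cong) (use fx_apply[OF y] in simp)
        finally show ?thesis .
      qed
      ultimately show "((\<lambda>y. integral (cbox 0 1) (\<lambda>t. t ^ m * h (a + t *\<^sub>R (y - a)))) has_derivative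
          (\<lambda>v. integral (cbox 0 1) (\<lambda>t. t ^ Suc m * (\<lambda>x. ?D x v) (a + t *\<^sub>R (y - a))))) (at y)"
        using at_within_open[OF y open_ball] by (metis (no_types, lifting) ext)
    qed
  }
qed

text \<open>Integrate the derivative of \<open>f\<close> along the segment from \<open>a\<close> to
  \<open>y\<close>: the coefficient \<open>g i y\<close> is the mean of the partial derivative over
  the segment, hence smooth in \<open>y\<close> and equal to the partial derivative at
  \<open>y = a\<close>.\<close>

lemma hadamard:
  fixes a :: "'a::euclidean_space" and f :: "'a \<Rightarrow> real"
  assumes "smooth_on (ball a r) f" and "0 < r"
  shows "\<exists>g. (\<forall>i\<in>Basis. smooth_on (ball a r) (g i) \<and> g i a = frechet_derivative f (at a) i) \<and>
      (\<forall>y\<in>ball a r. f y = f a + (\<Sum>i\<in>Basis. ((y - a) \<bullet> i) * g i y))"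
proof -
  let ?D = "\<lambda>x. frechet_derivative f (at x)"
  define g where "g i y = integral (cbox 0 1) (\<lambda>t::real. t ^ 0 * (\<lambda>x. ?D x i) (a + t *\<^sub>R (y - a)))" for i y
  have sm: "smooth_on (ball a r) (g i)" for i
    unfolding smooth_on_def g_def using Ck_on_ray_integral[OF smooth_on_frechet[OF assms(1)]] by blast
  have ga: "g i a = ?D a i" for i
    by (simp add: g_def)
  have "f y = f a + (\<Sum>i\<in>Basis. ((y - a) \<bullet> i) * g i y)" if y: "y \<in> ball a r" for y
  proof -
    note ray = ray_in_ball[OF y]
    have "((\<lambda>t. ?D (a + t *\<^sub>R (y - a)) (y - a)) has_integral
        f (a + 1 *\<^sub>R (y - a)) - f (a + 0 *\<^sub>R (y - a))) {0..1}"
    proof (rule fundamental_theorem_of_calculus)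
      fix t :: real assume t: "t \<in> {0..1}"
      have "((\<lambda>t. a + t *\<^sub>R (y - a)) has_derivative (\<lambda>s. s *\<^sub>R (y - a))) (at t)"
        by (auto intro!: derivative_eq_intros)
      from has_derivative_compose[OF this smooth_on_has_derivative[OF assms(1) ray]] t
      have d: "((\<lambda>t. f (a + t *\<^sub>R (y - a))) has_derivative
          (\<lambda>s. ?D (a + t *\<^sub>R (y - a)) (s *\<^sub>R (y - a)))) (at t)" by auto
      interpret bounded_linear "?D (a + t *\<^sub>R (y - a))"
        using smooth_on_has_derivative[OF assms(1) ray] has_derivative_bounded_linear t by auto
      show "((\<lambda>t. f (a + t *\<^sub>R (y - a))) has_vector_derivative ?D (a + t *\<^sub>R (y - a)) (y - a))
          (at t within {0..1})"
        using d unfolding has_vector_derivative_def scaleR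
        by (rule has_derivative_at_withinI)
    qed simp
    then have "integral (cbox 0 1) (\<lambda>t. ?D (a + t *\<^sub>R (y - a)) (y - a)) = f y - f a"
      by (simp add: integral_unique)
    moreover have "integral (cbox 0 1) (\<lambda>t. ?D (a + t *\<^sub>R (y - a)) (y - a)) =
        integral (cbox 0 1) (\<lambda>t. \<Sum>i\<in>Basis. ((y - a) \<bullet> i) * ?D (a + t *\<^sub>R (y - a)) i)"
      by (rule Henstock_Kurzweil_Integration.integral_cong) (use has_derivative_Basis[OF smooth_on_has_derivative[OF assms(1) ray]] in \<open>simp flip: real_scaleR_def\<close>)
    moreover have "\<dots> = (\<Sum>i\<in>Basis. ((y - a) \<bullet> i) * g i y)"
    proof -
      have "continuous_on (cbox 0 1) (\<lambda>t::real. ?D (a + t *\<^sub>R (y - a)) i)" for i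
        by (rule continuous_on_compose2[OF smooth_on_imp_continuous_on[OF smooth_on_frechet[OF assms(1)]]])
          (use ray in \<open>auto intro!: continuous_intros\<close>)
      from integrable_continuous[OF this]
      have "(\<lambda>t. ((y - a) \<bullet> i) * ?D (a + t *\<^sub>R (y - a)) i) integrable_on cbox 0 1" for i
        by (rule integrable_on_mult_right)
      then show ?thesis
        by (subst Henstock_Kurzweil_Integration.integral_sum) (simp_all add: g_def)
    qed
    ultimately show ?thesis by simp
  qed
  then show ?thesis using sm ga by blast
qed

section \<open>Smooth functions and tangent vectors on a manifold\<close>

locale smooth_mfd =
  fixes A :: "('m::{t2_space, second_countable_topology}, 'e::euclidean_space) atlas"
  assumes mfd: "smooth_manifold A"
begin

abbreviation "SF \<equiv> smooth_funs A"
abbreviation "VF \<equiv> vector_fields A"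

section \<open>Charts and smoothness near a point\<close>

lemma chart_cover: "\<exists>U \<phi>. (U, \<phi>) \<in> A \<and> p \<in> U"
proof -
  have "p \<in> (\<Union>(U, \<phi>)\<in>A. U)" using mfd by (simp add: smooth_manifold_def)
  then show ?thesis by auto
qed

lemma
  assumes "(U, \<phi>) \<in> A"
  shows chart_open: "open U" and chart_image_open: "open (\<phi> ` U)"
    and chart_homeo: "homeomorphism U (\<phi> ` U) \<phi> (inv_into U \<phi>)"
  using mfd assms by (auto simp: smooth_manifold_def)

lemma chart_inv: "(U, \<phi>) \<in> A \<Longrightarrow> p \<in> U \<Longrightarrow> inv_into U \<phi> (\<phi> p) = p"
  using chart_homeo homeomorphism_apply1 by metis

lemma chart_continuous: "(U, \<phi>) \<in> A \<Longrightarrow> continuous_on U \<phi>"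
  using chart_homeo homeomorphism_cont1 by metis

lemma chart_inv_continuous: "(U, \<phi>) \<in> A \<Longrightarrow> continuous_on (\<phi> ` U) (inv_into U \<phi>)"
  using chart_homeo homeomorphism_cont2 by metis

lemma chart_open_image:
  assumes "(U, \<phi>) \<in> A" and "open W" and "W \<subseteq> U"
  shows "open (\<phi> ` W)"
proof -
  have "\<phi> ` W = \<phi> ` U \<inter> inv_into U \<phi> -` W"
    using assms(3) chart_inv[OF assms(1)] by auto
  then show ?thesis
    using continuous_open_preimage[OF chart_inv_continuous chart_image_open] assms by metis
qed

lemma chart_transition:
  "(U, \<phi>) \<in> A \<Longrightarrow> (V, \<psi>) \<in> A \<Longrightarrow> smooth_on (\<phi> ` (U \<inter> V)) (\<psi> \<circ> inv_into U \<phi>)"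
  using mfd unfolding smooth_manifold_def by blast

text \<open>A property of germs: one chart is enough because transition maps are smooth. Unlike
  membership in \<open>smooth_funs\<close> it can be asserted of functions that fail to be smooth
  elsewhere.\<close>

definition smooth_near :: "('m \<Rightarrow> real) \<Rightarrow> 'm \<Rightarrow> bool" where
  "smooth_near f p \<longleftrightarrow> (\<exists>U \<phi> W. (U, \<phi>) \<in> A \<and> open W \<and> p \<in> W \<and> W \<subseteq> U \<and>
     smooth_on (\<phi> ` W) (f \<circ> inv_into U \<phi>))"

lemma smooth_nearI:
  "(U, \<phi>) \<in> A \<Longrightarrow> open W \<Longrightarrow> p \<in> W \<Longrightarrow> W \<subseteq> U \<Longrightarrow>
    smooth_on (\<phi> ` W) (\<lambda>y. f (inv_into U \<phi> y)) \<Longrightarrow> smooth_near f p"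
  unfolding smooth_near_def comp_def by blast

lemma smooth_near_chart:
  assumes "smooth_near f p" and V: "(V, \<psi>) \<in> A" "p \<in> V"
  shows "\<exists>W. open W \<and> p \<in> W \<and> W \<subseteq> V \<and> smooth_on (\<psi> ` W) (f \<circ> inv_into V \<psi>)"
proof -
  obtain U \<phi> W where U: "(U, \<phi>) \<in> A" "open W" "p \<in> W" "W \<subseteq> U"
    and s: "smooth_on (\<phi> ` W) (f \<circ> inv_into U \<phi>)"
    using assms(1) unfolding smooth_near_def by blast
  let ?W = "W \<inter> V"
  have o: "open (\<psi> ` ?W)"
    using chart_open_image[OF V(1)] U(2) chart_open[OF V(1)] by blast
  have "smooth_on (\<psi> ` ?W) (\<lambda>y. (f \<circ> inv_into U \<phi>) ((\<phi> \<circ> inv_into V \<psi>) y))"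
  proof (rule smooth_on_compose[OF o _ _ s])
    show "(\<phi> \<circ> inv_into V \<psi>) ` \<psi> ` ?W \<subseteq> \<phi> ` W" using chart_inv[OF V(1)] by auto
    show "smooth_on (\<psi> ` ?W) (\<phi> \<circ> inv_into V \<psi>)"
      by (rule smooth_on_subset[OF chart_transition[OF V(1) U(1)]]) (use U(4) in auto)
  qed
  then have "smooth_on (\<psi> ` ?W) (f \<circ> inv_into V \<psi>)"
    by (rule smooth_on_cong[OF o]) (use U(4) chart_inv[OF V(1)] chart_inv[OF U(1)] in auto)
  then show ?thesis
    using U(2,3) V(2) chart_open[OF V(1)] by (intro exI[of _ ?W]) auto
qed

lemma smooth_funs_iff: "f \<in> SF \<longleftrightarrow> (\<forall>p. smooth_near f p)"
proof
  assume f: "f \<in> SF"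
  show "\<forall>p. smooth_near f p"
  proof
    fix p
    obtain U \<phi> where "(U, \<phi>) \<in> A" "p \<in> U" using chart_cover by blast
    then show "smooth_near f p"
      using f chart_open unfolding smooth_near_def smooth_funs_def by blast
  qed
next
  assume f: "\<forall>p. smooth_near f p"
  have "smooth_on (\<phi> ` U) (f \<circ> inv_into U \<phi>)" if U: "(U, \<phi>) \<in> A" for U \<phi>
  proof (rule smooth_on_local)
    fix y assume "y \<in> \<phi> ` U"
    then obtain p where p: "p \<in> U" "y = \<phi> p" by blast
    obtain W where W: "open W" "p \<in> W" "W \<subseteq> U" "smooth_on (\<phi> ` W) (f \<circ> inv_into U \<phi>)"
      using smooth_near_chart[OF _ U p(1)] f by blast
    show "\<exists>T. open T \<and> y \<in> T \<and> smooth_on T (f \<circ> inv_into U \<phi>)"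
      using W p(2) chart_open_image[OF U W(1,3)] by (intro exI[of _ "\<phi> ` W"]) simp
  qed
  then show "f \<in> SF" unfolding smooth_funs_def by auto
qed

lemma smooth_near_cong:
  assumes "smooth_near f p" and "\<forall>\<^sub>F x in nhds p. f x = g x"
  shows "smooth_near g p"
proof -
  obtain U \<phi> W where U: "(U, \<phi>) \<in> A" "open W" "p \<in> W" "W \<subseteq> U"
    and s: "smooth_on (\<phi> ` W) (f \<circ> inv_into U \<phi>)"
    using assms(1) unfolding smooth_near_def by blast
  obtain N where N: "open N" "p \<in> N" "\<And>x. x \<in> N \<Longrightarrow> f x = g x"
    using assms(2) unfolding eventually_nhds by blast
  have "open (\<phi> ` (W \<inter> N))" using chart_open_image[OF U(1)] U N by blast
  moreover have "smooth_on (\<phi> ` (W \<inter> N)) (f \<circ> inv_into U \<phi>)"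
    by (rule smooth_on_subset[OF s]) blast
  ultimately have "smooth_on (\<phi> ` (W \<inter> N)) (g \<circ> inv_into U \<phi>)"
    by (rule smooth_on_cong) (use U N chart_inv[OF U(1)] in auto)
  then show ?thesis
    using U N unfolding comp_def by (intro smooth_nearI[of U \<phi> "W \<inter> N"]) auto
qed

lemma smooth_near_common:
  assumes "smooth_near f p" and "smooth_near g p"
  obtains U \<phi> W where "(U, \<phi>) \<in> A" "open W" "open (\<phi> ` W)" "p \<in> W" "W \<subseteq> U"
    "smooth_on (\<phi> ` W) (f \<circ> inv_into U \<phi>)" "smooth_on (\<phi> ` W) (g \<circ> inv_into U \<phi>)"
proof -
  obtain U \<phi> where U: "(U, \<phi>) \<in> A" "p \<in> U" using chart_cover by blast
  obtain W1 where 1: "open W1" "p \<in> W1" "W1 \<subseteq> U" "smooth_on (\<phi> ` W1) (f \<circ> inv_into U \<phi>)"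
    using smooth_near_chart[OF assms(1) U] by blast
  obtain W2 where 2: "open W2" "p \<in> W2" "W2 \<subseteq> U" "smooth_on (\<phi> ` W2) (g \<circ> inv_into U \<phi>)"
    using smooth_near_chart[OF assms(2) U] by blast
  show ?thesis
  proof (rule that[OF U(1), of "W1 \<inter> W2"])
    show "smooth_on (\<phi> ` (W1 \<inter> W2)) (f \<circ> inv_into U \<phi>)"
      by (rule smooth_on_subset[OF 1(4)]) auto
    show "smooth_on (\<phi> ` (W1 \<inter> W2)) (g \<circ> inv_into U \<phi>)"
      by (rule smooth_on_subset[OF 2(4)]) auto
    show "open (\<phi> ` (W1 \<inter> W2))"
      using 1 2 by (intro chart_open_image[OF U(1)]) auto
  qed (use 1 2 in auto)
qed

lemma smooth_near_const: "smooth_near (\<lambda>x. c) p"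
proof -
  obtain U \<phi> where U: "(U, \<phi>) \<in> A" "p \<in> U" using chart_cover by blast
  then show ?thesis
    using chart_open by (intro smooth_nearI[OF U(1) _ U(2)] smooth_on_const chart_image_open) auto
qed

lemma smooth_near_add:
  assumes "smooth_near f p" and "smooth_near g p"
  shows "smooth_near (\<lambda>x. f x + g x) p"
  using assms
proof (rule smooth_near_common)
  fix U \<phi> W
  assume "(U, \<phi>) \<in> A" "open W" "open (\<phi> ` W)" "p \<in> W" "W \<subseteq> U"
    "smooth_on (\<phi> ` W) (f \<circ> inv_into U \<phi>)" "smooth_on (\<phi> ` W) (g \<circ> inv_into U \<phi>)"
  then show ?thesis
    unfolding comp_def by (intro smooth_nearI[of U \<phi> W] smooth_on_add)
qed

lemma smooth_near_mult:
  assumes "smooth_near f p" and "smooth_near g p"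
  shows "smooth_near (\<lambda>x. f x * g x) p"
  using assms
proof (rule smooth_near_common)
  fix U \<phi> W
  assume "(U, \<phi>) \<in> A" "open W" "open (\<phi> ` W)" "p \<in> W" "W \<subseteq> U"
    "smooth_on (\<phi> ` W) (f \<circ> inv_into U \<phi>)" "smooth_on (\<phi> ` W) (g \<circ> inv_into U \<phi>)"
  then show ?thesis
    unfolding comp_def by (intro smooth_nearI[of U \<phi> W] smooth_on_mult)
qed

lemma smooth_near_isCont: "smooth_near f p \<Longrightarrow> isCont f p"
proof -
  assume "smooth_near f p"
  then obtain U \<phi> W where U: "(U, \<phi>) \<in> A" "open W" "p \<in> W" "W \<subseteq> U"
    and s: "smooth_on (\<phi> ` W) (f \<circ> inv_into U \<phi>)"
    unfolding smooth_near_def by blast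
  have "continuous_on W (\<lambda>x. (f \<circ> inv_into U \<phi>) (\<phi> x))"
    by (rule continuous_on_compose2[OF smooth_on_imp_continuous_on[OF s]
          continuous_on_subset[OF chart_continuous[OF U(1)] U(4)]]) simp
  then have "continuous_on W f"
    by (rule continuous_on_eq) (use U(4) chart_inv[OF U(1)] in auto)
  then show ?thesis
    using U(2,3) continuous_on_eq_continuous_at by blast
qed

lemma smooth_near_inverse:
  assumes "smooth_near f p" and "f p \<noteq> 0"
  shows "smooth_near (\<lambda>x. inverse (f x)) p"
proof -
  obtain U \<phi> W where U: "(U, \<phi>) \<in> A" "open W" "p \<in> W" "W \<subseteq> U"
    and s: "smooth_on (\<phi> ` W) (f \<circ> inv_into U \<phi>)"
    using assms(1) unfolding smooth_near_def by blast
  have "\<forall>\<^sub>F x in nhds p. f x \<noteq> 0"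
    using smooth_near_isCont[OF assms(1)] assms(2)
    unfolding isCont_def tendsto_at_iff_tendsto_nhds by (rule tendsto_imp_eventually_ne)
  then obtain N where N: "open N" "p \<in> N" "\<And>x. x \<in> N \<Longrightarrow> f x \<noteq> 0"
    unfolding eventually_nhds by blast
  have o: "open (\<phi> ` (W \<inter> N))" using chart_open_image[OF U(1)] U N by blast
  have "smooth_on (\<phi> ` (W \<inter> N)) (f \<circ> inv_into U \<phi>)"
    by (rule smooth_on_subset[OF s]) blast
  then have "smooth_on (\<phi> ` (W \<inter> N)) (\<lambda>y. inverse (f (inv_into U \<phi> y)))"
    unfolding comp_def by (rule smooth_on_inverse[OF o]) (use U N chart_inv[OF U(1)] in auto)
  then show ?thesis
    using U N unfolding comp_def by (intro smooth_nearI[of U \<phi> "W \<inter> N"]) auto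
qed

section \<open>The algebra of smooth functions, bump functions and extension of germs\<close>

lemma smooth_funs_local:
  assumes "\<And>p. \<exists>h\<in>SF. \<forall>\<^sub>F x in nhds p. h x = f x"
  shows "f \<in> SF"
  unfolding smooth_funs_iff
proof
  fix p
  obtain h where "h \<in> SF" "\<forall>\<^sub>F x in nhds p. h x = f x" using assms by blast
  then show "smooth_near f p"
    using smooth_near_cong[of h p f] by (simp add: smooth_funs_iff)
qed

lemma smooth_const [simp]: "(\<lambda>x. c) \<in> SF"
  by (simp add: smooth_funs_iff smooth_near_const)

lemma smooth_add:
  "f \<in> SF \<Longrightarrow> g \<in> SF \<Longrightarrow> (\<lambda>x. f x + g x) \<in> SF"
  by (simp add: smooth_funs_iff smooth_near_add)

lemma smooth_mult:
  "f \<in> SF \<Longrightarrow> g \<in> SF \<Longrightarrow> (\<lambda>x. f x * g x) \<in> SF"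
  by (simp add: smooth_funs_iff smooth_near_mult)

lemma smooth_minus: "f \<in> SF \<Longrightarrow> (\<lambda>x. - f x) \<in> SF"
  using smooth_mult[OF smooth_const[of "-1"]] by simp

lemma smooth_diff:
  "f \<in> SF \<Longrightarrow> g \<in> SF \<Longrightarrow> (\<lambda>x. f x - g x) \<in> SF"
  using smooth_add[OF _ smooth_minus, of f g] by simp

lemma smooth_power: "f \<in> SF \<Longrightarrow> (\<lambda>x. f x ^ n) \<in> SF"
  by (induction n) (simp_all add: smooth_mult)

lemma smooth_sum:
  "(\<And>i. i \<in> I \<Longrightarrow> f i \<in> SF) \<Longrightarrow> (\<lambda>x. \<Sum>i\<in>I. f i x) \<in> SF"
  by (induction I rule: infinite_finite_induct) (simp_all add: smooth_add)

lemma smooth_continuous: "f \<in> SF \<Longrightarrow> isCont f p"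
  by (simp add: smooth_funs_iff smooth_near_isCont)

text \<open>A Euclidean bump in a chart, extended by 0. It is smooth outside the chart as well
  because its support lies in the image of a closed ball, which is compact and so closed in a
  Hausdorff space. The set \<open>C\<close> stays in the conclusion so that products with functions
  smooth only on \<open>N\<close> can be extended by 0.\<close>

lemma smooth_bump:
  assumes "open N" and "p \<in> N"
  obtains \<rho> C where "\<rho> \<in> SF" "\<forall>\<^sub>F x in nhds p. \<rho> x = 1" "closed C" "C \<subseteq> N"
    "\<And>x. x \<notin> C \<Longrightarrow> \<rho> x = 0"
proof -
  obtain U \<phi> where U: "(U, \<phi>) \<in> A" "p \<in> U" using chart_cover by blast
  have "open (\<phi> ` (U \<inter> N))" using chart_open_image[OF U(1)] chart_open[OF U(1)] assms by blast
  then obtain r where r: "r > 0" "cball (\<phi> p) r \<subseteq> \<phi> ` (U \<inter> N)"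
    using U(2) assms(2) open_contains_cball by (metis IntI image_eqI)
  obtain \<kappa> :: "'e \<Rightarrow> real" where \<kappa>: "smooth_on UNIV \<kappa>" "\<And>y. y \<in> ball (\<phi> p) (r / 2) \<Longrightarrow> \<kappa> y = 1"
    "\<And>y. y \<notin> cball (\<phi> p) r \<Longrightarrow> \<kappa> y = 0"
    using smooth_bump_ball[OF r(1), of "\<phi> p"] by blast
  define C where "C = inv_into U \<phi> ` cball (\<phi> p) r"
  define \<rho> where "\<rho> x = (if x \<in> U then \<kappa> (\<phi> x) else 0)" for x
  have "compact C" unfolding C_def
    by (rule compact_continuous_image[OF continuous_on_subset[OF chart_inv_continuous[OF U(1)]]])
      (use r in auto)
  then have C: "closed C" by (rule compact_imp_closed)
  have CU: "C \<subseteq> U \<inter> N" unfolding C_def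
  proof (rule image_subsetI)
    fix y assume "y \<in> cball (\<phi> p) r"
    then obtain x where "x \<in> U \<inter> N" "y = \<phi> x" using r by blast
    then show "inv_into U \<phi> y \<in> U \<inter> N" using chart_inv[OF U(1)] by auto
  qed
  have z: "\<rho> x = 0" if "x \<notin> C" for x
  proof (cases "x \<in> U")
    case True
    then have "\<phi> x \<notin> cball (\<phi> p) r"
      using that chart_inv[OF U(1) True] unfolding C_def by (metis image_eqI)
    then show ?thesis by (simp add: \<rho>_def \<kappa>(3))
  qed (simp add: \<rho>_def)
  have "smooth_near \<rho> x" for x
  proof (cases "x \<in> U")
    case True
    have "smooth_on (\<phi> ` U) \<kappa>" by (rule smooth_on_subset[OF \<kappa>(1)]) simp
    then have "smooth_on (\<phi> ` U) (\<rho> \<circ> inv_into U \<phi>)"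
      by (rule smooth_on_cong[OF chart_image_open[OF U(1)]])
        (use chart_inv[OF U(1)] in \<open>auto simp: \<rho>_def\<close>)
    then show ?thesis unfolding smooth_near_def using U True chart_open by blast
  next
    case False
    then have "x \<in> - C" using CU by blast
    then have "\<forall>\<^sub>F x in nhds x. 0 = \<rho> x"
      using C z unfolding eventually_nhds by (intro exI[of _ "- C"]) auto
    then show ?thesis by (rule smooth_near_cong[OF smooth_near_const])
  qed
  then have "\<rho> \<in> SF" by (simp add: smooth_funs_iff)
  moreover have "\<forall>\<^sub>F x in nhds p. \<rho> x = 1" unfolding eventually_nhds
  proof (intro exI[of _ "U \<inter> \<phi> -` ball (\<phi> p) (r / 2)"] conjI ballI)
    show "open (U \<inter> \<phi> -` ball (\<phi> p) (r / 2))"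
      using continuous_open_preimage[OF chart_continuous chart_open] U by blast
  qed (use U r \<kappa> in \<open>auto simp: \<rho>_def\<close>)
  ultimately show ?thesis using that C CU z by blast
qed

lemma smooth_bump_mult:
  assumes "\<rho> \<in> SF" and "closed C" and "\<And>x. x \<notin> C \<Longrightarrow> \<rho> x = 0"
    and "\<And>x. x \<in> C \<Longrightarrow> smooth_near f x"
  shows "(\<lambda>x. \<rho> x * f x) \<in> SF"
  unfolding smooth_funs_iff
proof
  fix x
  show "smooth_near (\<lambda>x. \<rho> x * f x) x"
  proof (cases "x \<in> C")
    case True
    then show ?thesis using assms smooth_near_mult by (auto simp: smooth_funs_iff)
  next
    case False
    then have "\<forall>\<^sub>F x in nhds x. 0 = \<rho> x * f x"
      using assms(2,3) unfolding eventually_nhds by (intro exI[of _ "- C"]) auto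
    then show ?thesis by (rule smooth_near_cong[OF smooth_near_const])
  qed
qed

text \<open>Derivations take only globally smooth functions as arguments; this provides a global
  representative of a germ.\<close>

lemma smooth_extend:
  assumes "open N" and "p \<in> N" and "\<And>x. x \<in> N \<Longrightarrow> smooth_near f x"
  obtains h where "h \<in> SF" "\<forall>\<^sub>F x in nhds p. h x = f x"
proof -
  obtain \<rho> C where \<rho>: "\<rho> \<in> SF" "\<forall>\<^sub>F x in nhds p. \<rho> x = 1" "closed C" "C \<subseteq> N"
    "\<And>x. x \<notin> C \<Longrightarrow> \<rho> x = 0"
    using smooth_bump[OF assms(1,2)] by blast
  have "(\<lambda>x. \<rho> x * f x) \<in> SF"
    by (rule smooth_bump_mult[OF \<rho>(1,3,5)]) (use \<rho>(4) assms(3) in auto)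
  moreover have "\<forall>\<^sub>F x in nhds p. \<rho> x * f x = f x"
    using \<rho>(2) by eventually_elim simp
  ultimately show ?thesis using that by blast
qed

lemma smooth_recip:
  assumes "f \<in> SF" and "f p \<noteq> 0"
  obtains h where "h \<in> SF" "\<forall>\<^sub>F x in nhds p. h x * f x = 1"
proof -
  have "\<forall>\<^sub>F x in nhds p. f x \<noteq> 0"
    using smooth_continuous[OF assms(1)] assms(2)
    unfolding isCont_def tendsto_at_iff_tendsto_nhds by (rule tendsto_imp_eventually_ne)
  then obtain N where N: "open N" "p \<in> N" "\<And>x. x \<in> N \<Longrightarrow> f x \<noteq> 0"
    unfolding eventually_nhds by blast
  obtain h where h: "h \<in> SF" "\<forall>\<^sub>F x in nhds p. h x = inverse (f x)"
    using smooth_extend[OF N(1,2), of "\<lambda>x. inverse (f x)"] N(3) smooth_near_inverse assms(1)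
    by (auto simp: smooth_funs_iff)
  have "\<forall>\<^sub>F x in nhds p. x \<in> N" using N eventually_nhds by blast
  with h(2) have "\<forall>\<^sub>F x in nhds p. h x * f x = 1"
    by eventually_elim (simp add: N(3))
  then show ?thesis using that h(1) by blast
qed

end

definition vcomb :: "('m \<Rightarrow> real) \<Rightarrow> 'm vfield \<Rightarrow> ('m \<Rightarrow> real) \<Rightarrow> 'm vfield \<Rightarrow> 'm vfield"
  where "vcomb f X h Y = (\<lambda>p \<phi>. f p * X p \<phi> + h p * Y p \<phi>)"

definition vsum :: "'i set \<Rightarrow> ('i \<Rightarrow> 'm \<Rightarrow> real) \<Rightarrow> ('i \<Rightarrow> 'm vfield) \<Rightarrow> 'm vfield"
  where "vsum I c E = (\<lambda>p \<phi>. \<Sum>i\<in>I. c i p * E i p \<phi>)"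

definition chart_deriv :: "'m set \<Rightarrow> ('m \<Rightarrow> 'e::euclidean_space) \<Rightarrow> ('m \<Rightarrow> real) \<Rightarrow> 'm \<Rightarrow> 'e \<Rightarrow> real"
  where "chart_deriv U \<phi> f p = frechet_derivative (f \<circ> inv_into U \<phi>) (at (\<phi> p))"

context smooth_mfd
begin

section \<open>Derivations at a point and vector fields\<close>

lemma tangent_nonsmooth: "v \<in> tangent A p \<Longrightarrow> f \<notin> SF \<Longrightarrow> v f = 0"
  by (simp add: tangent_def)

lemma tangent_linear:
  "v \<in> tangent A p \<Longrightarrow> f \<in> SF \<Longrightarrow> h \<in> SF \<Longrightarrow>
    v (\<lambda>x. a * f x + c * h x) = a * v f + c * v h"
  by (simp add: tangent_def)

lemma tangent_mult:
  "v \<in> tangent A p \<Longrightarrow> f \<in> SF \<Longrightarrow> h \<in> SF \<Longrightarrow>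
    v (\<lambda>x. f x * h x) = v f * h p + f p * v h"
  by (simp add: tangent_def)

lemma tangent_add:
  "v \<in> tangent A p \<Longrightarrow> f \<in> SF \<Longrightarrow> h \<in> SF \<Longrightarrow>
    v (\<lambda>x. f x + h x) = v f + v h"
  using tangent_linear[of v p f h 1 1] by simp

lemma tangent_diff:
  "v \<in> tangent A p \<Longrightarrow> f \<in> SF \<Longrightarrow> h \<in> SF \<Longrightarrow>
    v (\<lambda>x. f x - h x) = v f - v h"
  using tangent_linear[of v p f h 1 "-1"] by simp

lemma tangent_minus:
  "v \<in> tangent A p \<Longrightarrow> f \<in> SF \<Longrightarrow> v (\<lambda>x. - f x) = - v f"
  using tangent_linear[of v p f f 0 "-1"] by simp

lemma tangent_const: "v \<in> tangent A p \<Longrightarrow> v (\<lambda>x. c) = 0"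
proof -
  assume v: "v \<in> tangent A p"
  have "v (\<lambda>x. 1) = 0" using tangent_mult[OF v, of "\<lambda>x. 1" "\<lambda>x. 1"] by simp
  then show ?thesis using tangent_linear[OF v, of "\<lambda>x. 1" "\<lambda>x. 1" c 0] by simp
qed

lemma tangent_sum:
  assumes "v \<in> tangent A p" and "\<And>i. i \<in> I \<Longrightarrow> f i \<in> SF"
  shows "v (\<lambda>x. \<Sum>i\<in>I. f i x) = (\<Sum>i\<in>I. v (f i))"
  using assms(2)
proof (induction I rule: infinite_finite_induct)
  case (insert i I)
  then show ?case using tangent_add[OF assms(1), of "f i" "\<lambda>x. \<Sum>i\<in>I. f i x"] smooth_sum[of I f] by simp
qed (auto simp: tangent_const[OF assms(1)])

lemma tangent_local:
  assumes "v \<in> tangent A p" and "f \<in> SF" and "h \<in> SF"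
    and "\<forall>\<^sub>F x in nhds p. f x = h x"
  shows "v f = v h"
proof -
  obtain N where N: "open N" "p \<in> N" "\<And>x. x \<in> N \<Longrightarrow> f x = h x"
    using assms(4) unfolding eventually_nhds by blast
  obtain \<rho> C where \<rho>: "\<rho> \<in> SF" "\<forall>\<^sub>F x in nhds p. \<rho> x = 1" "C \<subseteq> N"
    "\<And>x. x \<notin> C \<Longrightarrow> \<rho> x = 0"
    using smooth_bump[OF N(1,2)] by metis
  have "\<rho> p = 1" using \<rho>(2) eventually_nhds_x_imp_x by blast
  moreover have "(\<lambda>x. \<rho> x * (f x - h x)) = (\<lambda>x. 0)" using N \<rho>(3,4) by fastforce
  ultimately have "v f - v h = 0"
    using tangent_mult[OF assms(1) \<rho>(1) smooth_diff[OF assms(2,3)]] N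
      tangent_diff[OF assms(1-3)] tangent_const[OF assms(1), of 0] by simp
  then show ?thesis by simp
qed

lemma tangent_comb:
  assumes "u \<in> tangent A p" and "v \<in> tangent A p"
  shows "(\<lambda>f. a * u f + c * v f) \<in> tangent A p"
  using assms unfolding tangent_def by (auto simp: algebra_simps)

lemma tangent_zero: "(\<lambda>f. 0) \<in> tangent A p"
  unfolding tangent_def by simp

lemma tangent_lincomb:
  "(\<And>i. i \<in> I \<Longrightarrow> v i \<in> tangent A p) \<Longrightarrow> (\<lambda>f. \<Sum>i\<in>I. c i * v i f) \<in> tangent A p"
proof (induction I rule: infinite_finite_induct)
  case (insert i I)
  then show ?case
    using tangent_comb[of "v i" p "\<lambda>f. \<Sum>i\<in>I. c i * v i f" "c i" 1] by simp
qed (auto simp: tangent_zero)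

lemma vfield_tangent: "X \<in> VF \<Longrightarrow> X p \<in> tangent A p"
  by (simp add: vector_fields_def)

lemma vfield_smooth: "X \<in> VF \<Longrightarrow> f \<in> SF \<Longrightarrow> der X f \<in> SF"
  by (simp add: vector_fields_def)

lemma vfield_vcomb:
  assumes "f \<in> SF" "h \<in> SF" "X \<in> VF" "Y \<in> VF"
  shows "vcomb f X h Y \<in> VF"
proof -
  have "(\<lambda>p. f p * der X k p + h p * der Y k p) \<in> SF" if "k \<in> SF" for k
    using assms that by (intro smooth_add smooth_mult vfield_smooth)
  moreover have "vcomb f X h Y p \<in> tangent A p" for p
    unfolding vcomb_def using assms by (intro tangent_comb vfield_tangent)
  ultimately show ?thesis by (simp add: vector_fields_def vcomb_def der_def)
qed

lemma vfield_zero: "(\<lambda>p f. 0) \<in> VF"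
  by (simp add: vector_fields_def der_def tangent_zero)

lemma vfield_vsum:
  assumes "\<And>i. i \<in> I \<Longrightarrow> c i \<in> SF" "\<And>i. i \<in> I \<Longrightarrow> E i \<in> VF"
  shows "vsum I c E \<in> VF"
proof -
  have "(\<lambda>p. \<Sum>i\<in>I. c i p * der (E i) k p) \<in> SF" if "k \<in> SF" for k
    using assms that by (intro smooth_sum smooth_mult vfield_smooth) auto
  moreover have "vsum I c E p \<in> tangent A p" for p
    unfolding vsum_def using assms(2) by (intro tangent_lincomb vfield_tangent)
  ultimately show ?thesis by (simp add: vector_fields_def vsum_def der_def)
qed

text \<open>In the commutator applied to a product, the mixed terms \<open>(X f)(Y h)\<close> and
  \<open>(Y f)(X h)\<close> arise in both orders and cancel.\<close>

lemma vfield_bracket: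
  assumes X: "X \<in> VF" and Y: "Y \<in> VF"
  shows "lie_bracket X Y \<in> VF"
proof -
  \<comment> \<open>A field sends a non-smooth function to the zero function, which is smooth; hence
    the bracket vanishes on it, as \<open>tangent\<close> requires.\<close>
  have ns: "der X f = (\<lambda>x. 0)" "der Y f = (\<lambda>x. 0)" if "f \<notin> SF" for f
    using tangent_nonsmooth[OF vfield_tangent[OF X] that] tangent_nonsmooth[OF vfield_tangent[OF Y] that]
    by (auto simp: der_def)
  have lin: "der X (\<lambda>x. a * f x + c * h x) = (\<lambda>x. a * der X f x + c * der X h x)"
    and mult: "der X (\<lambda>x. f x * h x) = (\<lambda>x. der X f x * h x + f x * der X h x)"
    if "X \<in> VF" "f \<in> SF" "h \<in> SF" for X f h a c
    using that by (auto simp: der_def tangent_linear[OF vfield_tangent] tangent_mult[OF vfield_tangent])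
  have "lie_bracket X Y p \<in> tangent A p" for p
  proof -
    note Xp = vfield_tangent[OF X, of p] and Yp = vfield_tangent[OF Y, of p]
    note sm = vfield_smooth[OF X] vfield_smooth[OF Y]
    show ?thesis unfolding tangent_def
    proof (intro CollectI conjI allI impI ballI)
      fix f assume "f \<notin> SF"
      then show "lie_bracket X Y p f = 0"
        by (simp add: lie_bracket_def ns tangent_const[OF Xp] tangent_const[OF Yp])
    next
      fix f h :: "'m \<Rightarrow> real" and a c :: real
      assume f: "f \<in> SF" and h: "h \<in> SF"
      show "lie_bracket X Y p (\<lambda>x. a * f x + c * h x)
          = a * lie_bracket X Y p f + c * lie_bracket X Y p h"
        by (simp add: lie_bracket_def lin[OF X f h] lin[OF Y f h] tangent_linear[OF Xp] tangent_linear[OF Yp]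
            sm f h algebra_simps)
      show "lie_bracket X Y p (\<lambda>x. f x * h x) = lie_bracket X Y p f * h p + f p * lie_bracket X Y p h"
        by (simp add: lie_bracket_def mult[OF X f h] mult[OF Y f h] tangent_add[OF Xp] tangent_add[OF Yp]
            tangent_mult[OF Xp] tangent_mult[OF Yp] smooth_mult sm f h algebra_simps)
          (simp add: der_def)
    qed
  qed
  moreover have "der (lie_bracket X Y) f = (\<lambda>p. der X (der Y f) p - der Y (der X f) p)" for f
    by (simp add: der_def lie_bracket_def)
  moreover have "(\<lambda>p. der X (der Y f) p - der Y (der X f) p) \<in> SF"
    if "f \<in> SF" for f
    using that X Y by (intro smooth_diff vfield_smooth)
  ultimately show ?thesis by (simp add: vector_fields_def)
qed


subsection \<open>Coordinate frames\<close>

lemma chart_has_derivative: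
  assumes "(U, \<phi>) \<in> A" and "p \<in> U" and "f \<in> SF"
  shows "((f \<circ> inv_into U \<phi>) has_derivative chart_deriv U \<phi> f p) (at (\<phi> p))"
proof -
  have "smooth_on (\<phi> ` U) (f \<circ> inv_into U \<phi>)"
    using assms by (auto simp: smooth_funs_def)
  then show ?thesis
    unfolding chart_deriv_def by (rule smooth_on_has_derivative) (use assms in simp)
qed

lemma chart_deriv_smooth:
  assumes U: "(U, \<phi>) \<in> A" and "p \<in> U" and "f \<in> SF"
  shows "smooth_near (\<lambda>p. chart_deriv U \<phi> f p i) p"
proof (rule smooth_nearI[OF U chart_open[OF U] assms(2) order_refl])
  have "smooth_on (\<phi> ` U) (f \<circ> inv_into U \<phi>)"
    using assms by (auto simp: smooth_funs_def)
  then show "smooth_on (\<phi> ` U) (\<lambda>y. chart_deriv U \<phi> f (inv_into U \<phi> y) i)"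
    by (rule smooth_on_cong[OF chart_image_open[OF U] smooth_on_frechet])
      (use chart_inv[OF U] in \<open>auto simp: chart_deriv_def\<close>)
qed

lemma chart_deriv_linear:
  assumes U: "(U, \<phi>) \<in> A" "p \<in> U" and f: "f \<in> SF" and h: "h \<in> SF"
  shows "chart_deriv U \<phi> (\<lambda>x. a * f x + c * h x) p i = a * chart_deriv U \<phi> f p i + c * chart_deriv U \<phi> h p i"
proof -
  have "(((\<lambda>x. a * f x + c * h x) \<circ> inv_into U \<phi>) has_derivative
      (\<lambda>i. a * chart_deriv U \<phi> f p i + c * chart_deriv U \<phi> h p i)) (at (\<phi> p))"
    unfolding comp_def
    using chart_has_derivative[OF U f] chart_has_derivative[OF U h] unfolding comp_def
    by (intro has_derivative_add has_derivative_mult_right)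
  from frechet_derivative_at[OF this, symmetric] show ?thesis
    unfolding chart_deriv_def[of U \<phi> "\<lambda>x. a * f x + c * h x"] by (rule fun_cong)
qed

lemma chart_deriv_mult:
  assumes U: "(U, \<phi>) \<in> A" "p \<in> U" and f: "f \<in> SF" and h: "h \<in> SF"
  shows "chart_deriv U \<phi> (\<lambda>x. f x * h x) p i = chart_deriv U \<phi> f p i * h p + f p * chart_deriv U \<phi> h p i"
proof -
  have "(((\<lambda>x. f x * h x) \<circ> inv_into U \<phi>) has_derivative
      (\<lambda>i. f (inv_into U \<phi> (\<phi> p)) * chart_deriv U \<phi> h p i + chart_deriv U \<phi> f p i * h (inv_into U \<phi> (\<phi> p)))) (at (\<phi> p))"
    unfolding comp_def
    using chart_has_derivative[OF U f] chart_has_derivative[OF U h] unfolding comp_def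
    by (intro has_derivative_mult)
  from fun_cong[OF frechet_derivative_at[OF this, symmetric]]
  have "chart_deriv U \<phi> (\<lambda>x. f x * h x) p i =
      f (inv_into U \<phi> (\<phi> p)) * chart_deriv U \<phi> h p i + chart_deriv U \<phi> f p i * h (inv_into U \<phi> (\<phi> p))"
    unfolding chart_deriv_def[of U \<phi> "\<lambda>x. f x * h x"] .
  then show ?thesis by (simp add: chart_inv[OF U])
qed

text \<open>The factor \<open>a\<close> makes room for the value of a bump function, by which
  coordinate derivations are multiplied to become global fields.\<close>

lemma chart_deriv_tangent:
  assumes "(U, \<phi>) \<in> A" and "p \<in> U"
  shows "(\<lambda>f. if f \<in> SF then a * chart_deriv U \<phi> f p i else 0) \<in> tangent A p"
  unfolding tangent_def
  by (simp add: chart_deriv_linear[OF assms] chart_deriv_mult[OF assms] smooth_mult smooth_add algebra_simps)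

text \<open>A local coordinate system made of global objects: \<open>x\<close> and \<open>E\<close>
  behave as coordinates and coordinate fields on \<open>N\<close> and are unconstrained elsewhere.
  Both are indexed by all vectors of \<open>'e\<close>, so the duality reads
  \<open>i \<bullet> j\<close>; only the expansion runs over \<open>Basis\<close>.\<close>

definition frame_on ::
  "'m set \<Rightarrow> ('e \<Rightarrow> 'm \<Rightarrow> real) \<Rightarrow> ('e \<Rightarrow> 'm vfield) \<Rightarrow> bool" where
  "frame_on N x E \<longleftrightarrow> open N \<and> (\<forall>i. x i \<in> SF) \<and> (\<forall>i. E i \<in> VF) \<and>
     (\<forall>p\<in>N. \<forall>v\<in>tangent A p. \<forall>f\<in>SF. v f = (\<Sum>i\<in>Basis. v (x i) * E i p f)) \<and>
     (\<forall>p\<in>N. \<forall>i j. E i p (x j) = i \<bullet> j)"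

text \<open>That coordinate derivations span is Hadamard's lemma: \<open>f - f(p)\<close> is locally
  a sum of products of \<open>x_i - x_i(p)\<close> and \<open>g_i\<close>, on which the product rule
  leaves \<open>v(x_i) g_i(p)\<close>, and \<open>g_i(p)\<close> is the partial derivative of
  \<open>f\<close>.\<close>

lemma chart_frame:
  assumes U: "(U, \<phi>) \<in> A" and p0: "p0 \<in> U"
  obtains N x E where "frame_on N x E" "p0 \<in> N" "N \<subseteq> U"
    "\<And>p i. p \<in> N \<Longrightarrow> x i p = \<phi> p \<bullet> i"
    "\<And>p f i. p \<in> N \<Longrightarrow> f \<in> SF \<Longrightarrow> E i p f = chart_deriv U \<phi> f p i"
proof -
  obtain \<rho> C where \<rho>: "\<rho> \<in> SF" "\<forall>\<^sub>F x in nhds p0. \<rho> x = 1" "closed C" "C \<subseteq> U"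
    "\<And>x. x \<notin> C \<Longrightarrow> \<rho> x = 0"
    using smooth_bump[OF chart_open[OF U] p0] by blast
  obtain N where N: "open N" "p0 \<in> N" "\<And>x. x \<in> N \<Longrightarrow> \<rho> x = 1"
    using \<rho>(2) unfolding eventually_nhds by blast
  have NU: "N \<subseteq> U" using N(3) \<rho>(4,5) by fastforce
  define x where "x i p = \<rho> p * (\<phi> p \<bullet> i)" for i p
  define E where "E i p f = (if f \<in> SF then \<rho> p * chart_deriv U \<phi> f p i else 0)" for i p f
  have xs: "x i \<in> SF" for i
    unfolding x_def
  proof (rule smooth_bump_mult[OF \<rho>(1,3,5)])
    fix q assume "q \<in> C"
    then have "q \<in> U" using \<rho>(4) by blast
    then show "smooth_near (\<lambda>p. \<phi> p \<bullet> i) q"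
    proof (rule smooth_nearI[OF U chart_open[OF U] _ order_refl])
      have "smooth_on (\<phi> ` U) (\<lambda>y. y \<bullet> i)"
        by (intro smooth_on_bounded_linear chart_image_open[OF U] bounded_linear_inner_left)
      then show "smooth_on (\<phi> ` U) (\<lambda>y. \<phi> (inv_into U \<phi> y) \<bullet> i)"
        by (rule smooth_on_cong[OF chart_image_open[OF U]]) (use chart_inv[OF U] in auto)
    qed
  qed
  have Es: "E i \<in> VF" for i
    unfolding vector_fields_def
  proof (intro CollectI conjI allI ballI)
    show "E i p \<in> tangent A p" for p
    proof (cases "p \<in> U")
      case True
      then show ?thesis unfolding E_def by (rule chart_deriv_tangent[OF U])
    next
      case False
      then have "\<rho> p = 0" using \<rho>(4,5) by blast
      then have "E i p = (\<lambda>f. 0)" by (simp add: E_def fun_eq_iff)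
      then show ?thesis by (simp add: tangent_zero)
    qed
    fix f assume f: "f \<in> SF"
    have "(\<lambda>p. \<rho> p * chart_deriv U \<phi> f p i) \<in> SF"
      by (rule smooth_bump_mult[OF \<rho>(1,3,5)]) (use \<rho>(4) chart_deriv_smooth[OF U _ f] in blast)+
    then show "der (E i) f \<in> SF" using f by (simp add: der_def E_def)
  qed
  have x_N: "x i p = \<phi> p \<bullet> i" if "p \<in> N" for i p using N(3)[OF that] by (simp add: x_def)
  have E_N: "E i p f = chart_deriv U \<phi> f p i" if "p \<in> N" "f \<in> SF" for i p f
    using N(3)[OF that(1)] that(2) by (simp add: E_def)
  have dual: "E i p (x j) = i \<bullet> j" if p: "p \<in> N" for p i j
  proof -
    have "((\<lambda>y. y \<bullet> j) has_derivative (\<lambda>i. i \<bullet> j)) (at (\<phi> p))"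
      by (auto intro!: derivative_eq_intros)
    then have "((x j \<circ> inv_into U \<phi>) has_derivative (\<lambda>i. i \<bullet> j)) (at (\<phi> p))"
      by (rule has_derivative_transform_within_open[OF _ chart_open_image[OF U N(1) NU]])
        (use p NU chart_inv[OF U] x_N in auto)
    then show ?thesis
      using E_N[OF p xs] frechet_derivative_at by (metis chart_deriv_def)
  qed
  have rep: "v f = (\<Sum>i\<in>Basis. v (x i) * E i p f)"
    if p: "p \<in> N" and v: "v \<in> tangent A p" and f: "f \<in> SF" for p v f
  proof -
    have pU: "p \<in> U" using p NU by blast
    have o: "open (\<phi> ` N)" by (rule chart_open_image[OF U N(1) NU])
    then obtain r where r: "r > 0" "ball (\<phi> p) r \<subseteq> \<phi> ` N"
      using p open_contains_ball by (metis image_eqI)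
    have "smooth_on (\<phi> ` U) (f \<circ> inv_into U \<phi>)" using f U by (auto simp: smooth_funs_def)
    then have "smooth_on (ball (\<phi> p) r) (f \<circ> inv_into U \<phi>)"
      by (rule smooth_on_subset) (use r NU in blast)
    from hadamard[OF this r(1)] obtain g where
      g: "\<And>i. i \<in> Basis \<Longrightarrow> smooth_on (ball (\<phi> p) r) (g i)"
        "\<And>i. i \<in> Basis \<Longrightarrow> g i (\<phi> p) = chart_deriv U \<phi> f p i"
      and taylor: "\<And>y. y \<in> ball (\<phi> p) r \<Longrightarrow>
          (f \<circ> inv_into U \<phi>) y = (f \<circ> inv_into U \<phi>) (\<phi> p) + (\<Sum>i\<in>Basis. ((y - \<phi> p) \<bullet> i) * g i y)"
      unfolding chart_deriv_def by blast
    define W where "W = N \<inter> (U \<inter> \<phi> -` ball (\<phi> p) r)"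
    have W: "open W" "p \<in> W" "W \<subseteq> U"
      using continuous_open_preimage[OF chart_continuous[OF U] chart_open[OF U] open_ball]
        N(1) p pU r(1) by (auto simp: W_def)
    \<comment> \<open>The Hadamard coefficients exist only on a ball in the chart; their germs at
      \<open>p\<close> are extended to elements of \<open>SF\<close> before \<open>v\<close> is
      applied.\<close>
    have "\<exists>\<gamma>. \<gamma> \<in> SF \<and> (\<forall>\<^sub>F q in nhds p. \<gamma> q = g i (\<phi> q))" if i: "i \<in> Basis" for i
    proof -
      have sb: "\<phi> ` W \<subseteq> ball (\<phi> p) r" by (auto simp: W_def)
      have "smooth_near (\<lambda>q. g i (\<phi> q)) q" if "q \<in> W" for q
      proof (rule smooth_nearI[OF U W(1) that W(3)])
        have "smooth_on (\<phi> ` W) (g i)" by (rule smooth_on_subset[OF g(1)[OF i] sb])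
        then show "smooth_on (\<phi> ` W) (\<lambda>y. g i (\<phi> (inv_into U \<phi> y)))"
          by (rule smooth_on_cong[OF chart_open_image[OF U W(1,3)]])
            (use W(3) chart_inv[OF U] in auto)
      qed
      from smooth_extend[OF W(1,2) this] show ?thesis by blast
    qed
    then obtain \<gamma> where \<gamma>: "\<And>i. i \<in> Basis \<Longrightarrow> \<gamma> i \<in> SF"
      "\<And>i. i \<in> Basis \<Longrightarrow> \<forall>\<^sub>F q in nhds p. \<gamma> i q = g i (\<phi> q)"
      by metis
    have \<gamma>p: "\<gamma> i p = chart_deriv U \<phi> f p i" if "i \<in> Basis" for i
      using eventually_nhds_x_imp_x[OF \<gamma>(2)[OF that]] g(2)[OF that] by simp
    have sm: "(\<lambda>q. (x i q - x i p) * \<gamma> i q) \<in> SF" if "i \<in> Basis" for i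
      using xs \<gamma>(1)[OF that] by (intro smooth_mult smooth_diff smooth_const)
    have "\<forall>\<^sub>F q in nhds p. \<forall>i\<in>Basis. \<gamma> i q = g i (\<phi> q)"
      using \<gamma>(2) by (simp add: eventually_ball_finite)
    moreover have "\<forall>\<^sub>F q in nhds p. q \<in> W" using W(1,2) eventually_nhds by blast
    ultimately have "\<forall>\<^sub>F q in nhds p. f q = f p + (\<Sum>i\<in>Basis. (x i q - x i p) * \<gamma> i q)"
    proof eventually_elim
      case (elim q)
      then have q: "q \<in> N" "q \<in> U" "\<phi> q \<in> ball (\<phi> p) r" by (auto simp: W_def)
      have "f q = f p + (\<Sum>i\<in>Basis. ((\<phi> q - \<phi> p) \<bullet> i) * g i (\<phi> q))"
        using taylor[OF q(3)] by (simp add: chart_inv[OF U q(2)] chart_inv[OF U pU])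
      also have "(\<Sum>i\<in>Basis. ((\<phi> q - \<phi> p) \<bullet> i) * g i (\<phi> q)) = (\<Sum>i\<in>Basis. (x i q - x i p) * \<gamma> i q)"
        by (rule sum.cong) (use elim x_N q p in \<open>auto simp: inner_diff_left\<close>)
      finally show ?case .
    qed
    then have "v f = v (\<lambda>q. f p + (\<Sum>i\<in>Basis. (x i q - x i p) * \<gamma> i q))"
      by (rule tangent_local[OF v f, rotated]) (intro smooth_add smooth_const smooth_sum sm)
    also have "\<dots> = (\<Sum>i\<in>Basis. v (\<lambda>q. (x i q - x i p) * \<gamma> i q))"
      by (subst tangent_add[OF v smooth_const smooth_sum[OF sm]])
        (simp_all add: tangent_sum[OF v sm] tangent_const[OF v])
    also have "\<dots> = (\<Sum>i\<in>Basis. v (x i) * E i p f)"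
    proof (rule sum.cong[OF refl])
      fix i :: 'e assume i: "i \<in> Basis"
      show "v (\<lambda>q. (x i q - x i p) * \<gamma> i q) = v (x i) * E i p f"
        using tangent_mult[OF v smooth_diff[OF xs smooth_const] \<gamma>(1)[OF i], of i "x i p"]
          tangent_diff[OF v xs smooth_const, of i "x i p"] tangent_const[OF v]
        by (simp add: \<gamma>p[OF i] E_N[OF p f])
    qed
    finally show ?thesis .
  qed
  have "frame_on N x E"
    unfolding frame_on_def using N(1) xs Es dual rep by blast
  then show ?thesis using that N(2) NU x_N E_N by blast
qed

lemma frame_exists:
  obtains N x E where "frame_on N x E" "p0 \<in> N"
  using chart_cover chart_frame by metis

lemma frame_onD:
  assumes "frame_on N x E"
  shows "open N" "x i \<in> SF" "E i \<in> VF"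
    "p \<in> N \<Longrightarrow> E i p (x j) = i \<bullet> j"
  using assms unfolding frame_on_def by blast+

lemma frame_tvec:
  assumes "frame_on N x E" and "p \<in> N" and v: "v \<in> tangent A p"
  shows "v = (\<lambda>f. \<Sum>i\<in>Basis. v (x i) * E i p f)"
proof
  fix f
  show "v f = (\<Sum>i\<in>Basis. v (x i) * E i p f)"
  proof (cases "f \<in> SF")
    case True
    then show ?thesis using assms unfolding frame_on_def by blast
  next
    case False
    then show ?thesis
      using tangent_nonsmooth[OF v] tangent_nonsmooth[OF vfield_tangent[OF frame_onD(3)[OF assms(1)]]]
      by simp
  qed
qed

text \<open>Keep the coefficients of \<open>v\<close> in a frame constant.\<close>

lemma vfield_extend:
  assumes v: "v \<in> tangent A p"
  obtains X where "X \<in> VF" "X p = v"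
proof -
  obtain N x E where F: "frame_on N x E" "p \<in> N" using frame_exists by blast
  have "vsum Basis (\<lambda>i q. v (x i)) E \<in> VF"
    using frame_onD[OF F(1)] by (intro vfield_vsum) auto
  moreover have "vsum Basis (\<lambda>i q. v (x i)) E p = v"
    unfolding vsum_def by (rule frame_tvec[OF F v, symmetric])
  ultimately show ?thesis using that by blast
qed


subsection \<open>Tensorial one-forms\<close>

text \<open>Linearity over smooth functions, which makes the value at a point depend only on the
  vector there; \<open>vcomb\<close> covers additivity and homogeneity together.\<close>

definition tensorial :: "'m oneform \<Rightarrow> bool" where
  "tensorial \<omega> \<longleftrightarrow> (\<forall>X\<in>VF. \<omega> X \<in> SF) \<and>
     (\<forall>f\<in>SF. \<forall>h\<in>SF. \<forall>X\<in>VF. \<forall>Y\<in>VF.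
        \<forall>p. \<omega> (vcomb f X h Y) p = f p * \<omega> X p + h p * \<omega> Y p)"

lemma tensorialD:
  assumes "tensorial \<omega>"
  shows "X \<in> VF \<Longrightarrow> \<omega> X \<in> SF"
    "f \<in> SF \<Longrightarrow> h \<in> SF \<Longrightarrow> X \<in> VF \<Longrightarrow> Y \<in> VF \<Longrightarrow>
      \<omega> (vcomb f X h Y) p = f p * \<omega> X p + h p * \<omega> Y p"
  using assms unfolding tensorial_def by blast+

lemma tensorial_vsum:
  assumes "tensorial \<omega>" and "finite I"
    and "\<And>i. i \<in> I \<Longrightarrow> c i \<in> SF" and "\<And>i. i \<in> I \<Longrightarrow> E i \<in> VF"
  shows "\<omega> (vsum I c E) p = (\<Sum>i\<in>I. c i p * \<omega> (E i) p)"
  using assms(2-)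
proof (induction I rule: finite_induct)
  case empty
  have "vsum {} c E = vcomb (\<lambda>x. 0) (\<lambda>p f. 0) (\<lambda>x. 0) (\<lambda>p f. 0)"
    by (simp add: vsum_def vcomb_def)
  then show ?case
    using tensorialD(2)[OF assms(1), of "\<lambda>x. 0" "\<lambda>x. 0" "\<lambda>p f. 0" "\<lambda>p f. 0"] vfield_zero by simp
next
  case (insert i I)
  have "vsum (insert i I) c E = vcomb (c i) (E i) (\<lambda>x. 1) (vsum I c E)"
    using insert by (simp add: vsum_def vcomb_def)
  then show ?case
    using insert tensorialD(2)[OF assms(1), of "c i" "\<lambda>x. 1" "E i" "vsum I c E" p]
      vfield_vsum[of I c E] by simp
qed

text \<open>The frame expands \<open>X\<close> only on \<open>N\<close>, but \<open>\<omega>\<close>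
  acts on global fields. After multiplication by a bump \<open>\<rho>\<close> the expansion is an
  equality of global fields, both sides being 0 off \<open>N\<close>, and \<open>\<rho>\<close> is 1
  at \<open>p\<close>.\<close>

lemma tensorial_frame:
  assumes "tensorial \<omega>" and F: "frame_on N x E" and X: "X \<in> VF" and p: "p \<in> N"
  shows "\<omega> X p = (\<Sum>i\<in>Basis. X p (x i) * \<omega> (E i) p)"
proof -
  note F' = frame_onD[OF F]
  obtain \<rho> C where \<rho>: "\<rho> \<in> SF" "\<forall>\<^sub>F x in nhds p. \<rho> x = 1" "C \<subseteq> N"
    "\<And>x. x \<notin> C \<Longrightarrow> \<rho> x = 0"
    using smooth_bump[OF F'(1) p] by metis
  have \<rho>p: "\<rho> p = 1" using eventually_nhds_x_imp_x[OF \<rho>(2)] .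
  have c: "(\<lambda>q. \<rho> q * der X (x i) q) \<in> SF" for i
    using \<rho>(1) F'(2) X by (intro smooth_mult vfield_smooth)
  have "vcomb \<rho> X (\<lambda>x. 0) X q f = vsum Basis (\<lambda>i q. \<rho> q * der X (x i) q) E q f" for q f
  proof (cases "q \<in> N")
    case True
    have "X q f = (\<Sum>i\<in>Basis. X q (x i) * E i q f)"
      by (rule fun_cong[OF frame_tvec[OF F True vfield_tangent[OF X]]])
    then show ?thesis
      by (simp add: vcomb_def vsum_def der_def sum_distrib_left mult.assoc)
  next
    case False
    then have "\<rho> q = 0" using \<rho> by blast
    then show ?thesis by (simp add: vcomb_def vsum_def)
  qed
  then have "vcomb \<rho> X (\<lambda>x. 0) X = vsum Basis (\<lambda>i q. \<rho> q * der X (x i) q) E"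
    by blast
  then have "\<omega> X p = \<omega> (vsum Basis (\<lambda>i q. \<rho> q * der X (x i) q) E) p"
    using tensorialD(2)[OF assms(1) \<rho>(1) smooth_const X X, of 0 p] \<rho>p by simp
  also have "\<dots> = (\<Sum>i\<in>Basis. X p (x i) * \<omega> (E i) p)"
    by (subst tensorial_vsum[OF assms(1) finite_Basis c F'(3)]) (simp add: \<rho>p der_def)
  finally show ?thesis .
qed

lemma tensorial_pointwise:
  assumes "tensorial \<omega>" and "X \<in> VF" and "Y \<in> VF" and "X p = Y p"
  shows "\<omega> X p = \<omega> Y p"
proof -
  obtain N x E where F: "frame_on N x E" "p \<in> N" using frame_exists by blast
  show ?thesis
    using tensorial_frame[OF assms(1) F(1) assms(2) F(2)] tensorial_frame[OF assms(1) F(1) assms(3) F(2)]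
      assms(4) by simp
qed

text \<open>The hypothesis makes \<open>\<omega> Z p\<close> a function of \<open>Z p\<close>, and
  every tangent vector extends to a field, so the definite description in \<open>value_at\<close>
  has exactly one solution.\<close>

lemma value_at_eq_flat:
  assumes "v \<in> tangent A p" and \<omega>: "\<And>Z. Z \<in> VF \<Longrightarrow> \<omega> Z p = g p v (Z p)"
  shows "value_at A \<omega> p = flat A g p v"
proof
  fix z
  show "value_at A \<omega> p z = flat A g p v z"
  proof (cases "z \<in> tangent A p")
    case True
    then obtain Z where Z: "Z \<in> VF" "Z p = z" using vfield_extend by blast
    have "(THE c. \<exists>Z\<in>VF. Z p = z \<and> c = \<omega> Z p) = g p v z"
      using Z \<omega> by (intro the_equality) auto
    then show ?thesis using True by (simp add: value_at_def flat_def)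
  qed (simp add: value_at_def flat_def)
qed

end

subsection \<open>Linear systems with smooth coefficients\<close>

text \<open>Gaussian elimination: divide by a coefficient that does not vanish at the given point.\<close>

lemma (in smooth_mfd) smooth_solve:
  fixes G :: "'i \<Rightarrow> 'j \<Rightarrow> 'm \<Rightarrow> real" and w :: "'i \<Rightarrow> 'm \<Rightarrow> real"
  assumes "finite I" and "finite J" and "card I = card J"
    and "\<And>i j. i \<in> I \<Longrightarrow> j \<in> J \<Longrightarrow> G i j \<in> SF"
    and "\<And>i. i \<in> I \<Longrightarrow> w i \<in> SF"
    and "\<And>c j. (\<And>i. i \<in> I \<Longrightarrow> (\<Sum>j\<in>J. G i j z * c j) = 0) \<Longrightarrow> j \<in> J \<Longrightarrow> c j = 0"
  shows "\<exists>c. (\<forall>j\<in>J. c j \<in> SF) \<and>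
    (\<forall>\<^sub>F p in nhds z. \<forall>i\<in>I. (\<Sum>j\<in>J. G i j p * c j p) = w i p)"
  using assms
proof (induction "card J" arbitrary: I J G w)
  case 0
  then have "I = {}" "J = {}" by auto
  then show ?case by simp
next
  case (Suc n)
  note fin = Suc.prems(1,2) and G = Suc.prems(4) and w = Suc.prems(5) and ker = Suc.prems(6)
  obtain j0 where j0: "j0 \<in> J" using Suc.hyps(2) by (metis card.empty ex_in_conv nat.distinct(1))
  have "\<exists>i0\<in>I. G i0 j0 z \<noteq> 0"
  proof (rule ccontr)
    assume *: "\<not> ?thesis"
    \<comment> \<open>If the whole column \<open>j0\<close> vanished at \<open>z\<close>, its unit
      vector would lie in the kernel.\<close>
    have "(if j0 = j0 then 1 else 0 :: real) = 0"
      by (rule ker[of "\<lambda>j. if j = j0 then 1 else 0" j0])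
        (use * j0 fin in \<open>auto simp: if_distrib sum.delta cong: if_cong\<close>)
    then show False by simp
  qed
  then obtain i0 where i0: "i0 \<in> I" "G i0 j0 z \<noteq> 0" by blast
  obtain r where r: "r \<in> SF" "\<forall>\<^sub>F p in nhds z. r p * G i0 j0 p = 1"
    using smooth_recip[OF G[OF i0(1) j0] i0(2)] by blast
  have rp: "r z * G i0 j0 z = 1" using eventually_nhds_x_imp_x[OF r(2)] .
  define I' J' where "I' = I - {i0}" and "J' = J - {j0}"
  \<comment> \<open>Eliminating the unknown \<open>j0\<close> by row \<open>i0\<close> leaves the
    Schur complement; multiplication by \<open>r\<close> replaces division by the pivot near
    \<open>z\<close>.\<close>
  define G' where "G' i j p = G i j p - G i j0 p * r p * G i0 j p" for i j p
  define w' where "w' i p = w i p - G i j0 p * r p * w i0 p" for i p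
  have split: "(\<Sum>j\<in>J. G i j p * c j) = G i j0 p * c j0 + (\<Sum>j\<in>J'. G i j p * c j)" for i p c
    unfolding J'_def using fin(2) j0 by (rule sum.remove)
  have G'_sum: "(\<Sum>j\<in>J'. G' i j p * c j) =
      (\<Sum>j\<in>J'. G i j p * c j) - G i j0 p * r p * (\<Sum>j\<in>J'. G i0 j p * c j)" for i p c
    by (simp add: G'_def left_diff_distrib sum_subtractf sum_distrib_left mult.assoc)
  have "\<exists>c. (\<forall>j\<in>J'. c j \<in> SF) \<and>
    (\<forall>\<^sub>F p in nhds z. \<forall>i\<in>I'. (\<Sum>j\<in>J'. G' i j p * c j p) = w' i p)"
  proof (rule Suc.hyps(1))
    show "n = card J'" "finite I'" "finite J'" "card I' = card J'"
      using Suc.hyps(2) Suc.prems(3) fin i0 j0 by (auto simp: I'_def J'_def)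
    show "G' i j \<in> SF" if "i \<in> I'" "j \<in> J'" for i j
      unfolding G'_def using that i0(1) j0 r(1)
      by (intro smooth_diff smooth_mult G) (auto simp: I'_def J'_def)
    show "w' i \<in> SF" if "i \<in> I'" for i
      unfolding w'_def using that i0(1) j0 r(1)
      by (intro smooth_diff smooth_mult G w) (auto simp: I'_def J'_def)
    fix c :: "'j \<Rightarrow> real" and j
    assume c: "\<And>i. i \<in> I' \<Longrightarrow> (\<Sum>j\<in>J'. G' i j z * c j) = 0" and j: "j \<in> J'"
    \<comment> \<open>A kernel vector of the reduced system lifts to one of the full system at
      \<open>z\<close> by solving row \<open>i0\<close> for the component \<open>j0\<close>.\<close>
    define d where "d = c(j0 := - r z * (\<Sum>j\<in>J'. G i0 j z * c j))"
    have dJ': "(\<Sum>j\<in>J'. G i j z * d j) = (\<Sum>j\<in>J'. G i j z * c j)" for i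
      by (rule sum.cong) (auto simp: d_def J'_def)
    have "(\<Sum>j\<in>J. G i j z * d j) = 0" if i: "i \<in> I" for i
    proof (cases "i = i0")
      case True
      have "G i0 j0 z * d j0 = - (r z * G i0 j0 z) * (\<Sum>j\<in>J'. G i0 j z * c j)"
        by (simp add: d_def)
      then show ?thesis using True by (simp add: split dJ' rp)
    next
      case False
      then have "(\<Sum>j\<in>J'. G' i j z * c j) = 0" using c i by (simp add: I'_def)
      then show ?thesis by (simp add: split dJ' G'_sum) (simp add: d_def mult.assoc)
    qed
    then have "d j = 0" using ker j by (auto simp: J'_def)
    then show "c j = 0" using j by (simp add: d_def J'_def split: if_splits)
  qed
  then obtain c where c: "\<And>j. j \<in> J' \<Longrightarrow> c j \<in> SF"
    "\<forall>\<^sub>F p in nhds z. \<forall>i\<in>I'. (\<Sum>j\<in>J'. G' i j p * c j p) = w' i p" by blast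
  define d where "d = c(j0 := \<lambda>p. r p * (w i0 p - (\<Sum>j\<in>J'. G i0 j p * c j p)))"
  have "d j \<in> SF" if "j \<in> J" for j
  proof (cases "j = j0")
    case True
    have "(\<lambda>p. r p * (w i0 p - (\<Sum>j\<in>J'. G i0 j p * c j p))) \<in> SF"
      using i0(1) r(1) w c(1) G by (intro smooth_mult smooth_diff smooth_sum) (auto simp: J'_def)
    then show ?thesis using True by (simp add: d_def)
  qed (use c(1) that in \<open>auto simp: d_def J'_def\<close>)
  moreover have "\<forall>\<^sub>F p in nhds z. \<forall>i\<in>I. (\<Sum>j\<in>J. G i j p * d j p) = w i p"
    using c(2) r(2)
  proof eventually_elim
    case (elim p)
    have dJ': "(\<Sum>j\<in>J'. G i j p * d j p) = (\<Sum>j\<in>J'. G i j p * c j p)" for i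
      by (rule sum.cong) (auto simp: d_def J'_def)
    show ?case
    proof
      fix i assume i: "i \<in> I"
      show "(\<Sum>j\<in>J. G i j p * d j p) = w i p"
      proof (cases "i = i0")
        case True
        have "G i0 j0 p * d j0 p = (r p * G i0 j0 p) * (w i0 p - (\<Sum>j\<in>J'. G i0 j p * c j p))"
          by (simp add: d_def)
        then show ?thesis using True elim(2) by (simp add: split dJ')
      next
        case False
        then have "(\<Sum>j\<in>J'. G' i j p * c j p) = w' i p" using elim(1) i by (simp add: I'_def)
        then show ?thesis
          by (simp add: split dJ' G'_sum w'_def) (simp add: d_def algebra_simps)
      qed
    qed
  qed
  ultimately show ?case by blast
qed


section \<open>Metrics and vector fields along maps\<close>

lemma (in smooth_mfd) linear_on_tangent_sum:
  assumes L: "\<And>u v a c. u \<in> tangent A p \<Longrightarrow> v \<in> tangent A p \<Longrightarrow>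
      L (\<lambda>f. a * u f + c * v f) = a * L u + c * L v"
    and "finite I" and "\<And>i. i \<in> I \<Longrightarrow> v i \<in> tangent A p"
  shows "L (\<lambda>f. \<Sum>i\<in>I. c i * v i f) = (\<Sum>i\<in>I. c i * (L (v i) :: real))"
  using assms(2,3)
proof (induction I rule: finite_induct)
  case empty
  show ?case using L[OF tangent_zero tangent_zero, of 0 0] by simp
next
  case (insert i I)
  then show ?case
    using L[of "v i" "\<lambda>f. \<Sum>i\<in>I. c i * v i f" "c i" 1] tangent_lincomb[of I v p c] by simp
qed

locale ssr_mfd = smooth_mfd A
  for A :: "('m::{t2_space, second_countable_topology}, 'e::euclidean_space) atlas" +
  fixes g :: "'m metric"
  assumes ssr: "singular_semi_riemannian A g"
begin

lemma g_sym: "v \<in> tangent A p \<Longrightarrow> w \<in> tangent A p \<Longrightarrow> g p v w = g p w v"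
  using ssr unfolding singular_semi_riemannian_def by blast

lemma g_left:
  "u \<in> tangent A p \<Longrightarrow> v \<in> tangent A p \<Longrightarrow> w \<in> tangent A p \<Longrightarrow>
    g p (\<lambda>f. a * u f + c * v f) w = a * g p u w + c * g p v w"
  using ssr unfolding singular_semi_riemannian_def by blast

lemma g_right:
  "u \<in> tangent A p \<Longrightarrow> v \<in> tangent A p \<Longrightarrow> w \<in> tangent A p \<Longrightarrow>
    g p w (\<lambda>f. a * u f + c * v f) = a * g p w u + c * g p w v"
  by (simp add: g_sym[of w p] g_left tangent_comb)

lemma ip_smooth: "X \<in> VF \<Longrightarrow> Y \<in> VF \<Longrightarrow> ip g X Y \<in> SF"
  using ssr unfolding singular_semi_riemannian_def by blast

lemma ip_sym: "X \<in> VF \<Longrightarrow> Y \<in> VF \<Longrightarrow> ip g X Y = ip g Y X"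
  using g_sym vfield_tangent unfolding ip_def by blast

lemma ip_vcomb_right:
  "X \<in> VF \<Longrightarrow> Y \<in> VF \<Longrightarrow> Z \<in> VF \<Longrightarrow>
    ip g X (vcomb f Y h Z) = (\<lambda>p. f p * ip g X Y p + h p * ip g X Z p)"
  by (simp add: ip_def vcomb_def g_right vfield_tangent)

lemma g_frame:
  assumes F: "frame_on N x E" "p \<in> N" and "u \<in> tangent A p" and "w \<in> tangent A p"
  shows "g p u w = (\<Sum>i\<in>Basis. u (x i) * g p (E i p) w)"
proof -
  have "g p u w = g p (\<lambda>f. \<Sum>i\<in>Basis. u (x i) * E i p f) w"
    by (rule arg_cong[OF frame_tvec[OF F assms(3)], of "\<lambda>z. g p z w"])
  also have "\<dots> = (\<Sum>i\<in>Basis. u (x i) * g p (E i p) w)"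
    by (rule linear_on_tangent_sum[of p "\<lambda>z. g p z w"])
      (auto simp: g_left assms(4) vfield_tangent frame_onD[OF F(1)])
  finally show ?thesis .
qed

lemma nondegenerate_unique:
  assumes "non_degenerate A g" and u: "u \<in> tangent A p" and v: "v \<in> tangent A p"
    and eq: "\<And>w. w \<in> tangent A p \<Longrightarrow> g p u w = g p v w"
  shows "u = v"
proof -
  have "(\<lambda>f. 1 * u f + (-1) * v f) = (\<lambda>f. 0)"
    using assms(1) tangent_comb[OF u v, of 1 "-1"] g_left[OF u v, of _ 1 "-1"] eq
    unfolding non_degenerate_def by simp
  then show ?thesis by (simp add: fun_eq_iff)
qed

end

locale smooth_map = dom: smooth_mfd A' + cod: smooth_mfd A
  for A' :: "('n::{t2_space, second_countable_topology}, 'f::euclidean_space) atlas"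
  and A :: "('m::{t2_space, second_countable_topology}, 'e::euclidean_space) atlas" +
  fixes \<pi> :: "'n \<Rightarrow> 'm"
  assumes isCont: "isCont \<pi> x"
    and pullback: "f \<in> smooth_funs A \<Longrightarrow> (\<lambda>x. f (\<pi> x)) \<in> smooth_funs A'"
begin

text \<open>Smooth sections of the pullback of the tangent bundle. For the identity map they are the
  vector fields; for a projection of a product they are vectors tangent to a factor that depend on
  both points.\<close>

definition along :: "('n \<Rightarrow> 'm tvec) set" where
  "along = {G. (\<forall>x. G x \<in> tangent A (\<pi> x)) \<and>
     (\<forall>f\<in>cod.SF. (\<lambda>x. G x f) \<in> dom.SF)}"

lemma along_tangent: "G \<in> along \<Longrightarrow> G x \<in> tangent A (\<pi> x)"
  by (simp add: along_def)

lemma along_smooth: "G \<in> along \<Longrightarrow> f \<in> cod.SF \<Longrightarrow> (\<lambda>x. G x f) \<in> dom.SF"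
  by (simp add: along_def)

lemma along_pullback: "X \<in> cod.VF \<Longrightarrow> (\<lambda>x. X (\<pi> x)) \<in> along"
  using pullback[OF cod.vfield_smooth] by (simp add: along_def cod.vfield_tangent der_def)

lemma along_zero: "(\<lambda>x f. 0) \<in> along"
  by (simp add: along_def cod.tangent_zero)

lemma along_comb:
  assumes "a \<in> dom.SF" "c \<in> dom.SF" "G \<in> along" "H \<in> along"
  shows "(\<lambda>x f. a x * G x f + c x * H x f) \<in> along"
proof -
  have "(\<lambda>x. a x * G x f + c x * H x f) \<in> dom.SF" if "f \<in> cod.SF" for f
    using assms that by (intro dom.smooth_add dom.smooth_mult) (simp_all add: along_smooth)
  moreover have "(\<lambda>f. a x * G x f + c x * H x f) \<in> tangent A (\<pi> x)" for x
    using assms by (intro cod.tangent_comb along_tangent)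
  ultimately show ?thesis by (simp add: along_def)
qed

lemma along_sum:
  assumes "\<And>i. i \<in> I \<Longrightarrow> c i \<in> dom.SF" "\<And>i. i \<in> I \<Longrightarrow> G i \<in> along"
  shows "(\<lambda>x f. \<Sum>i\<in>I. c i x * G i x f) \<in> along"
proof -
  have "(\<lambda>x. \<Sum>i\<in>I. c i x * G i x f) \<in> dom.SF" if "f \<in> cod.SF" for f
    using assms that by (intro dom.smooth_sum dom.smooth_mult) (simp_all add: along_smooth)
  moreover have "(\<lambda>f. \<Sum>i\<in>I. c i x * G i x f) \<in> tangent A (\<pi> x)" for x
    using assms by (intro cod.tangent_lincomb along_tangent)
  ultimately show ?thesis by (simp add: along_def)
qed

lemma eventually_in_open: "open N \<Longrightarrow> \<pi> x0 \<in> N \<Longrightarrow> \<forall>\<^sub>F x in nhds x0. \<pi> x \<in> N"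
  using isCont[of x0] unfolding isCont_def tendsto_at_iff_tendsto_nhds by (rule topological_tendstoD)

end

locale metric_along = smooth_map A' A \<pi> + ssr_mfd A g
  for A' :: "('n::{t2_space, second_countable_topology}, 'f::euclidean_space) atlas"
  and A :: "('m::{t2_space, second_countable_topology}, 'e::euclidean_space) atlas"
  and \<pi> and g
begin

text \<open>Near a point both sections are expanded in a frame of the target, which leaves smooth
  coefficients and the pulled back Gram matrix.\<close>

lemma along_inner_smooth:
  assumes G: "G \<in> along" and H: "H \<in> along"
  shows "(\<lambda>x. g (\<pi> x) (G x) (H x)) \<in> dom.SF"
proof (rule dom.smooth_funs_local)
  fix x0
  obtain N x E where F: "cod.frame_on N x E" "\<pi> x0 \<in> N" using cod.frame_exists by blast
  note F' = cod.frame_onD[OF F(1)]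
  define h where "h y = (\<Sum>i\<in>Basis. G y (x i) * (\<Sum>j\<in>Basis. H y (x j) * ip g (E j) (E i) (\<pi> y)))" for y
  have "h \<in> dom.SF"
    unfolding h_def
    by (intro dom.smooth_sum dom.smooth_mult along_smooth G H F' pullback[OF ip_smooth])
  moreover have "\<forall>\<^sub>F y in nhds x0. h y = g (\<pi> y) (G y) (H y)"
    using eventually_in_open[OF F'(1) F(2)]
  proof eventually_elim
    case (elim y)
    note t = along_tangent[OF G, of y] along_tangent[OF H, of y] cod.vfield_tangent[OF F'(3), of _ "\<pi> y"]
    have "g (\<pi> y) (G y) (H y) = (\<Sum>i\<in>Basis. G y (x i) * g (\<pi> y) (H y) (E i (\<pi> y)))"
      using g_frame[OF F(1) elim t(1,2)] g_sym[OF t(2) t(3)] by simp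
    then show ?case by (simp add: h_def ip_def g_frame[OF F(1) elim t(2) t(3)])
  qed
  ultimately show "\<exists>h\<in>dom.SF. \<forall>\<^sub>F y in nhds x0. h y = g (\<pi> y) (G y) (H y)" by blast
qed

text \<open>Raising an index. In a frame, the components of the representing vector solve the linear
  system of the Gram matrix, so near each point there is a smooth solution. Non-degeneracy makes the
  representing vector unique at every point, which glues the local solutions without a partition of
  unity.\<close>

lemma sharp_exists:
  assumes nd: "non_degenerate A g"
    and lin: "\<And>x u v a c. u \<in> tangent A (\<pi> x) \<Longrightarrow> v \<in> tangent A (\<pi> x) \<Longrightarrow>
      \<beta> x (\<lambda>f. a * u f + c * v f) = a * \<beta> x u + c * \<beta> x v"
    and smooth: "\<And>X. X \<in> cod.VF \<Longrightarrow> (\<lambda>x. \<beta> x (X (\<pi> x))) \<in> dom.SF"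
  obtains G where "G \<in> along" "\<And>x w. w \<in> tangent A (\<pi> x) \<Longrightarrow> g (\<pi> x) (G x) w = \<beta> x w"
proof -
  have local: "\<exists>H\<in>along. \<forall>\<^sub>F x in nhds x0. \<forall>w\<in>tangent A (\<pi> x). g (\<pi> x) (H x) w = \<beta> x w" for x0
  proof -
    obtain N x E where F: "cod.frame_on N x E" "\<pi> x0 \<in> N" using cod.frame_exists by blast
    note F' = cod.frame_onD[OF F(1)]
    note Et = cod.vfield_tangent[OF F'(3)]
    have "\<exists>c. (\<forall>j\<in>Basis. c j \<in> dom.SF) \<and> (\<forall>\<^sub>F y in nhds x0. \<forall>i\<in>Basis.
        (\<Sum>j\<in>Basis. ip g (E j) (E i) (\<pi> y) * c j y) = \<beta> y (E i (\<pi> y)))"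
    proof (rule dom.smooth_solve[where G = "\<lambda>i j y. ip g (E j) (E i) (\<pi> y)"
          and w = "\<lambda>i y. \<beta> y (E i (\<pi> y))" and z = x0])
      show "(\<lambda>y. ip g (E j) (E i) (\<pi> y)) \<in> dom.SF" for i j
        by (intro pullback[OF ip_smooth] F')
      show "(\<lambda>y. \<beta> y (E i (\<pi> y))) \<in> dom.SF" for i
        by (intro smooth F')
      \<comment> \<open>A kernel vector of the Gram matrix at \<open>x0\<close> is a tangent vector
        orthogonal to the frame, hence to everything, hence 0; the functions \<open>x k\<close> read
        off its coefficients.\<close>
      fix c and k :: 'e
      assume c: "\<And>i. i \<in> Basis \<Longrightarrow> (\<Sum>j\<in>Basis. ip g (E j) (E i) (\<pi> x0) * c j) = 0" and k: "k \<in> Basis"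
      define v where "v = (\<lambda>f. \<Sum>j\<in>Basis. c j * E j (\<pi> x0) f)"
      have v: "v \<in> tangent A (\<pi> x0)" unfolding v_def by (intro cod.tangent_lincomb Et)
      have "g (\<pi> x0) v (E i (\<pi> x0)) = (\<Sum>j\<in>Basis. c j * g (\<pi> x0) (E j (\<pi> x0)) (E i (\<pi> x0)))" for i
        unfolding v_def
        by (rule cod.linear_on_tangent_sum[of "\<pi> x0" "\<lambda>z. g (\<pi> x0) z (E i (\<pi> x0))"]) (auto simp: g_left Et)
      then have vE: "g (\<pi> x0) v (E i (\<pi> x0)) = 0" if "i \<in> Basis" for i
        using c[OF that] by (simp add: ip_def mult.commute)
      have "g (\<pi> x0) v w = 0" if "w \<in> tangent A (\<pi> x0)" for w
        using g_frame[OF F that v] g_sym[OF that v] g_sym[OF v Et] vE by simp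
      then have "v = (\<lambda>f. 0)" using nd v unfolding non_degenerate_def by blast
      then have "(\<Sum>j\<in>Basis. c j * E j (\<pi> x0) (x k)) = 0" unfolding v_def by metis
      then show "c k = 0"
        using k by (simp add: F'(4)[OF F(2)] inner_Basis if_distrib cong: if_cong)
    qed simp_all
    then obtain c where c: "\<And>j. j \<in> Basis \<Longrightarrow> c j \<in> dom.SF"
      "\<forall>\<^sub>F y in nhds x0. \<forall>i\<in>Basis. (\<Sum>j\<in>Basis. ip g (E j) (E i) (\<pi> y) * c j y) = \<beta> y (E i (\<pi> y))"
      by blast
    define H where "H = (\<lambda>y f. \<Sum>j\<in>Basis. c j y * E j (\<pi> y) f)"
    have H: "H \<in> along"
      unfolding H_def using along_sum[of Basis c "\<lambda>j y. E j (\<pi> y)"] c(1) along_pullback[OF F'(3)] by simp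
    moreover have "\<forall>\<^sub>F y in nhds x0. \<forall>w\<in>tangent A (\<pi> y). g (\<pi> y) (H y) w = \<beta> y w"
      using c(2) eventually_in_open[OF F'(1) F(2)]
    proof eventually_elim
      case (elim y)
      have HE: "g (\<pi> y) (H y) (E i (\<pi> y)) = \<beta> y (E i (\<pi> y))" if "i \<in> Basis" for i
      proof -
        have "g (\<pi> y) (H y) (E i (\<pi> y)) = (\<Sum>j\<in>Basis. c j y * g (\<pi> y) (E j (\<pi> y)) (E i (\<pi> y)))"
          unfolding H_def
          by (rule cod.linear_on_tangent_sum[of "\<pi> y" "\<lambda>z. g (\<pi> y) z (E i (\<pi> y))"]) (auto simp: g_left Et)
        then show ?thesis using elim(1) that by (simp add: ip_def mult.commute)
      qed
      show ?case
      proof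
        fix w assume w: "w \<in> tangent A (\<pi> y)"
        note Hy = along_tangent[OF H, of y]
        have "g (\<pi> y) (H y) w = (\<Sum>i\<in>Basis. w (x i) * g (\<pi> y) (E i (\<pi> y)) (H y))"
          using g_frame[OF F(1) elim(2) w Hy] g_sym[OF w Hy] by simp
        also have "\<dots> = (\<Sum>i\<in>Basis. w (x i) * \<beta> y (E i (\<pi> y)))"
          using HE g_sym[OF Hy Et] by simp
        also have "\<dots> = \<beta> y (\<lambda>f. \<Sum>i\<in>Basis. w (x i) * E i (\<pi> y) f)"
          by (rule cod.linear_on_tangent_sum[of "\<pi> y" "\<beta> y", symmetric]) (auto simp: lin Et)
        also have "\<dots> = \<beta> y w"
          by (rule arg_cong[OF cod.frame_tvec[OF F(1) elim(2) w, symmetric]])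
        finally show "g (\<pi> y) (H y) w = \<beta> y w" .
      qed
    qed
    ultimately show ?thesis by blast
  qed
  have "\<exists>v. v \<in> tangent A (\<pi> x) \<and> (\<forall>w\<in>tangent A (\<pi> x). g (\<pi> x) v w = \<beta> x w)" for x
    using local[of x] along_tangent eventually_nhds_x_imp_x by blast
  then obtain G where G: "\<And>x. G x \<in> tangent A (\<pi> x)"
    "\<And>x w. w \<in> tangent A (\<pi> x) \<Longrightarrow> g (\<pi> x) (G x) w = \<beta> x w" by metis
  have "(\<lambda>x. G x f) \<in> dom.SF" if f: "f \<in> cod.SF" for f
  proof (rule dom.smooth_funs_local)
    fix x0
    obtain H where H: "H \<in> along"
      "\<forall>\<^sub>F x in nhds x0. \<forall>w\<in>tangent A (\<pi> x). g (\<pi> x) (H x) w = \<beta> x w"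
      using local by blast
    have "\<forall>\<^sub>F x in nhds x0. H x f = G x f"
      using H(2)
    proof eventually_elim
      case (elim x)
      have "H x = G x"
        by (rule nondegenerate_unique[OF nd along_tangent[OF H(1)] G(1)]) (use elim G(2) in simp)
      then show ?case by simp
    qed
    then show "\<exists>h\<in>dom.SF. \<forall>\<^sub>F x in nhds x0. h x = G x f"
      by (intro bexI[of _ "\<lambda>x. H x f"] along_smooth[OF H(1) f])
  qed
  then have "G \<in> along" using G(1) by (simp add: along_def)
  then show ?thesis using that G(2) by blast
qed

end

context ssr_mfd
begin

text \<open>The case of the identity map. Since \<open>sharp_exists\<close> expects pointwise
  covectors and \<open>\<omega>\<close> acts on fields, a vector is passed to
  \<open>\<omega>\<close> through a chosen extension; by tensoriality the value does not depend on
  the choice.\<close>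

lemma tensorial_sharp:
  assumes nd: "non_degenerate A g" and \<omega>: "tensorial \<omega>"
  obtains G where "G \<in> VF" "\<And>Z. Z \<in> VF \<Longrightarrow> ip g G Z = \<omega> Z"
proof -
  interpret I: metric_along A A "\<lambda>x. x" g by unfold_locales auto
  define ext where "ext x w = (SOME Z. Z \<in> VF \<and> Z x = w)" for x w
  have ext: "ext x w \<in> VF" "ext x w x = w" if "w \<in> tangent A x" for x w
    using someI_ex[of "\<lambda>Z. Z \<in> VF \<and> Z x = w"] vfield_extend[OF that]
    unfolding ext_def by metis+
  obtain G where G: "G \<in> I.along" "\<And>x w. w \<in> tangent A x \<Longrightarrow> g x (G x) w = \<omega> (ext x w) x"
  proof (rule I.sharp_exists[OF nd, of "\<lambda>x w. \<omega> (ext x w) x"])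
    fix x u v and a c :: real
    assume uv: "u \<in> tangent A x" "v \<in> tangent A x"
    let ?w = "\<lambda>f. a * u f + c * v f"
    have "\<omega> (ext x ?w) x = \<omega> (vcomb (\<lambda>x. a) (ext x u) (\<lambda>x. c) (ext x v)) x"
    proof (rule tensorial_pointwise[OF \<omega> ext(1)[OF tangent_comb[OF uv]]])
      show "vcomb (\<lambda>x. a) (ext x u) (\<lambda>x. c) (ext x v) \<in> VF"
        by (intro vfield_vcomb smooth_const ext uv)
      show "ext x ?w x = vcomb (\<lambda>x. a) (ext x u) (\<lambda>x. c) (ext x v) x"
        by (simp add: vcomb_def ext(2) uv tangent_comb)
    qed
    also have "\<dots> = a * \<omega> (ext x u) x + c * \<omega> (ext x v) x"
      by (rule tensorialD(2)[OF \<omega>]) (use ext uv in auto)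
    finally show "\<omega> (ext x ?w) x = a * \<omega> (ext x u) x + c * \<omega> (ext x v) x" .
  next
    fix X assume X: "X \<in> VF"
    have "\<omega> (ext x (X x)) x = \<omega> X x" for x
      by (rule tensorial_pointwise[OF \<omega>]) (use ext vfield_tangent[OF X] X in auto)
    then show "(\<lambda>x. \<omega> (ext x (X x)) x) \<in> SF"
      using tensorialD(1)[OF \<omega> X] by simp
  qed blast
  have "G \<in> VF" using G(1) by (simp add: I.along_def vector_fields_def der_def)
  moreover have "ip g G Z = \<omega> Z" if Z: "Z \<in> VF" for Z
  proof
    fix x
    have "\<omega> (ext x (Z x)) x = \<omega> Z x"
      by (rule tensorial_pointwise[OF \<omega>]) (use ext vfield_tangent[OF Z] Z in auto)
    then show "ip g G Z x = \<omega> Z x" using G(2) vfield_tangent[OF Z] by (simp add: ip_def)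
  qed
  ultimately show ?thesis using that by blast
qed


subsection \<open>The Koszul form\<close>

lemma bracket_anti: "lie_bracket X Y p = (\<lambda>f. - lie_bracket Y X p f)"
  by (simp add: lie_bracket_def)

lemma ip_bracket_anti:
  assumes "X \<in> VF" "Y \<in> VF" "Z \<in> VF"
  shows "ip g X (lie_bracket Y Z) p = - ip g X (lie_bracket Z Y) p"
proof -
  note t = vfield_tangent[OF vfield_bracket[OF assms(3,2)], of p]
  show ?thesis
    unfolding ip_def bracket_anti[of Y Z]
    using g_right[OF t t vfield_tangent[OF assms(1)], of 0 "-1"] by simp
qed

text \<open>Places \<open>Z\<close> second in both brackets that contain it, where the Leibniz rule
  for \<open>vcomb\<close> applies.\<close>

lemma koszul_alt:
  assumes "X \<in> VF" "Y \<in> VF" "Z \<in> VF"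
  shows "koszul g X Y Z p = 1/2 * (der X (ip g Y Z) p + der Y (ip g X Z) p - der Z (ip g X Y) p
    - ip g X (lie_bracket Y Z) p - ip g Y (lie_bracket X Z) p + ip g Z (lie_bracket X Y) p)"
  unfolding koszul_def ip_bracket_anti[OF assms(2,3,1)] ip_sym[OF assms(3,1)] by simp

lemma der_vcomb: "der (vcomb f X h Y) k p = f p * der X k p + h p * der Y k p"
  by (simp add: der_def vcomb_def)

lemma der_mult_add:
  assumes "X \<in> VF" "f \<in> SF" "f' \<in> SF"
    "h \<in> SF" "h' \<in> SF"
  shows "der X (\<lambda>x. f x * f' x + h x * h' x) p =
    der X f p * f' p + f p * der X f' p + der X h p * h' p + h p * der X h' p"
  unfolding der_def
    tangent_add[OF vfield_tangent[OF assms(1)] smooth_mult[OF assms(2,3)] smooth_mult[OF assms(4,5)]]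
    tangent_mult[OF vfield_tangent[OF assms(1)] assms(2,3)]
    tangent_mult[OF vfield_tangent[OF assms(1)] assms(4,5)]
  by simp

lemma bracket_vcomb:
  assumes Y: "Y \<in> VF" and Z: "Z \<in> VF" and W: "W \<in> VF"
    and f: "f \<in> SF" and h: "h \<in> SF"
  shows "lie_bracket Y (vcomb f Z h W) =
    vcomb (\<lambda>x. 1) (vcomb (der Y f) Z f (lie_bracket Y Z)) (\<lambda>x. 1) (vcomb (der Y h) W h (lie_bracket Y W))"
    (is "?L = ?R")
proof (intro ext)
  fix p k
  show "?L p k = ?R p k"
  proof (cases "k \<in> SF")
    case True
    have "der (vcomb f Z h W) k = (\<lambda>p. f p * der Z k p + h p * der W k p)"
      by (simp add: der_vcomb fun_eq_iff)
    then show ?thesis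
      using der_mult_add[OF Y f vfield_smooth[OF Z True] h vfield_smooth[OF W True], of p]
      by (simp add: lie_bracket_def vcomb_def algebra_simps) (simp add: der_def algebra_simps)
  next
    case False
    have "?L \<in> VF" "?R \<in> VF"
      using assms by (intro vfield_bracket vfield_vcomb vfield_smooth smooth_const; simp)+
    then show ?thesis
      using tangent_nonsmooth[OF vfield_tangent False] by metis
  qed
qed

lemma ip_bracket_vcomb:
  assumes X: "X \<in> VF"
    and Y: "Y \<in> VF" and Z: "Z \<in> VF" and W: "W \<in> VF"
    and f: "f \<in> SF" and h: "h \<in> SF"
  shows "ip g X (lie_bracket Y (vcomb f Z h W)) p =
    der Y f p * ip g X Z p + f p * ip g X (lie_bracket Y Z) p
    + der Y h p * ip g X W p + h p * ip g X (lie_bracket Y W) p"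
  unfolding bracket_vcomb[OF Y Z W f h]
  by (simp add: ip_vcomb_right vfield_vcomb vfield_bracket vfield_smooth assms)

lemma koszul_smooth:
  assumes "X \<in> VF" "Y \<in> VF" "Z \<in> VF"
  shows "koszul g X Y Z \<in> SF"
  unfolding koszul_def
  by (intro smooth_mult smooth_add smooth_diff smooth_const vfield_smooth ip_smooth vfield_bracket assms)

text \<open>Derivatives of the coefficients cancel: those from differentiating
  \<open>g(Y, Z)\<close> along \<open>X\<close> against the bracket of \<open>X\<close> and
  \<open>Z\<close>, those from differentiating \<open>g(X, Z)\<close> along \<open>Y\<close> against
  the bracket of \<open>Y\<close> and \<open>Z\<close>.\<close>

lemma koszul_tensorial:
  assumes X: "X \<in> VF" and Y: "Y \<in> VF"
  shows "tensorial (koszul g X Y)"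
  unfolding tensorial_def
proof (intro conjI ballI allI)
  show "koszul g X Y Z \<in> SF" if "Z \<in> VF" for Z
    using koszul_smooth X Y that by blast
  fix f h Z W p
  assume f: "f \<in> SF" and h: "h \<in> SF"
    and Z: "Z \<in> VF" and W: "W \<in> VF"
  note ZW = vfield_vcomb[OF f h Z W]
  show "koszul g X Y (vcomb f Z h W) p = f p * koszul g X Y Z p + h p * koszul g X Y W p"
    unfolding koszul_alt[OF X Y ZW] koszul_alt[OF X Y Z] koszul_alt[OF X Y W]
      ip_bracket_vcomb[OF X Y Z W f h] ip_bracket_vcomb[OF Y X Z W f h]
      ip_vcomb_right[OF X Z W] ip_vcomb_right[OF Y Z W] der_vcomb
      der_mult_add[OF X f ip_smooth[OF Y Z] h ip_smooth[OF Y W]]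
      der_mult_add[OF Y f ip_smooth[OF X Z] h ip_smooth[OF X W]]
      ip_sym[OF ZW vfield_bracket[OF X Y]] ip_sym[OF Z vfield_bracket[OF X Y]] ip_sym[OF W vfield_bracket[OF X Y]]
      ip_vcomb_right[OF vfield_bracket[OF X Y] Z W]
    by (simp add: field_simps)
qed

lemma koszul_metric:
  assumes "X \<in> VF" "Y \<in> VF" "Z \<in> VF"
  shows "der X (ip g Y Z) p = koszul g X Y Z p + koszul g X Z Y p"
  using ip_bracket_anti[OF assms(1,2,3), of p] ip_sym[OF assms(2,3)] assms
  by (simp add: koszul_alt field_simps)

lemma koszul_torsion_free:
  assumes "X \<in> VF" "Y \<in> VF" "Z \<in> VF"
  shows "koszul g X Y Z p - koszul g Y X Z p = ip g (lie_bracket X Y) Z p"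
  using ip_bracket_anti[OF assms(3,1,2), of p] ip_sym[OF assms(1,2)]
    ip_sym[OF vfield_bracket[OF assms(1,2)] assms(3)] assms
  by (simp add: koszul_alt field_simps)

text \<open>The Levi-Civita derivative, chosen by its defining property; such a field exists once
  \<open>g\<close> is non-degenerate.\<close>

definition nabla :: "'m vfield \<Rightarrow> 'm vfield \<Rightarrow> 'm vfield" where
  "nabla X Y = (SOME G. G \<in> VF \<and> (\<forall>Z\<in>VF. ip g G Z = koszul g X Y Z))"

lemma
  assumes "non_degenerate A g" and "X \<in> VF" and "Y \<in> VF"
  shows vfield_nabla: "nabla X Y \<in> VF"
    and ip_nabla: "Z \<in> VF \<Longrightarrow> ip g (nabla X Y) Z = koszul g X Y Z"
proof -
  have "\<exists>G. G \<in> VF \<and> (\<forall>Z\<in>VF. ip g G Z = koszul g X Y Z)"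
    using tensorial_sharp[OF assms(1) koszul_tensorial[OF assms(2,3)]] by metis
  from someI_ex[OF this, folded nabla_def]
  show "nabla X Y \<in> VF"
    and "Z \<in> VF \<Longrightarrow> ip g (nabla X Y) Z = koszul g X Y Z" by blast+
qed

end

section \<open>Products\<close>

lemma inv_into_map_prod:
  assumes "inj_on \<phi> U" "inj_on \<psi> V" "y \<in> \<phi> ` U" "z \<in> \<psi> ` V"
  shows "inv_into (U \<times> V) (map_prod \<phi> \<psi>) (y, z) = (inv_into U \<phi> y, inv_into V \<psi> z)"
  by (rule inv_into_f_eq[OF map_prod_inj_on[OF assms(1,2)]])
    (use assms in \<open>auto simp: f_inv_into_f inv_into_into\<close>)

lemma (in smooth_map) differential_tangent:
  assumes "v \<in> tangent A' x"
  shows "differential A \<pi> v \<in> tangent A (\<pi> x)"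
  unfolding tangent_def differential_def comp_def
  using dom.tangent_linear[OF assms pullback pullback] dom.tangent_mult[OF assms pullback pullback]
  by (simp add: cod.smooth_add cod.smooth_mult)

text \<open>Shared by both kinds of lifts: \<open>\<sigma> y z\<close> is the point of the slice
  through \<open>y\<close> with coordinate \<open>z\<close>, and \<open>e\<close> embeds directions
  of the factor into those of the product. In coordinates the derivative along a slice is a sum of
  \<open>X(x_i)\<close> times partial derivatives of \<open>f\<close> on the product, all
  smooth.\<close>

lemma (in smooth_map) smooth_along_slices:
  fixes f :: "'n \<Rightarrow> real" and \<sigma> :: "'n \<Rightarrow> 'm \<Rightarrow> 'n" and e :: "'e \<Rightarrow> 'f"
  assumes X: "X \<in> cod.VF" and f: "f \<in> dom.SF"
    and slice: "\<And>y. (\<lambda>z. f (\<sigma> y z)) \<in> cod.SF"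
    and charts: "\<And>x. \<exists>U \<phi> W \<eta>. (U, \<phi>) \<in> A \<and> (W, \<eta>) \<in> A' \<and> x \<in> W \<and> \<pi> ` W \<subseteq> U \<and>
      (\<forall>y\<in>W. \<forall>i. chart_deriv W \<eta> f y (e i) = chart_deriv U \<phi> (\<lambda>z. f (\<sigma> y z)) (\<pi> y) i)"
  shows "(\<lambda>y. X (\<pi> y) (\<lambda>z. f (\<sigma> y z))) \<in> dom.SF"
proof (rule dom.smooth_funs_local)
  fix x0
  obtain U \<phi> W \<eta> where U: "(U, \<phi>) \<in> A" and W: "(W, \<eta>) \<in> A'" "x0 \<in> W" and WU: "\<pi> ` W \<subseteq> U"
    and cd: "\<And>y i. y \<in> W \<Longrightarrow> chart_deriv W \<eta> f y (e i) = chart_deriv U \<phi> (\<lambda>z. f (\<sigma> y z)) (\<pi> y) i"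
    using charts by metis
  have x0U: "\<pi> x0 \<in> U" using W(2) WU by blast
  obtain N x E where F: "cod.frame_on N x E" "\<pi> x0 \<in> N" "N \<subseteq> U"
    and E: "\<And>y f k. y \<in> N \<Longrightarrow> f \<in> cod.SF \<Longrightarrow> E k y f = chart_deriv U \<phi> f y k"
    using cod.chart_frame[OF U x0U] by metis
  obtain N' x' E' where F': "dom.frame_on N' x' E'" "x0 \<in> N'" "N' \<subseteq> W"
    and E': "\<And>y f k. y \<in> N' \<Longrightarrow> f \<in> dom.SF \<Longrightarrow> E' k y f = chart_deriv W \<eta> f y k"
    using dom.chart_frame[OF W] by metis
  define h where "h = (\<lambda>y. \<Sum>i\<in>Basis. der X (x i) (\<pi> y) * der (E' (e i)) f y)"
  have "h \<in> dom.SF"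
    unfolding h_def
    by (intro dom.smooth_sum dom.smooth_mult pullback cod.vfield_smooth dom.vfield_smooth X f
        cod.frame_onD[OF F(1)] dom.frame_onD[OF F'(1)])
  moreover have "\<forall>\<^sub>F y in nhds x0. y \<in> N'"
    using dom.frame_onD(1)[OF F'(1)] F'(2) eventually_nhds by blast
  with eventually_in_open[OF cod.frame_onD(1)[OF F(1)] F(2)]
  have "\<forall>\<^sub>F y in nhds x0. h y = X (\<pi> y) (\<lambda>z. f (\<sigma> y z))"
  proof eventually_elim
    case (elim y)
    then have y: "y \<in> W" using F'(3) by blast
    have "X (\<pi> y) (\<lambda>z. f (\<sigma> y z)) = (\<Sum>i\<in>Basis. X (\<pi> y) (x i) * E i (\<pi> y) (\<lambda>z. f (\<sigma> y z)))"
      by (rule fun_cong[OF cod.frame_tvec[OF F(1) elim(1) cod.vfield_tangent[OF X]]])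
    also have "\<dots> = h y"
      by (simp add: h_def der_def E[OF elim(1) slice] E'[OF elim(2) f] cd[OF y])
    finally show ?case by simp
  qed
  ultimately show "\<exists>h\<in>dom.SF. \<forall>\<^sub>F y in nhds x0. h y = X (\<pi> y) (\<lambda>z. f (\<sigma> y z))"
    by blast
qed

text \<open>Both facts come from the coordinate expression \<open>c\<close> of \<open>\<pi>\<close>
  between two charts: composition with \<open>c\<close> gives smoothness, the chain rule for
  \<open>c\<close> gives derivatives. For projections and slice inclusions \<open>c\<close> is
  linear or affine.\<close>

lemma
  fixes A' :: "('n::{t2_space, second_countable_topology}, 'f::euclidean_space) atlas"
    and A :: "('m::{t2_space, second_countable_topology}, 'e::euclidean_space) atlas"
  assumes "smooth_mfd A'" and "smooth_mfd A" and f: "f \<in> smooth_funs A"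
    and U: "(U, \<phi>) \<in> A'" and V: "(V, \<psi>) \<in> A" and "\<pi> ` U \<subseteq> V" and x: "x \<in> U"
    and c: "\<And>y. y \<in> U \<Longrightarrow> c (\<phi> y) = \<psi> (\<pi> y)"
  shows smooth_near_pullback: "smooth_on (\<phi> ` U) c \<Longrightarrow> smooth_mfd.smooth_near A' (\<lambda>x. f (\<pi> x)) x"
    and chart_deriv_pullback: "(c has_derivative D) (at (\<phi> x)) \<Longrightarrow>
      chart_deriv U \<phi> (\<lambda>x. f (\<pi> x)) x i = chart_deriv V \<psi> f (\<pi> x) (D i)"
proof -
  interpret dom: smooth_mfd A' by fact
  interpret cod: smooth_mfd A by fact
  have eq: "(f \<circ> inv_into V \<psi>) (c y) = f (\<pi> (inv_into U \<phi> y))" if "y \<in> \<phi> ` U" for y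
    using that assms(6) c dom.chart_inv[OF U] cod.chart_inv[OF V] by auto
  show "dom.smooth_near (\<lambda>x. f (\<pi> x)) x" if sc: "smooth_on (\<phi> ` U) c"
  proof (rule dom.smooth_nearI[OF U dom.chart_open[OF U] x order_refl])
    have "smooth_on (\<psi> ` V) (f \<circ> inv_into V \<psi>)" using f V by (auto simp: smooth_funs_def)
    from smooth_on_compose[OF dom.chart_image_open[OF U] _ sc this]
    have "smooth_on (\<phi> ` U) (\<lambda>y. (f \<circ> inv_into V \<psi>) (c y))" using assms(6) c by auto
    then show "smooth_on (\<phi> ` U) (\<lambda>y. f (\<pi> (inv_into U \<phi> y)))"
      by (rule smooth_on_cong[OF dom.chart_image_open[OF U] _ eq])
  qed
  show "chart_deriv U \<phi> (\<lambda>x. f (\<pi> x)) x i = chart_deriv V \<psi> f (\<pi> x) (D i)"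
    if D: "(c has_derivative D) (at (\<phi> x))"
  proof -
    have "((f \<circ> inv_into V \<psi>) has_derivative chart_deriv V \<psi> f (\<pi> x)) (at (c (\<phi> x)))"
      using cod.chart_has_derivative[OF V _ f, of "\<pi> x"] assms(6) c x by auto
    from has_derivative_compose[OF D this]
    have "(((\<lambda>x. f (\<pi> x)) \<circ> inv_into U \<phi>) has_derivative (\<lambda>i. chart_deriv V \<psi> f (\<pi> x) (D i))) (at (\<phi> x))"
      by (rule has_derivative_transform_within_open[OF _ dom.chart_image_open[OF U]])
        (use x eq in auto)
    from fun_cong[OF frechet_derivative_at[OF this, symmetric]] show ?thesis
      unfolding chart_deriv_def[of U \<phi>] .
  qed
qed

locale product_mfd = B: smooth_mfd AB + F: smooth_mfd AF
  for AB :: "('m::{t2_space, second_countable_topology}, 'e::euclidean_space) atlas"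
  and AF :: "('n::{t2_space, second_countable_topology}, 'f::euclidean_space) atlas"
begin

abbreviation "AP \<equiv> prod_atlas AB AF"

section \<open>The product manifold, its projections and its slices\<close>

lemma prod_chart:
  assumes "(U, \<phi>) \<in> AB" and "(V, \<psi>) \<in> AF"
  shows "(U \<times> V, map_prod \<phi> \<psi>) \<in> AP"
  unfolding prod_atlas_def using assms by (intro image_eqI[of _ _ "((U, \<phi>), (V, \<psi>))"]) auto

lemma prod_chartE:
  assumes "c \<in> AP"
  obtains U \<phi> V \<psi> where "(U, \<phi>) \<in> AB" "(V, \<psi>) \<in> AF" "c = (U \<times> V, map_prod \<phi> \<psi>)"
  using assms unfolding prod_atlas_def by auto

lemma prod_chart_inv:
  assumes "(U, \<phi>) \<in> AB" and "(V, \<psi>) \<in> AF" and "y \<in> \<phi> ` U" "z \<in> \<psi> ` V"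
  shows "inv_into (U \<times> V) (map_prod \<phi> \<psi>) (y, z) = (inv_into U \<phi> y, inv_into V \<psi> z)"
proof (rule inv_into_map_prod[OF _ _ assms(3,4)])
  show "inj_on \<phi> U" using B.chart_inv[OF assms(1)] by (metis inj_onI)
  show "inj_on \<psi> V" using F.chart_inv[OF assms(2)] by (metis inj_onI)
qed

lemma image_map_prod: "map_prod \<phi> \<psi> ` (U \<times> V) = (\<phi> ` U) \<times> (\<psi> ` V)"
  by force

lemma smooth_on_fst:
  fixes f :: "'e \<Rightarrow> 'c::real_normed_vector"
  assumes "open S" "open T" "smooth_on S f"
  shows "smooth_on (S \<times> (T :: 'f set)) (\<lambda>x. f (fst x))"
  by (rule smooth_on_compose[OF open_Times[OF assms(1,2)] _
        smooth_on_bounded_linear[OF open_Times[OF assms(1,2)] bounded_linear_fst] assms(3)]) auto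

lemma smooth_on_snd:
  fixes f :: "'f \<Rightarrow> 'c::real_normed_vector"
  assumes "open S" "open T" "smooth_on T f"
  shows "smooth_on ((S :: 'e set) \<times> T) (\<lambda>x. f (snd x))"
  by (rule smooth_on_compose[OF open_Times[OF assms(1,2)] _
        smooth_on_bounded_linear[OF open_Times[OF assms(1,2)] bounded_linear_snd] assms(3)]) auto

lemma prod_manifold: "smooth_manifold AP"
  unfolding smooth_manifold_def
proof (intro conjI ballI, goal_cases)
  case 1
  have "\<exists>c\<in>AP. (p, q) \<in> fst c" for p q
  proof -
    obtain U \<phi> where 1: "(U, \<phi>) \<in> AB" "p \<in> U" using B.chart_cover by blast
    obtain V \<psi> where 2: "(V, \<psi>) \<in> AF" "q \<in> V" using F.chart_cover by blast
    show ?thesis using 1(2) 2(2) by (intro bexI[OF _ prod_chart[OF 1(1) 2(1)]]) simp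
  qed
  then show ?case by (force simp: case_prod_beta)
next
  case (2 c)
  then obtain U \<phi> V \<psi> where U: "(U, \<phi>) \<in> AB" and V: "(V, \<psi>) \<in> AF"
    and c: "c = (U \<times> V, map_prod \<phi> \<psi>)" using prod_chartE by metis
  have o: "open (U \<times> V)" "open (map_prod \<phi> \<psi> ` (U \<times> V))"
    using B.chart_open[OF U] F.chart_open[OF V] B.chart_image_open[OF U] F.chart_image_open[OF V]
    unfolding image_map_prod by (simp_all add: open_Times)
  have "homeomorphism (U \<times> V) (map_prod \<phi> \<psi> ` (U \<times> V)) (map_prod \<phi> \<psi>) (inv_into (U \<times> V) (map_prod \<phi> \<psi>))"
  proof (rule homeomorphismI)
    have "continuous_on (U \<times> V) (\<lambda>x. (\<phi> (fst x), \<psi> (snd x)))"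
      by (intro continuous_on_Pair continuous_on_compose2[OF B.chart_continuous[OF U]]
          continuous_on_compose2[OF F.chart_continuous[OF V]] continuous_intros) auto
    then show "continuous_on (U \<times> V) (map_prod \<phi> \<psi>)"
      by (simp add: map_prod_def case_prod_beta)
    have "continuous_on (\<phi> ` U \<times> \<psi> ` V) (\<lambda>x. (inv_into U \<phi> (fst x), inv_into V \<psi> (snd x)))"
      by (intro continuous_on_Pair continuous_on_compose2[OF B.chart_inv_continuous[OF U]]
          continuous_on_compose2[OF F.chart_inv_continuous[OF V]] continuous_intros) auto
    then have "continuous_on (\<phi> ` U \<times> \<psi> ` V) (inv_into (U \<times> V) (map_prod \<phi> \<psi>))"
      by (rule continuous_on_eq) (use prod_chart_inv[OF U V] in auto)
    then show "continuous_on (map_prod \<phi> \<psi> ` (U \<times> V)) (inv_into (U \<times> V) (map_prod \<phi> \<psi>))"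
      unfolding image_map_prod .
    show "inv_into (U \<times> V) (map_prod \<phi> \<psi>) ` map_prod \<phi> \<psi> ` (U \<times> V) \<subseteq> U \<times> V"
      by (rule image_subsetI) (rule inv_into_into)
    show "inv_into (U \<times> V) (map_prod \<phi> \<psi>) (map_prod \<phi> \<psi> x) = x" if "x \<in> U \<times> V" for x
      using that prod_chart_inv[OF U V] B.chart_inv[OF U] F.chart_inv[OF V] by (cases x) auto
    show "map_prod \<phi> \<psi> (inv_into (U \<times> V) (map_prod \<phi> \<psi>) y) = y" if "y \<in> map_prod \<phi> \<psi> ` (U \<times> V)" for y
      using that by (rule f_inv_into_f)
  qed auto
  then show ?case using c o by simp
next
  case (3 c)
  then obtain U \<phi> V \<psi> where U: "(U, \<phi>) \<in> AB" and V: "(V, \<psi>) \<in> AF"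
    and c: "c = (U \<times> V, map_prod \<phi> \<psi>)" using prod_chartE by metis
  have "smooth_on (map_prod \<phi> \<psi> ` (U \<times> V \<inter> fst d)) (snd d \<circ> inv_into (U \<times> V) (map_prod \<phi> \<psi>))"
    if dA: "d \<in> AP" for d
  proof -
    obtain U' \<phi>' V' \<psi>' where U': "(U', \<phi>') \<in> AB" and V': "(V', \<psi>') \<in> AF"
      and d: "d = (U' \<times> V', map_prod \<phi>' \<psi>')" using prod_chartE[OF dA] by metis
    have o: "open (\<phi> ` (U \<inter> U'))" "open (\<psi> ` (V \<inter> V'))"
      using B.chart_open[OF U] B.chart_open[OF U'] F.chart_open[OF V] F.chart_open[OF V']
      by (auto intro!: B.chart_open_image[OF U] F.chart_open_image[OF V])
    have im: "map_prod \<phi> \<psi> ` (U \<times> V \<inter> U' \<times> V') = \<phi> ` (U \<inter> U') \<times> \<psi> ` (V \<inter> V')"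
      by force
    have "smooth_on (\<phi> ` (U \<inter> U') \<times> \<psi> ` (V \<inter> V'))
        (\<lambda>x. ((\<phi>' \<circ> inv_into U \<phi>) (fst x), (\<psi>' \<circ> inv_into V \<psi>) (snd x)))"
      by (rule smooth_on_Pair[OF open_Times[OF o] smooth_on_fst[OF o B.chart_transition[OF U U']]
            smooth_on_snd[OF o F.chart_transition[OF V V']]])
    then have "smooth_on (\<phi> ` (U \<inter> U') \<times> \<psi> ` (V \<inter> V'))
        (map_prod \<phi>' \<psi>' \<circ> inv_into (U \<times> V) (map_prod \<phi> \<psi>))"
      by (rule smooth_on_cong[OF open_Times[OF o]]) (use prod_chart_inv[OF U V] in auto)
    then show ?thesis using d im by simp
  qed
  then show ?case by (auto simp: c)
qed

end

sublocale product_mfd \<subseteq> P: smooth_mfd AP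
  by unfold_locales (rule prod_manifold)

context product_mfd
begin

lemma smooth_fst:
  assumes "f \<in> B.SF"
  shows "(\<lambda>x. f (fst x)) \<in> P.SF"
  unfolding P.smooth_funs_iff
proof
  fix x :: "'m \<times> 'n"
  obtain U \<phi> where U: "(U, \<phi>) \<in> AB" "fst x \<in> U" using B.chart_cover by blast
  obtain V \<psi> where V: "(V, \<psi>) \<in> AF" "snd x \<in> V" using F.chart_cover by blast
  note o = P.chart_image_open[OF prod_chart[OF U(1) V(1)]]
  show "P.smooth_near (\<lambda>x. f (fst x)) x"
    by (rule smooth_near_pullback[OF P.smooth_mfd_axioms B.smooth_mfd_axioms assms
          prod_chart[OF U(1) V(1)] U(1) _ _ _ smooth_on_bounded_linear[OF o bounded_linear_fst]])
      (use U V in \<open>auto simp: mem_Times_iff\<close>)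
qed

lemma smooth_snd:
  assumes "f \<in> F.SF"
  shows "(\<lambda>x. f (snd x)) \<in> P.SF"
  unfolding P.smooth_funs_iff
proof
  fix x :: "'m \<times> 'n"
  obtain U \<phi> where U: "(U, \<phi>) \<in> AB" "fst x \<in> U" using B.chart_cover by blast
  obtain V \<psi> where V: "(V, \<psi>) \<in> AF" "snd x \<in> V" using F.chart_cover by blast
  note o = P.chart_image_open[OF prod_chart[OF U(1) V(1)]]
  show "P.smooth_near (\<lambda>x. f (snd x)) x"
    by (rule smooth_near_pullback[OF P.smooth_mfd_axioms F.smooth_mfd_axioms assms
          prod_chart[OF U(1) V(1)] V(1) _ _ _ smooth_on_bounded_linear[OF o bounded_linear_snd]])
      (use U V in \<open>auto simp: mem_Times_iff\<close>)
qed

lemma smooth_slice_fst: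
  assumes "f \<in> P.SF"
  shows "(\<lambda>p. f (p, q)) \<in> B.SF"
  unfolding B.smooth_funs_iff
proof
  fix p
  obtain U \<phi> where U: "(U, \<phi>) \<in> AB" "p \<in> U" using B.chart_cover by blast
  obtain V \<psi> where V: "(V, \<psi>) \<in> AF" "q \<in> V" using F.chart_cover by blast
  note o = B.chart_image_open[OF U(1)]
  show "B.smooth_near (\<lambda>p. f (p, q)) p"
    by (rule smooth_near_pullback[OF B.smooth_mfd_axioms P.smooth_mfd_axioms assms
          U(1) prod_chart[OF U(1) V(1)] _ U(2) _ smooth_on_Pair[OF o
            smooth_on_bounded_linear[OF o bounded_linear_ident] smooth_on_const[OF o, of "\<psi> q"]]])
      (use V in auto)
qed

lemma smooth_slice_snd:
  assumes "f \<in> P.SF"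
  shows "(\<lambda>q. f (p, q)) \<in> F.SF"
  unfolding F.smooth_funs_iff
proof
  fix q
  obtain U \<phi> where U: "(U, \<phi>) \<in> AB" "p \<in> U" using B.chart_cover by blast
  obtain V \<psi> where V: "(V, \<psi>) \<in> AF" "q \<in> V" using F.chart_cover by blast
  note o = F.chart_image_open[OF V(1)]
  show "F.smooth_near (\<lambda>q. f (p, q)) q"
    by (rule smooth_near_pullback[OF F.smooth_mfd_axioms P.smooth_mfd_axioms assms
          V(1) prod_chart[OF U(1) V(1)] _ V(2) _ smooth_on_Pair[OF o
            smooth_on_const[OF o, of "\<phi> p"] smooth_on_bounded_linear[OF o bounded_linear_ident]]])
      (use U in auto)
qed

lemma
  assumes U: "(U, \<phi>) \<in> AB" "p \<in> U" and V: "(V, \<psi>) \<in> AF" "q \<in> V" and f: "f \<in> P.SF"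
  shows chart_deriv_fst:
      "chart_deriv (U \<times> V) (map_prod \<phi> \<psi>) f (p, q) (i, 0) = chart_deriv U \<phi> (\<lambda>p. f (p, q)) p i"
    and chart_deriv_snd:
      "chart_deriv (U \<times> V) (map_prod \<phi> \<psi>) f (p, q) (0, j) = chart_deriv V \<psi> (\<lambda>q. f (p, q)) q j"
proof -
  have 1: "((\<lambda>y. (y, \<psi> q)) has_derivative (\<lambda>i. (i, 0))) (at (\<phi> p))"
    and 2: "((\<lambda>z. (\<phi> p, z)) has_derivative (\<lambda>j. (0, j))) (at (\<psi> q))"
    by (auto intro!: derivative_eq_intros)
  show "chart_deriv (U \<times> V) (map_prod \<phi> \<psi>) f (p, q) (i, 0) = chart_deriv U \<phi> (\<lambda>p. f (p, q)) p i"
    by (rule chart_deriv_pullback[OF B.smooth_mfd_axioms P.smooth_mfd_axioms f U(1)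
          prod_chart[OF U(1) V(1)] _ U(2) _ 1, symmetric]) (use V in auto)
  show "chart_deriv (U \<times> V) (map_prod \<phi> \<psi>) f (p, q) (0, j) = chart_deriv V \<psi> (\<lambda>q. f (p, q)) q j"
    by (rule chart_deriv_pullback[OF F.smooth_mfd_axioms P.smooth_mfd_axioms f V(1)
          prod_chart[OF U(1) V(1)] _ V(2) _ 2, symmetric]) (use U in auto)
qed

end

sublocale product_mfd \<subseteq> fst: smooth_map AP AB fst
  by unfold_locales (auto intro: smooth_fst continuous_intros)

sublocale product_mfd \<subseteq> snd: smooth_map AP AF snd
  by unfold_locales (auto intro: smooth_snd continuous_intros)

context product_mfd
begin

abbreviation dfst :: "('m \<times> 'n) tvec \<Rightarrow> 'm tvec" where "dfst \<equiv> differential AB fst"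
abbreviation dsnd :: "('m \<times> 'n) tvec \<Rightarrow> 'n tvec" where "dsnd \<equiv> differential AF snd"
abbreviation "LB \<equiv> lift_base AB AF"
abbreviation "LF \<equiv> lift_fibre AB AF"

section \<open>Differentials of the projections, and lifts as vector fields\<close>

lemma slice_map_fst: "smooth_map AB AP (\<lambda>p. (p, q))"
  by unfold_locales (auto intro: smooth_slice_fst continuous_intros)

lemma slice_map_snd: "smooth_map AF AP (\<lambda>q. (p, q))"
  by unfold_locales (auto intro: smooth_slice_snd continuous_intros)

lemma dfst_apply: "h \<in> B.SF \<Longrightarrow> dfst v h = v (\<lambda>x. h (fst x))"
  by (simp add: differential_def comp_def)

lemma dsnd_apply: "h \<in> F.SF \<Longrightarrow> dsnd v h = v (\<lambda>x. h (snd x))"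
  by (simp add: differential_def comp_def)

text \<open>Subtracting from \<open>f\<close> the pullbacks of its two slices through \<open>(p, q)\<close> leaves a function
  whose partial derivatives vanish there.\<close>

lemma tangent_prod:
  assumes v: "v \<in> tangent AP (p, q)" and f: "f \<in> P.SF"
  shows "v f = dfst v (\<lambda>p. f (p, q)) + dsnd v (\<lambda>q. f (p, q))"
proof -
  note s1 = smooth_slice_fst[OF f, of q] and s2 = smooth_slice_snd[OF f, of p]
  obtain U \<phi> where U: "(U, \<phi>) \<in> AB" "p \<in> U" using B.chart_cover by blast
  obtain V \<psi> where V: "(V, \<psi>) \<in> AF" "q \<in> V" using F.chart_cover by blast
  have UV: "(p, q) \<in> U \<times> V" using U V by simp
  define r where "r = (\<lambda>x. f x - (f (fst x, q) + f (p, snd x)))"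
  have r: "r \<in> P.SF"
    unfolding r_def by (intro P.smooth_diff P.smooth_add f smooth_fst[OF s1] smooth_snd[OF s2])
  obtain N x E where F: "P.frame_on N x E" "(p, q) \<in> N"
    and E: "\<And>y f k. y \<in> N \<Longrightarrow> f \<in> P.SF \<Longrightarrow> E k y f = chart_deriv (U \<times> V) (map_prod \<phi> \<psi>) f y k"
    using P.chart_frame[OF prod_chart[OF U(1) V(1)] UV] by metis
  have z: "chart_deriv W \<eta> (\<lambda>x. c) y i = 0" for W and \<eta> :: "'a \<Rightarrow> 'b::euclidean_space" and c y i
    using frechet_derivative_const[of c] by (simp add: chart_deriv_def comp_def)
  have "E k (p, q) r = 0" if k: "k \<in> Basis" for k
  proof -
    consider i where "k = (i, 0)" | i where "k = (0, i)"
      using k by (auto simp: Basis_prod_def)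
    then show ?thesis
      unfolding E[OF F(2) r]
    proof cases
      case 1
      show "chart_deriv (U \<times> V) (map_prod \<phi> \<psi>) r (p, q) k = 0"
        unfolding 1 chart_deriv_fst[OF U V r] by (simp add: r_def z)
    next
      case 2
      show "chart_deriv (U \<times> V) (map_prod \<phi> \<psi>) r (p, q) k = 0"
        unfolding 2 chart_deriv_snd[OF U V r] by (simp add: r_def z)
    qed
  qed
  then have "v r = 0"
    using fun_cong[OF P.frame_tvec[OF F v], of r] by simp
  then show ?thesis
    unfolding r_def P.tangent_diff[OF v f P.smooth_add[OF smooth_fst[OF s1] smooth_snd[OF s2]]]
      P.tangent_add[OF v smooth_fst[OF s1] smooth_snd[OF s2]] dfst_apply[OF s1] dsnd_apply[OF s2]
    by simp
qed

lemma tangent_prod_eqI: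
  assumes v: "v \<in> tangent AP (p, q)" and w: "w \<in> tangent AP (p, q)"
    and "dfst v = dfst w" and "dsnd v = dsnd w"
  shows "v = w"
proof
  fix f
  show "v f = w f"
    using assms(3,4) tangent_prod[OF v] tangent_prod[OF w] P.tangent_nonsmooth[OF v] P.tangent_nonsmooth[OF w]
    by (cases "f \<in> P.SF") simp_all
qed

lemma dfst_tangent: "v \<in> tangent AP x \<Longrightarrow> dfst v \<in> tangent AB (fst x)"
  by (rule fst.differential_tangent)

lemma dsnd_tangent: "v \<in> tangent AP x \<Longrightarrow> dsnd v \<in> tangent AF (snd x)"
  by (rule snd.differential_tangent)

lemma dfst_comb: "dfst (\<lambda>f. a * v f + c * w f) = (\<lambda>f. a * dfst v f + c * dfst w f)"
  by (simp add: differential_def fun_eq_iff)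

lemma dsnd_comb: "dsnd (\<lambda>f. a * v f + c * w f) = (\<lambda>f. a * dsnd v f + c * dsnd w f)"
  by (simp add: differential_def fun_eq_iff)

lemma lift_base_apply: "f \<in> P.SF \<Longrightarrow> LB X x f = X (fst x) (\<lambda>p. f (p, snd x))"
  by (simp add: lift_base_def differential_def comp_def case_prod_beta)

lemma lift_fibre_apply: "f \<in> P.SF \<Longrightarrow> LF X x f = X (snd x) (\<lambda>q. f (fst x, q))"
  by (simp add: lift_fibre_def differential_def comp_def case_prod_beta)

lemma lift_base_vfield:
  assumes X: "X \<in> B.VF"
  shows "LB X \<in> P.VF"
  unfolding vector_fields_def
proof (intro CollectI conjI allI ballI)
  show "LB X x \<in> tangent AP x" for x
    using smooth_map.differential_tangent[OF slice_map_fst B.vfield_tangent[OF X], of "snd x" "fst x"]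
    by (simp add: lift_base_def case_prod_beta)
  fix f assume f: "f \<in> P.SF"
  have "(\<lambda>x. X (fst x) (\<lambda>p. f (p, snd x))) \<in> P.SF"
  proof (rule fst.smooth_along_slices[OF X f smooth_slice_fst[OF f]])
    fix x :: "'m \<times> 'n"
    obtain U \<phi> where U: "(U, \<phi>) \<in> AB" "fst x \<in> U" using B.chart_cover by blast
    obtain V \<psi> where V: "(V, \<psi>) \<in> AF" "snd x \<in> V" using F.chart_cover by blast
    show "\<exists>U \<phi> W \<eta>. (U, \<phi>) \<in> AB \<and> (W, \<eta>) \<in> AP \<and> x \<in> W \<and> fst ` W \<subseteq> U \<and> (\<forall>y\<in>W. \<forall>i.
        chart_deriv W \<eta> f y (i, 0) = chart_deriv U \<phi> (\<lambda>p. f (p, snd y)) (fst y) i)"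
      using U V chart_deriv_fst[OF U(1) _ V(1) _ f]
      by (intro exI[of _ U] exI[of _ \<phi>] exI[of _ "U \<times> V"] exI[of _ "map_prod \<phi> \<psi>"])
        (auto simp: prod_chart mem_Times_iff)
  qed
  then show "der (LB X) f \<in> P.SF"
    by (simp add: der_def lift_base_apply[OF f])
qed

lemma lift_fibre_vfield:
  assumes X: "X \<in> F.VF"
  shows "LF X \<in> P.VF"
  unfolding vector_fields_def
proof (intro CollectI conjI allI ballI)
  show "LF X x \<in> tangent AP x" for x
    using smooth_map.differential_tangent[OF slice_map_snd F.vfield_tangent[OF X], of "fst x" "snd x"]
    by (simp add: lift_fibre_def case_prod_beta)
  fix f assume f: "f \<in> P.SF"
  have "(\<lambda>x. X (snd x) (\<lambda>q. f (fst x, q))) \<in> P.SF"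
  proof (rule snd.smooth_along_slices[OF X f smooth_slice_snd[OF f]])
    fix x :: "'m \<times> 'n"
    obtain U \<phi> where U: "(U, \<phi>) \<in> AB" "fst x \<in> U" using B.chart_cover by blast
    obtain V \<psi> where V: "(V, \<psi>) \<in> AF" "snd x \<in> V" using F.chart_cover by blast
    show "\<exists>V \<psi> W \<eta>. (V, \<psi>) \<in> AF \<and> (W, \<eta>) \<in> AP \<and> x \<in> W \<and> snd ` W \<subseteq> V \<and> (\<forall>y\<in>W. \<forall>i.
        chart_deriv W \<eta> f y (0, i) = chart_deriv V \<psi> (\<lambda>q. f (fst y, q)) (snd y) i)"
      using U V chart_deriv_snd[OF U(1) _ V(1) _ f]
      by (intro exI[of _ V] exI[of _ \<psi>] exI[of _ "U \<times> V"] exI[of _ "map_prod \<phi> \<psi>"])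
        (auto simp: prod_chart mem_Times_iff)
  qed
  then show "der (LF X) f \<in> P.SF"
    by (simp add: der_def lift_fibre_apply[OF f])
qed

end

section \<open>Contraction\<close>

lemma vector_space_pointwise: "vector_space (\<lambda>(c::real) (\<alpha>::'a \<Rightarrow> real) v. c * \<alpha> v)"
  by unfold_locales (auto simp: fun_eq_iff algebra_simps)

context smooth_mfd
begin

text \<open>Serves to count dimensions. Linearity is spelled out by pointwise combinations because
  derivations are bare functions.\<close>

lemma tangent_iso:
  obtains T :: "'e \<Rightarrow> 'm tvec"
  where "\<And>c d s t. T (s *\<^sub>R c + t *\<^sub>R d) = (\<lambda>f. s * T c f + t * T d f)" "inj T" "range T = tangent A p"
proof -
  obtain N x E where F: "frame_on N x E" "p \<in> N" using frame_exists by blast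
  define T where "T c = (\<lambda>f. \<Sum>i\<in>Basis. (c \<bullet> i) * E i p f)" for c
  have "T (s *\<^sub>R c + t *\<^sub>R d) = (\<lambda>f. s * T c f + t * T d f)" for c d s t
    by (simp add: T_def inner_add_left sum_distrib_left sum.distrib algebra_simps)
  moreover have "inj T"
  proof (rule injI)
    fix c d assume eq: "T c = T d"
    have "T c (x j) = c \<bullet> j" if "j \<in> Basis" for c j
      using that by (simp add: T_def frame_onD(4)[OF F] inner_Basis if_distrib cong: if_cong)
    then have "c \<bullet> j = d \<bullet> j" if "j \<in> Basis" for j using eq that by metis
    then show "c = d" by (rule euclidean_eqI)
  qed
  moreover have "range T = tangent A p"
  proof (intro equalityI subsetI)
    fix v assume "v \<in> range T"
    then show "v \<in> tangent A p"
      unfolding T_def using tangent_lincomb[of Basis "\<lambda>i. E i p"] vfield_tangent[OF frame_onD(3)[OF F(1)]]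
      by auto
  next
    fix v assume v: "v \<in> tangent A p"
    have "T (\<Sum>i\<in>Basis. v (x i) *\<^sub>R i) = (\<lambda>f. \<Sum>i\<in>Basis. v (x i) * E i p f)"
      by (simp add: T_def)
    also have "\<dots> = v" by (rule frame_tvec[OF F v, symmetric])
    finally show "v \<in> range T" by (metis rangeI)
  qed
  ultimately show ?thesis using that by blast
qed

text \<open>An injective linear map preserves dimension; its target is the vector space of real
  functions with the pointwise operations used by \<open>metric_rank\<close>.\<close>

lemma metric_rank_eqI:
  fixes L :: "'v::euclidean_space \<Rightarrow> 'm covec"
  assumes lin: "\<And>c d s t. L (s *\<^sub>R c + t *\<^sub>R d) = (\<lambda>w. s * L c w + t * L d w)"
    and "inj L" and "range L = bullet_space A g p"
  shows "metric_rank A g p = DIM('v)"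
proof -
  interpret V: vector_space "\<lambda>(c::real) (\<alpha>::'m covec) v. c * \<alpha> v"
    by (rule vector_space_pointwise)
  interpret finite_dimensional_vector_space_pair_1 scaleR "Basis :: 'v set"
    "\<lambda>(c::real) (\<alpha>::'m covec) v. c * \<alpha> v" ..
  have "Vector_Spaces.linear scaleR (\<lambda>(c::real) (\<alpha>::'m covec) v. c * \<alpha> v) L"
  proof unfold_locales
    show "L (c + d) = L c + L d" for c d using lin[of 1 c 1 d] by (simp add: fun_eq_iff)
    show "L (s *\<^sub>R c) = (\<lambda>v. s * L c v)" for s c using lin[of s c 0 c] by simp
  qed
  from dim_image_eq[OF this inj_on_subset[OF assms(2) subset_UNIV], of UNIV] show ?thesis
    using assms(3) by (simp add: metric_rank_def dim_raw_def[symmetric])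
qed

end

context ssr_mfd
begin

lemma g_left_zero: "w \<in> tangent A p \<Longrightarrow> g p (\<lambda>f. 0) w = 0"
  using g_left[OF tangent_zero tangent_zero, of w p 0 0] by simp

lemma g_right_zero: "w \<in> tangent A p \<Longrightarrow> g p w (\<lambda>f. 0) = 0"
  using g_right[OF tangent_zero tangent_zero, of w p 0 0] by simp

text \<open>Stated for a single point, so that it applies to a twisted product at the points with
  \<open>b \<noteq> 0\<close>: non-degeneracy there makes \<open>flat\<close> injective on the
  tangent space.\<close>

lemma metric_rank_nondegenerate:
  assumes nd: "\<And>v. v \<in> tangent A p \<Longrightarrow> \<forall>w\<in>tangent A p. g p v w = 0 \<Longrightarrow> v = (\<lambda>f. 0)"
  shows "metric_rank A g p = DIM('e)"
proof -
  obtain T :: "'e \<Rightarrow> 'm tvec" where T: "\<And>c d s t. T (s *\<^sub>R c + t *\<^sub>R d) = (\<lambda>f. s * T c f + t * T d f)"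
    "inj T" "range T = tangent A p" using tangent_iso by metis
  have Tt: "T c \<in> tangent A p" for c using T(3) by blast
  have T0: "T 0 = (\<lambda>f. 0)" using T(1)[of 0 0 0 0] by simp
  let ?L = "\<lambda>c. flat A g p (T c)"
  show ?thesis
  proof (rule metric_rank_eqI)
    show lin: "?L (s *\<^sub>R c + t *\<^sub>R d) = (\<lambda>w. s * ?L c w + t * ?L d w)" for s c t d
      by (auto simp: fun_eq_iff flat_def T(1) g_left Tt)
    show "inj ?L"
    proof (rule injI)
      fix c d assume eq: "?L c = ?L d"
      have "g p (T (1 *\<^sub>R c + (-1) *\<^sub>R d)) w = 0" if "w \<in> tangent A p" for w
        using fun_cong[OF lin[of 1 c "-1" d], of w] fun_cong[OF eq, of w] that by (simp add: flat_def)
      then have "T (1 *\<^sub>R c + (-1) *\<^sub>R d) = T 0" using nd Tt T0 by metis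
      then show "c = d" using injD[OF T(2)] by force
    qed
    show "range ?L = bullet_space A g p"
      unfolding bullet_space_def T(3)[symmetric] by auto
  qed
qed

text \<open>Well-definedness of the inner product of flats: replace one argument at a time, the
  second by symmetry.\<close>

lemma bullet_inner_flat:
  assumes v: "v \<in> tangent A p" and w: "w \<in> tangent A p"
  shows "bullet_inner A g p (flat A g p v) (flat A g p w) = g p v w"
  unfolding bullet_inner_def
proof (rule the_equality)
  fix c
  assume "\<exists>v'\<in>tangent A p. \<exists>w'\<in>tangent A p.
    flat A g p v = flat A g p v' \<and> flat A g p w = flat A g p w' \<and> c = g p v' w'"
  then obtain v' w' where *: "v' \<in> tangent A p" "w' \<in> tangent A p"
    "flat A g p v = flat A g p v'" "flat A g p w = flat A g p w'" "c = g p v' w'" by blast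
  have "g p v w' = g p v' w'" using fun_cong[OF *(3), of w'] *(2) by (simp add: flat_def)
  moreover have "g p w v = g p w' v" using fun_cong[OF *(4), of v] v by (simp add: flat_def)
  ultimately show "c = g p v w" using * v w g_sym by metis
qed (use v w in blast)

text \<open>Smooth functions that agree on a dense set are equal by continuity, so the definite
  description in \<open>contraction\<close> has at most one solution.\<close>

lemma contraction_eqI:
  assumes h: "h \<in> SF"
    and bullet: "\<And>p. bullet_inner A g p (value_at A \<omega> p) (value_at A \<tau> p) = h p"
    and dense: "closure (regular_points A g) = UNIV"
  shows "contraction A g \<omega> \<tau> = h"
  unfolding contraction_def
proof (rule the_equality)
  fix h'
  assume h': "h' \<in> SF \<and> (\<forall>p\<in>regular_points A g.
    h' p = bullet_inner A g p (value_at A \<omega> p) (value_at A \<tau> p))"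
  have "continuous_on UNIV (\<lambda>p. h' p - h p)"
    using h h' smooth_continuous by (intro continuous_at_imp_continuous_on ballI continuous_diff) auto
  then have "h' p - h p = 0" for p
    by (rule continuous_constant_on_closure[of "regular_points A g", unfolded dense])
      (use h' bullet in auto)
  then show "h' = h" by (simp add: fun_eq_iff)
qed (use h bullet in auto)

lemma value_at_koszul:
  assumes "non_degenerate A g" "X \<in> VF" "Y \<in> VF"
  shows "value_at A (koszul g X Y) p = flat A g p (nabla X Y p)"
proof (rule value_at_eq_flat)
  show "nabla X Y p \<in> tangent A p" using vfield_nabla[OF assms] vfield_tangent by blast
  show "koszul g X Y Z p = g p (nabla X Y p) (Z p)" if "Z \<in> VF" for Z
    unfolding ip_nabla[OF assms that, symmetric] by (simp add: ip_def)
qed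

lemma contraction_koszul:
  assumes nd: "non_degenerate A g"
    and "X \<in> VF" "Y \<in> VF" "Z \<in> VF" "T \<in> VF"
  shows "contraction A g (koszul g X Y) (koszul g Z T) = ip g (nabla X Y) (nabla Z T)"
proof (rule contraction_eqI)
  note n = vfield_nabla[OF nd assms(2,3)] vfield_nabla[OF nd assms(4,5)]
  show "ip g (nabla X Y) (nabla Z T) \<in> SF" by (rule ip_smooth[OF n])
  show "bullet_inner A g p (value_at A (koszul g X Y) p) (value_at A (koszul g Z T) p)
      = ip g (nabla X Y) (nabla Z T) p" for p
    using n vfield_tangent
    by (simp add: value_at_koszul[OF nd] assms(2-) bullet_inner_flat ip_def)
  have "metric_rank A g p = DIM('e)" for p
    using nd by (intro metric_rank_nondegenerate) (auto simp: non_degenerate_def)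
  then have "regular_points A g = UNIV" unfolding regular_points_def by auto
  then show "closure (regular_points A g) = UNIV" by simp
qed

end

context product_mfd
begin

section \<open>Lifts of vector fields\<close>

lemma dfst_lift_base: "X \<in> B.VF \<Longrightarrow> dfst (LB X x) = X (fst x)"
  using B.tangent_nonsmooth[OF B.vfield_tangent]
  by (cases x) (auto simp: fun_eq_iff differential_def lift_base_apply smooth_fst comp_def)

lemma dsnd_lift_base: "X \<in> B.VF \<Longrightarrow> dsnd (LB X x) = (\<lambda>f. 0)"
  using B.tangent_const[OF B.vfield_tangent]
  by (cases x) (auto simp: fun_eq_iff differential_def lift_base_apply smooth_snd comp_def)

lemma dfst_lift_fibre: "U \<in> F.VF \<Longrightarrow> dfst (LF U x) = (\<lambda>f. 0)"
  using F.tangent_const[OF F.vfield_tangent]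
  by (cases x) (auto simp: fun_eq_iff differential_def lift_fibre_apply smooth_fst comp_def)

lemma dsnd_lift_fibre: "U \<in> F.VF \<Longrightarrow> dsnd (LF U x) = U (snd x)"
  using F.tangent_nonsmooth[OF F.vfield_tangent]
  by (cases x) (auto simp: fun_eq_iff differential_def lift_fibre_apply smooth_snd comp_def)

lemma der_lift_base_fst: "h \<in> B.SF \<Longrightarrow> der (LB X) (\<lambda>x. h (fst x)) = (\<lambda>x. der X h (fst x))"
  by (auto simp: der_def lift_base_apply smooth_fst)

lemma der_lift_base_snd:
  "X \<in> B.VF \<Longrightarrow> h \<in> F.SF \<Longrightarrow> der (LB X) (\<lambda>x. h (snd x)) = (\<lambda>x. 0)"
  by (auto simp: der_def lift_base_apply smooth_snd B.tangent_const[OF B.vfield_tangent])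

lemma der_lift_fibre_fst:
  "U \<in> F.VF \<Longrightarrow> h \<in> B.SF \<Longrightarrow> der (LF U) (\<lambda>x. h (fst x)) = (\<lambda>x. 0)"
  by (auto simp: der_def lift_fibre_apply smooth_fst F.tangent_const[OF F.vfield_tangent])

lemma der_lift_fibre_snd: "h \<in> F.SF \<Longrightarrow> der (LF U) (\<lambda>x. h (snd x)) = (\<lambda>x. der U h (snd x))"
  by (auto simp: der_def lift_fibre_apply smooth_snd)

text \<open>Pullbacks from the factors determine both projected differentials, hence the tangent
  vector; bracket computations can thus be confined to pullbacks.\<close>

lemma vfield_prod_eqI:
  assumes "X \<in> P.VF" and "Y \<in> P.VF"
    and "\<And>x h. h \<in> B.SF \<Longrightarrow> X x (\<lambda>x. h (fst x)) = Y x (\<lambda>x. h (fst x))"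
    and "\<And>x h. h \<in> F.SF \<Longrightarrow> X x (\<lambda>x. h (snd x)) = Y x (\<lambda>x. h (snd x))"
  shows "X = Y"
proof
  fix x
  have "dfst (X x) = dfst (Y x)" "dsnd (X x) = dsnd (Y x)"
    using assms(3,4) by (auto simp: differential_def comp_def fun_eq_iff)
  then show "X x = Y x"
    using tangent_prod_eqI P.vfield_tangent assms(1,2) by (metis prod.collapse)
qed

lemma bracket_lift_base:
  assumes X: "X \<in> B.VF" and Y: "Y \<in> B.VF"
  shows "lie_bracket (LB X) (LB Y) = LB (lie_bracket X Y)"
proof (rule vfield_prod_eqI)
  note b = B.vfield_bracket[OF X Y]
  show "lie_bracket (LB X) (LB Y) \<in> P.VF" "LB (lie_bracket X Y) \<in> P.VF"
    using X Y b by (intro P.vfield_bracket lift_base_vfield; simp)+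
  show "lie_bracket (LB X) (LB Y) x (\<lambda>x. h (fst x)) = LB (lie_bracket X Y) x (\<lambda>x. h (fst x))"
    if h: "h \<in> B.SF" for x h
    by (cases x) (simp add: lie_bracket_def der_lift_base_fst h lift_base_apply smooth_fst B.vfield_smooth X Y)
  show "lie_bracket (LB X) (LB Y) x (\<lambda>x. h (snd x)) = LB (lie_bracket X Y) x (\<lambda>x. h (snd x))"
    if h: "h \<in> F.SF" for x h
    using X Y h b P.tangent_const[OF P.vfield_tangent[OF lift_base_vfield]] B.tangent_const[OF B.vfield_tangent[OF b]]
    by (cases x) (simp add: lie_bracket_def[of "LB X"] der_lift_base_snd lift_base_apply[OF smooth_snd])
qed

lemma bracket_lift_fibre:
  assumes X: "X \<in> F.VF" and Y: "Y \<in> F.VF"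
  shows "lie_bracket (LF X) (LF Y) = LF (lie_bracket X Y)"
proof (rule vfield_prod_eqI)
  note b = F.vfield_bracket[OF X Y]
  show "lie_bracket (LF X) (LF Y) \<in> P.VF" "LF (lie_bracket X Y) \<in> P.VF"
    using X Y b by (intro P.vfield_bracket lift_fibre_vfield; simp)+
  show "lie_bracket (LF X) (LF Y) x (\<lambda>x. h (snd x)) = LF (lie_bracket X Y) x (\<lambda>x. h (snd x))"
    if h: "h \<in> F.SF" for x h
    by (cases x) (simp add: lie_bracket_def der_lift_fibre_snd h lift_fibre_apply smooth_snd F.vfield_smooth X Y)
  show "lie_bracket (LF X) (LF Y) x (\<lambda>x. h (fst x)) = LF (lie_bracket X Y) x (\<lambda>x. h (fst x))"
    if h: "h \<in> B.SF" for x h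
    using X Y h b P.tangent_const[OF P.vfield_tangent[OF lift_fibre_vfield]] F.tangent_const[OF F.vfield_tangent[OF b]]
    by (cases x) (simp add: lie_bracket_def[of "LF X"] der_lift_fibre_fst lift_fibre_apply[OF smooth_fst])
qed

text \<open>On pullbacks both iterated derivatives vanish, since each lift annihilates functions of
  the other factor.\<close>

lemma bracket_lift_mixed:
  assumes X: "X \<in> B.VF" and U: "U \<in> F.VF"
  shows "lie_bracket (LB X) (LF U) = (\<lambda>x f. 0)" and "lie_bracket (LF U) (LB X) = (\<lambda>x f. 0)"
proof -
  note t = P.tangent_const[OF P.vfield_tangent[OF lift_base_vfield[OF X]]]
    P.tangent_const[OF P.vfield_tangent[OF lift_fibre_vfield[OF U]]]
  show *: "lie_bracket (LB X) (LF U) = (\<lambda>x f. 0)"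
  proof (rule vfield_prod_eqI[OF P.vfield_bracket[OF lift_base_vfield[OF X] lift_fibre_vfield[OF U]] P.vfield_zero])
    show "lie_bracket (LB X) (LF U) x (\<lambda>x. h (fst x)) = 0" if h: "h \<in> B.SF" for x h
      using X U h t fun_cong[OF der_lift_fibre_fst[OF U B.vfield_smooth[OF X h]], of x]
      by (simp add: lie_bracket_def der_lift_base_fst der_lift_fibre_fst) (simp add: der_def)
    show "lie_bracket (LB X) (LF U) x (\<lambda>x. h (snd x)) = 0" if h: "h \<in> F.SF" for x h
      using X U h t fun_cong[OF der_lift_base_snd[OF X F.vfield_smooth[OF U h]], of x]
      by (simp add: lie_bracket_def der_lift_base_snd der_lift_fibre_snd) (simp add: der_def)
  qed
  show "lie_bracket (LF U) (LB X) = (\<lambda>x f. 0)"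
  proof (intro ext)
    fix x f
    show "lie_bracket (LF U) (LB X) x f = 0"
      using fun_cong[OF fun_cong[OF *, of x], of f] by (simp add: lie_bracket_def)
  qed
qed

text \<open>Extend both vectors to fields on the factors and add the lifts.\<close>

lemma tangent_join:
  assumes u: "u \<in> tangent AB (fst x)" and w: "w \<in> tangent AF (snd x)"
  obtains v where "v \<in> tangent AP x" "dfst v = u" "dsnd v = w"
proof -
  obtain X where X: "X \<in> B.VF" "X (fst x) = u" using B.vfield_extend[OF u] by blast
  obtain W where W: "W \<in> F.VF" "W (snd x) = w" using F.vfield_extend[OF w] by blast
  show ?thesis
  proof (rule that)
    show "(\<lambda>f. 1 * LB X x f + 1 * LF W x f) \<in> tangent AP x"
      using X W by (intro P.tangent_comb P.vfield_tangent lift_base_vfield lift_fibre_vfield)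
    show "dfst (\<lambda>f. 1 * LB X x f + 1 * LF W x f) = u" "dsnd (\<lambda>f. 1 * LB X x f + 1 * LF W x f) = w"
      unfolding dfst_comb dsnd_comb using X W
      by (simp_all add: dfst_lift_base dfst_lift_fibre dsnd_lift_base dsnd_lift_fibre)
  qed
qed

text \<open>At \<open>x\<close> an arbitrary field agrees with the sum of a base lift and a fibre
  lift, and a tensorial form sees only the value at \<open>x\<close>. Knowing a form on lifts is
  therefore enough.\<close>

lemma tensorial_prod:
  assumes \<omega>: "P.tensorial \<omega>" and Z: "Z \<in> P.VF"
    and X: "X \<in> B.VF" "X (fst x) = dfst (Z x)"
    and W: "W \<in> F.VF" "W (snd x) = dsnd (Z x)"
  shows "\<omega> Z x = \<omega> (LB X) x + \<omega> (LF W) x"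
proof -
  note l = lift_base_vfield[OF X(1)] lift_fibre_vfield[OF W(1)]
  let ?Y = "vcomb (\<lambda>x. 1) (LB X) (\<lambda>x. 1) (LF W)"
  have Y: "?Y \<in> P.VF" using l by (intro P.vfield_vcomb P.smooth_const)
  have "Z x = ?Y x"
  proof (rule tangent_prod_eqI[of _ "fst x" "snd x"])
    show "dfst (Z x) = dfst (?Y x)" "dsnd (Z x) = dsnd (?Y x)"
      unfolding vcomb_def dfst_comb dsnd_comb using X W
      by (simp_all add: dfst_lift_base dfst_lift_fibre dsnd_lift_base dsnd_lift_fibre)
  qed (use P.vfield_tangent[OF Z] P.vfield_tangent[OF Y] in simp_all)
  from P.tensorial_pointwise[OF \<omega> Z Y this] show ?thesis
    using P.tensorialD(2)[OF \<omega> P.smooth_const P.smooth_const l] by simp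
qed

lemma vfield_dfst_along: "Z \<in> P.VF \<Longrightarrow> (\<lambda>x. dfst (Z x)) \<in> fst.along"
  using dfst_tangent[OF P.vfield_tangent] P.vfield_smooth[OF _ smooth_fst]
  by (simp add: fst.along_def dfst_apply der_def del: split_paired_All)

lemma vfield_dsnd_along: "Z \<in> P.VF \<Longrightarrow> (\<lambda>x. dsnd (Z x)) \<in> snd.along"
  using dsnd_tangent[OF P.vfield_tangent] P.vfield_smooth[OF _ smooth_snd]
  by (simp add: snd.along_def dsnd_apply der_def del: split_paired_All)

end

section \<open>Twisted products\<close>

text \<open>A named constant, so that rules on metrics, tangency and smoothness of linear
  combinations apply by first-order rewriting instead of matching an abstraction.\<close>

definition tcomb :: "real \<Rightarrow> 'm tvec \<Rightarrow> real \<Rightarrow> 'm tvec \<Rightarrow> 'm tvec"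
  where "tcomb a u c v = (\<lambda>f. a * u f + c * v f)"

lemma (in smooth_mfd) tcomb_tangent:
  "u \<in> tangent A p \<Longrightarrow> v \<in> tangent A p \<Longrightarrow> tcomb a u c v \<in> tangent A p"
  unfolding tcomb_def by (rule tangent_comb)

lemma (in ssr_mfd)
  assumes "u \<in> tangent A p" "v \<in> tangent A p" "w \<in> tangent A p"
  shows g_tcomb_left: "g p (tcomb a u c v) w = a * g p u w + c * g p v w"
    and g_tcomb_right: "g p w (tcomb a u c v) = a * g p w u + c * g p w v"
  unfolding tcomb_def using assms by (simp_all add: g_left g_right)

lemma (in smooth_map) along_tcomb:
  "a \<in> smooth_funs A' \<Longrightarrow> c \<in> smooth_funs A' \<Longrightarrow> G \<in> along \<Longrightarrow> H \<in> along \<Longrightarrow>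
    (\<lambda>x. tcomb (a x) (G x) (c x) (H x)) \<in> along"
  unfolding tcomb_def by (rule along_comb)

context smooth_mfd
begin

lemma
  assumes "X \<in> VF" and "f \<in> SF" and "h \<in> SF"
  shows der_add: "der X (\<lambda>x. f x + h x) p = der X f p + der X h p"
    and der_diff: "der X (\<lambda>x. f x - h x) p = der X f p - der X h p"
    and der_mult: "der X (\<lambda>x. f x * h x) p = der X f p * h p + f p * der X h p"
  unfolding der_def
  by (rule tangent_add[OF vfield_tangent[OF assms(1)] assms(2,3)],
      rule tangent_diff[OF vfield_tangent[OF assms(1)] assms(2,3)],
      rule tangent_mult[OF vfield_tangent[OF assms(1)] assms(2,3)])

lemma der_minus: "X \<in> VF \<Longrightarrow> f \<in> SF \<Longrightarrow> der X (\<lambda>x. - f x) p = - der X f p"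
  by (simp add: der_def tangent_minus[OF vfield_tangent])

lemma der_const: "X \<in> VF \<Longrightarrow> der X (\<lambda>x. c) p = 0"
  by (simp add: der_def tangent_const[OF vfield_tangent])

lemma der_power:
  "X \<in> VF \<Longrightarrow> f \<in> SF \<Longrightarrow>
    der X (\<lambda>x. f x ^ n) p = real n * f p ^ (n - 1) * der X f p"
proof (induction n)
  case (Suc n)
  then show ?case
    using der_mult[OF Suc.prems smooth_power[OF Suc.prems(2)], of n p]
    by (cases n) (simp_all add: algebra_simps)
qed (simp add: der_const)

end

locale twisted_product = product_mfd AB AF + B: ssr_mfd AB gB + F: ssr_mfd AF gF
  for AB :: "('m::{t2_space, second_countable_topology}, 'e::euclidean_space) atlas"
  and AF :: "('n::{t2_space, second_countable_topology}, 'f::euclidean_space) atlas"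
  and gB :: "'m metric" and gF :: "'n metric" +
  fixes b :: "'m \<times> 'n \<Rightarrow> real"
  assumes ndB: "non_degenerate AB gB" and ndF: "non_degenerate AF gF"
    and b_smooth: "b \<in> smooth_funs (prod_atlas AB AF)"
    and b_zero: "b x = 0 \<Longrightarrow> v \<in> tangent (prod_atlas AB AF) x \<Longrightarrow> v b = 0"

sublocale twisted_product \<subseteq> fst: metric_along AP AB fst gB ..
sublocale twisted_product \<subseteq> snd: metric_along AP AF snd gF ..

context twisted_product
begin

abbreviation "gP \<equiv> twisted_metric AB AF gB gF b"

lemma metric_apply:
  "gP x v w = gB (fst x) (dfst v) (dfst w) + (b x)\<^sup>2 * gF (snd x) (dsnd v) (dsnd w)"
  by (simp add: twisted_metric_def case_prod_beta)

text \<open>Smoothness of the metric concerns all fields of the product, not just lifts; the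
  projections of a field are sections along the projections, whose products are smooth.\<close>

lemma twisted_ssr: "singular_semi_riemannian AP gP"
  unfolding singular_semi_riemannian_def
proof (intro conjI allI ballI prod_manifold)
  fix x v w assume v: "v \<in> tangent AP x" and w: "w \<in> tangent AP x"
  show "gP x v w = gP x w v"
    using B.g_sym[OF dfst_tangent[OF v] dfst_tangent[OF w]]
      F.g_sym[OF dsnd_tangent[OF v] dsnd_tangent[OF w]] by (simp add: metric_apply)
next
  fix x u v w and a c :: real
  assume "u \<in> tangent AP x" "v \<in> tangent AP x" "w \<in> tangent AP x"
  then show "gP x (\<lambda>f. a * u f + c * v f) w = a * gP x u w + c * gP x v w"
    unfolding metric_apply dfst_comb dsnd_comb
    by (simp add: B.g_left F.g_left dfst_tangent dsnd_tangent algebra_simps)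
next
  fix X Y assume X: "X \<in> P.VF" and Y: "Y \<in> P.VF"
  have "(\<lambda>x. gB (fst x) (dfst (X x)) (dfst (Y x)) + (b x)\<^sup>2 * gF (snd x) (dsnd (X x)) (dsnd (Y x)))
      \<in> P.SF"
    by (intro P.smooth_add P.smooth_mult P.smooth_power b_smooth fst.along_inner_smooth
        snd.along_inner_smooth vfield_dfst_along vfield_dsnd_along X Y)
  then show "ip gP X Y \<in> P.SF" by (simp add: ip_def metric_apply)
qed

end

sublocale twisted_product \<subseteq> P: ssr_mfd AP gP
  by unfold_locales (rule twisted_ssr)

context twisted_product
begin

section \<open>Metric and Koszul form on lifts\<close>

lemma
  assumes "X \<in> B.VF" "Y \<in> B.VF" "U \<in> F.VF" "V \<in> F.VF"
  shows ip_lift_BB: "ip gP (LB X) (LB Y) = (\<lambda>x. ip gB X Y (fst x))"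
    and ip_lift_BF: "ip gP (LB X) (LF U) = (\<lambda>x. 0)"
    and ip_lift_FB: "ip gP (LF U) (LB X) = (\<lambda>x. 0)"
    and ip_lift_FF: "ip gP (LF U) (LF V) = (\<lambda>x. (b x)\<^sup>2 * ip gF U V (snd x))"
  using assms B.vfield_tangent F.vfield_tangent
  by (simp_all add: ip_def metric_apply dfst_lift_base dfst_lift_fibre dsnd_lift_base dsnd_lift_fibre
      B.g_left_zero B.g_right_zero F.g_left_zero F.g_right_zero B.tangent_zero F.tangent_zero)

lemma ip_zero_right: "Z \<in> P.VF \<Longrightarrow> ip gP Z (\<lambda>x f. 0) = (\<lambda>x. 0)"
  by (simp add: ip_def P.g_right_zero P.vfield_tangent)

lemma der_lift_ip:
  assumes "X \<in> B.VF" "Y \<in> B.VF" "Z \<in> B.VF"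
    "U \<in> F.VF" "V \<in> F.VF" "W \<in> F.VF"
  shows "der (LB X) (\<lambda>x. ip gB Y Z (fst x)) x = der X (ip gB Y Z) (fst x)"
    "der (LF U) (\<lambda>x. ip gB Y Z (fst x)) x = 0"
    "der (LB X) (\<lambda>x. (b x)\<^sup>2 * ip gF V W (snd x)) x = 2 * b x * der (LB X) b x * ip gF V W (snd x)"
    "der (LF U) (\<lambda>x. (b x)\<^sup>2 * ip gF V W (snd x)) x =
      2 * b x * der (LF U) b x * ip gF V W (snd x) + (b x)\<^sup>2 * der U (ip gF V W) (snd x)"
  using assms
  by (simp_all add: der_lift_base_fst der_lift_base_snd der_lift_fibre_fst der_lift_fibre_snd
      B.ip_smooth F.ip_smooth P.der_mult P.der_power lift_base_vfield lift_fibre_vfield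
      P.smooth_power smooth_snd b_smooth)

lemmas lift_simps = ip_lift_BB ip_lift_BF ip_lift_FB ip_lift_FF ip_zero_right der_lift_ip
  bracket_lift_base bracket_lift_fibre bracket_lift_mixed lift_base_vfield lift_fibre_vfield
  B.vfield_bracket F.vfield_bracket P.der_const

text \<open>Mixed brackets and mixed products vanish. Among the remaining terms, those without a
  derivative of \<open>b\<close> reassemble to the Koszul form of a factor; the others come from
  differentiating \<open>b^2\<close>, whose factor 2 cancels the \<open>1/2\<close>.\<close>

lemma koszul_lift:
  assumes "X \<in> B.VF" "Y \<in> B.VF" "Z \<in> B.VF"
    "U \<in> F.VF" "V \<in> F.VF" "W \<in> F.VF"
  shows "koszul gP (LB X) (LB Y) (LB Z) x = koszul gB X Y Z (fst x)"
    "koszul gP (LB X) (LB Y) (LF W) x = 0"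
    "koszul gP (LB X) (LF V) (LB Z) x = 0"
    "koszul gP (LB X) (LF V) (LF W) x = b x * der (LB X) b x * ip gF V W (snd x)"
    "koszul gP (LF V) (LB X) (LB Z) x = 0"
    "koszul gP (LF V) (LB X) (LF W) x = b x * der (LB X) b x * ip gF V W (snd x)"
    "koszul gP (LF V) (LF W) (LB X) x = - (b x * der (LB X) b x * ip gF V W (snd x))"
    "koszul gP (LF U) (LF V) (LF W) x = (b x)\<^sup>2 * koszul gF U V W (snd x)
      + b x * (der (LF U) b x * ip gF V W (snd x) + der (LF V) b x * ip gF U W (snd x)
        - der (LF W) b x * ip gF U V (snd x))"
  using assms F.ip_sym[OF assms(5,6)] F.ip_sym[OF assms(4,6)]
  by (simp_all add: koszul_def lift_simps) (simp_all add: field_simps)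

subsection \<open>The semi-symmetric non-metric Koszul form\<close>

lemma ssnm_tensorial:
  assumes "P \<in> P.VF" "X \<in> P.VF" "Y \<in> P.VF"
  shows "P.tensorial (ssnm_koszul gP P X Y)"
  unfolding P.tensorial_def
proof (intro conjI ballI allI)
  note K = P.koszul_tensorial[OF assms(2,3)]
  show "ssnm_koszul gP P X Y Z \<in> P.SF" if "Z \<in> P.VF" for Z
    unfolding ssnm_koszul_def
    by (intro P.smooth_add P.smooth_mult P.ip_smooth P.koszul_smooth assms that)
  fix f h Z W x
  assume "f \<in> P.SF" "h \<in> P.SF" "Z \<in> P.VF" "W \<in> P.VF"
  then show "ssnm_koszul gP P X Y (vcomb f Z h W) x = f x * ssnm_koszul gP P X Y Z x + h x * ssnm_koszul gP P X Y W x"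
    using P.tensorialD(2)[OF K] assms by (simp add: ssnm_koszul_def P.ip_vcomb_right algebra_simps)
qed

text \<open>The added term \<open>g(Y, P) g(X, Z)\<close> can survive only for a middle argument in
  the fibre. It is of order \<open>b^2\<close> if the outer arguments are base fields and of order
  \<open>b^4\<close> if they are fibre fields, each fibre product carrying a factor
  \<open>b^2\<close>.\<close>

lemma ssnm_lift:
  assumes "X \<in> B.VF" "Y \<in> B.VF" "Z \<in> B.VF"
    "U \<in> F.VF" "V \<in> F.VF" "W \<in> F.VF" "P \<in> F.VF"
  shows "ssnm_koszul gP (LF P) (LB X) (LB Y) (LB Z) = (\<lambda>x. koszul gB X Y Z (fst x))"
    "ssnm_koszul gP (LF P) (LB X) (LB Y) (LF W) = (\<lambda>x. 0)"
    "ssnm_koszul gP (LF P) (LB X) (LF V) (LB Z) = (\<lambda>x. (b x)\<^sup>2 * ip gF V P (snd x) * ip gB X Z (fst x))"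
    "ssnm_koszul gP (LF P) (LB X) (LF V) (LF W) = (\<lambda>x. b x * der (LB X) b x * ip gF V W (snd x))"
    "ssnm_koszul gP (LF P) (LF V) (LB X) (LB Z) = (\<lambda>x. 0)"
    "ssnm_koszul gP (LF P) (LF V) (LB X) (LF W) = (\<lambda>x. b x * der (LB X) b x * ip gF V W (snd x))"
    "ssnm_koszul gP (LF P) (LF V) (LF W) (LB X) = (\<lambda>x. - (b x * der (LB X) b x * ip gF V W (snd x)))"
    "ssnm_koszul gP (LF P) (LF U) (LF V) (LF W) = (\<lambda>x. (b x)\<^sup>2 * koszul gF U V W (snd x)
      + b x * (der (LF U) b x * ip gF V W (snd x) + der (LF V) b x * ip gF U W (snd x)
        - der (LF W) b x * ip gF U V (snd x))
      + b x ^ 4 * (ip gF V P (snd x) * ip gF U W (snd x)))"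
  using assms by (simp_all add: ssnm_koszul_def koszul_lift lift_simps fun_eq_iff algebra_simps)


subsection \<open>Vectors representing the Koszul form\<close>

text \<open>Where \<open>b \<noteq> 0\<close>, a form represented by \<open>(a, c, d)\<close> is the flat of \<open>a + c + d / b\<close>; where
  \<open>b = 0\<close>, it is the flat of \<open>a\<close>.\<close>

definition represents ::
  "('m \<times> 'n) oneform \<Rightarrow> ('m \<times> 'n \<Rightarrow> 'm tvec) \<Rightarrow> ('m \<times> 'n \<Rightarrow> 'n tvec) \<Rightarrow> ('m \<times> 'n \<Rightarrow> 'n tvec) \<Rightarrow> bool"
where
  "represents \<omega> a c d \<longleftrightarrow> P.tensorial \<omega> \<and> a \<in> fst.along \<and> c \<in> snd.along \<and> d \<in> snd.along \<and>
     (\<forall>x. b x = 0 \<longrightarrow> d x = (\<lambda>f. 0)) \<and>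
     (\<forall>Z\<in>B.VF. \<forall>x. \<omega> (LB Z) x = gB (fst x) (a x) (Z (fst x))) \<and>
     (\<forall>W\<in>F.VF. \<forall>x. \<omega> (LF W) x =
        (b x)\<^sup>2 * gF (snd x) (c x) (W (snd x)) + b x * gF (snd x) (d x) (W (snd x)))"

text \<open>Where \<open>b = 0\<close>, HOL evaluates \<open>1 / b\<close> to 0, so the formula for
  \<open>v\<close> still makes sense; the metric gives its fibre component weight 0 there.\<close>

lemma represents_flat:
  assumes "represents \<omega> a c d"
  obtains v where "v \<in> tangent AP x" "dfst v = a x" "dsnd v = tcomb 1 (c x) (1 / b x) (d x)"
    "value_at AP \<omega> x = flat AP gP x v"
proof -
  note r = assms[unfolded represents_def]
  have rB: "\<omega> (LB Z) x = gB (fst x) (a x) (Z (fst x))" if "Z \<in> B.VF" for Z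
    using r that by blast
  have rF: "\<omega> (LF W) x = (b x)\<^sup>2 * gF (snd x) (c x) (W (snd x)) + b x * gF (snd x) (d x) (W (snd x))"
    if "W \<in> F.VF" for W
    using r that by blast
  have t: "a x \<in> tangent AB (fst x)" "c x \<in> tangent AF (snd x)" "d x \<in> tangent AF (snd x)"
    using r fst.along_tangent snd.along_tangent by blast+
  obtain v where v: "v \<in> tangent AP x" "dfst v = a x" "dsnd v = tcomb 1 (c x) (1 / b x) (d x)"
    using tangent_join[OF t(1) F.tcomb_tangent[OF t(2,3)]] by metis
  have "\<omega> Z x = gP x v (Z x)" if Z: "Z \<in> P.VF" for Z
  proof -
    note Zt = dfst_tangent[OF P.vfield_tangent[OF Z]] dsnd_tangent[OF P.vfield_tangent[OF Z]]
    obtain X where X: "X \<in> B.VF" "X (fst x) = dfst (Z x)"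
      using B.vfield_extend[OF Zt(1)] by blast
    obtain W where W: "W \<in> F.VF" "W (snd x) = dsnd (Z x)"
      using F.vfield_extend[OF Zt(2)] by blast
    have "\<omega> Z x = \<omega> (LB X) x + \<omega> (LF W) x"
      using r by (intro tensorial_prod Z X W) blast
    also have "\<dots> = gP x v (Z x)"
      unfolding metric_apply v(2,3) F.g_tcomb_left[OF t(2,3) Zt(2)] rB[OF X(1)] rF[OF W(1)] X(2) W(2)
      by (cases "b x = 0") (simp_all add: power2_eq_square algebra_simps)
    finally show ?thesis .
  qed
  then have "value_at AP \<omega> x = flat AP gP x v" by (rule P.value_at_eq_flat[OF v(1)])
  then show ?thesis using that v by blast
qed

text \<open>The rank takes only two values, \<open>DIM('e) + DIM('f)\<close> where
  \<open>b \<noteq> 0\<close> and \<open>DIM('e)\<close> where \<open>b = 0\<close>. So the open set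
  \<open>b \<noteq> 0\<close> and the interior of its complement consist of regular points, and
  their union is dense.\<close>

lemma regular_points_dense: "closure (regular_points AP gP) = UNIV"
proof -
  have rank1: "metric_rank AP gP x = DIM('e \<times> 'f)" if bx: "b x \<noteq> 0" for x
  proof (rule P.metric_rank_nondegenerate)
    fix v assume v: "v \<in> tangent AP x" and z: "\<forall>w\<in>tangent AP x. gP x v w = 0"
    \<comment> \<open>Testing against vectors tangent to one factor separates the two components of
      \<open>v\<close>.\<close>
    have "gB (fst x) (dfst v) u = 0" if u: "u \<in> tangent AB (fst x)" for u
    proof -
      obtain w where "w \<in> tangent AP x" "dfst w = u" "dsnd w = (\<lambda>f. 0)"
        using tangent_join[OF u F.tangent_zero] by metis
      then show ?thesis
        using z F.g_right_zero[OF dsnd_tangent[OF v]] by (force simp: metric_apply)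
    qed
    then have 1: "dfst v = (\<lambda>f. 0)"
      using ndB dfst_tangent[OF v] unfolding non_degenerate_def by blast
    have "gF (snd x) (dsnd v) u = 0" if u: "u \<in> tangent AF (snd x)" for u
    proof -
      obtain w where "w \<in> tangent AP x" "dfst w = (\<lambda>f. 0)" "dsnd w = u"
        using tangent_join[OF B.tangent_zero u] by metis
      then show ?thesis
        using z bx B.g_right_zero[OF dfst_tangent[OF v]] by (force simp: metric_apply)
    qed
    then have 2: "dsnd v = (\<lambda>f. 0)"
      using ndF dsnd_tangent[OF v] unfolding non_degenerate_def by blast
    show "v = (\<lambda>f. 0)"
      by (rule tangent_prod_eqI[of _ "fst x" "snd x"])
        (use v 1 2 P.tangent_zero in \<open>simp_all add: differential_def\<close>)
  qed
  have rank0: "metric_rank AP gP x = DIM('e)" if bx: "b x = 0" for x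
  proof -
    obtain T :: "'e \<Rightarrow> 'm tvec" where T: "\<And>c d s t. T (s *\<^sub>R c + t *\<^sub>R d) = (\<lambda>f. s * T c f + t * T d f)"
      "inj T" "range T = tangent AB (fst x)" using B.tangent_iso by metis
    have Tt: "T c \<in> tangent AB (fst x)" for c using T(3) by blast
    have flat_eq: "flat AP gP x v = (\<lambda>w. if w \<in> tangent AP x then gB (fst x) (dfst v) (dfst w) else 0)" for v
      by (simp add: flat_def metric_apply bx fun_eq_iff)
    \<comment> \<open>At a zero of \<open>b\<close> the flat of a vector depends only on its base
      component, so the bullet space is an isomorphic image of the tangent space of the
      base.\<close>
    define L where "L c = (\<lambda>w. if w \<in> tangent AP x then gB (fst x) (T c) (dfst w) else 0)" for c
    show ?thesis
    proof (rule P.metric_rank_eqI)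
      show "L (s *\<^sub>R c + t *\<^sub>R d) = (\<lambda>w. s * L c w + t * L d w)" for s c t d
        by (auto simp: fun_eq_iff L_def T(1) B.g_left Tt dfst_tangent)
      show "inj L"
      proof (rule injI)
        fix c d assume eq: "L c = L d"
        have "gB (fst x) (T c) u = gB (fst x) (T d) u" if u: "u \<in> tangent AB (fst x)" for u
        proof -
          obtain w where "w \<in> tangent AP x" "dfst w = u"
            using tangent_join[OF u F.tangent_zero] by metis
          then show ?thesis using fun_cong[OF eq, of w] by (simp add: L_def)
        qed
        from B.nondegenerate_unique[OF ndB Tt Tt this] show "c = d" using injD[OF T(2)] by blast
      qed
      show "range L = bullet_space AP gP x"
      proof (intro equalityI subsetI)
        fix \<alpha> assume "\<alpha> \<in> range L"
        then obtain c where c: "\<alpha> = L c" by blast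
        obtain v where v: "v \<in> tangent AP x" "dfst v = T c"
          using tangent_join[OF Tt F.tangent_zero] by metis
        have "L c = flat AP gP x v" unfolding flat_eq L_def v(2) ..
        then show "\<alpha> \<in> bullet_space AP gP x"
          unfolding c bullet_space_def using v(1) by (rule image_eqI)
      next
        fix \<alpha> assume "\<alpha> \<in> bullet_space AP gP x"
        then obtain v where v: "v \<in> tangent AP x" "\<alpha> = flat AP gP x v" unfolding bullet_space_def by blast
        obtain c where c: "dfst v = T c" using dfst_tangent[OF v(1)] T(3) by (metis rangeE)
        have "\<alpha> = L c" unfolding v(2) flat_eq L_def c ..
        then show "\<alpha> \<in> range L" by blast
      qed
    qed
  qed
  have ob: "open {x. b x \<noteq> 0}"
    using P.smooth_continuous[OF b_smooth]
    by (intro open_Collect_neq continuous_on_const continuous_at_imp_continuous_on ballI)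
  have 1: "{x. b x \<noteq> 0} \<subseteq> regular_points AP gP"
    unfolding regular_points_def using ob rank1 by auto
  have 2: "interior {x. b x = 0} \<subseteq> regular_points AP gP"
  proof
    fix x assume x: "x \<in> interior {x. b x = 0}"
    have "metric_rank AP gP y = metric_rank AP gP x" if "y \<in> interior {x. b x = 0}" for y
    proof -
      have "b x = 0" "b y = 0" using x that interior_subset by blast+
      then show ?thesis using rank0 by simp
    qed
    then show "x \<in> regular_points AP gP"
      unfolding regular_points_def using x by blast
  qed
  \<comment> \<open>The interior of a set is the complement of the closure of its
    complement.\<close>
  have "UNIV = closure {x. b x \<noteq> 0} \<union> interior {x. b x = 0}"
    unfolding closure_interior by (auto simp: Compl_eq)
  also have "\<dots> \<subseteq> closure (regular_points AP gP)"
    using closure_mono[OF 1] 2 closure_subset by blast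
  finally show ?thesis by blast
qed

text \<open>Expanding the metric on two vectors of the shape \<open>a + c + d / b\<close>, every
  \<open>1 / b\<close> cancels against the weight \<open>b^2\<close>. At zeros of \<open>b\<close>
  only the base product remains, and on the right-hand side the last term vanishes with
  \<open>d\<close>. The right-hand side is smooth across the zero set.\<close>

lemma contraction_represents:
  assumes 1: "represents \<omega> a c d" and 2: "represents \<tau> a' c' d'"
  shows "contraction AP gP \<omega> \<tau> x = gB (fst x) (a x) (a' x) + (b x)\<^sup>2 * gF (snd x) (c x) (c' x)
    + b x * (gF (snd x) (c x) (d' x) + gF (snd x) (d x) (c' x)) + gF (snd x) (d x) (d' x)"
proof -
  define h where "h x = gB (fst x) (a x) (a' x) + (b x)\<^sup>2 * gF (snd x) (c x) (c' x)
    + b x * (gF (snd x) (c x) (d' x) + gF (snd x) (d x) (c' x)) + gF (snd x) (d x) (d' x)" for x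
  have al: "a \<in> fst.along" "c \<in> snd.along" "d \<in> snd.along" "a' \<in> fst.along" "c' \<in> snd.along" "d' \<in> snd.along"
    using 1 2 unfolding represents_def by blast+
  have "contraction AP gP \<omega> \<tau> = h"
  proof (rule P.contraction_eqI[OF _ _ regular_points_dense])
    show "h \<in> P.SF"
      unfolding h_def
      by (intro P.smooth_add P.smooth_mult P.smooth_power b_smooth fst.along_inner_smooth
          snd.along_inner_smooth al)
    fix x
    obtain v where v: "v \<in> tangent AP x" "dfst v = a x" "dsnd v = tcomb 1 (c x) (1 / b x) (d x)"
      "value_at AP \<omega> x = flat AP gP x v" using represents_flat[OF 1] by metis
    obtain w where w: "w \<in> tangent AP x" "dfst w = a' x" "dsnd w = tcomb 1 (c' x) (1 / b x) (d' x)"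
      "value_at AP \<tau> x = flat AP gP x w" using represents_flat[OF 2] by metis
    have t: "c x \<in> tangent AF (snd x)" "d x \<in> tangent AF (snd x)"
        "c' x \<in> tangent AF (snd x)" "d' x \<in> tangent AF (snd x)"
      using al snd.along_tangent by blast+
    have "gP x v w = h x"
    proof (cases "b x = 0")
      case True
      then have "d x = (\<lambda>f. 0)" using 1 unfolding represents_def by blast
      then show ?thesis
        using True t by (simp add: metric_apply v(2) w(2) h_def F.g_left_zero)
    next
      case False
      then show ?thesis
        using t
        by (simp add: metric_apply v(2,3) w(2,3) h_def F.g_tcomb_left F.g_tcomb_right F.tcomb_tangent
            power2_eq_square field_simps)
    qed
    then show "bullet_inner AP gP x (value_at AP \<omega> x) (value_at AP \<tau> x) = h x"
      using P.bullet_inner_flat[OF v(1) w(1)] v(4) w(4) by simp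
  qed
  then show ?thesis by (simp add: h_def)
qed

text \<open>The gradient of the slice of \<open>b\<close> through the second point, taken as a
  function of the pair so that smoothness in both variables can be expressed.\<close>

definition gradB :: "'m \<times> 'n \<Rightarrow> 'm tvec" where
  "gradB = (SOME G. G \<in> fst.along \<and>
     (\<forall>x. \<forall>u\<in>tangent AB (fst x). gB (fst x) (G x) u = u (\<lambda>p. b (p, snd x))))"

definition gradF :: "'m \<times> 'n \<Rightarrow> 'n tvec" where
  "gradF = (SOME G. G \<in> snd.along \<and>
     (\<forall>x. \<forall>u\<in>tangent AF (snd x). gF (snd x) (G x) u = u (\<lambda>q. b (fst x, q))))"

text \<open>The covector to be raised is the differential of a slice; it varies smoothly because on
  a base field it is the derivative of \<open>b\<close> along the lift.\<close>

lemma
  shows gradB_along: "gradB \<in> fst.along"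
    and gradB: "u \<in> tangent AB (fst x) \<Longrightarrow> gB (fst x) (gradB x) u = u (\<lambda>p. b (p, snd x))"
proof -
  have "\<exists>G. G \<in> fst.along \<and>
     (\<forall>x. \<forall>u\<in>tangent AB (fst x). gB (fst x) (G x) u = u (\<lambda>p. b (p, snd x)))"
  proof (rule fst.sharp_exists[OF ndB, of "\<lambda>x u. u (\<lambda>p. b (p, snd x))"])
    fix X assume X: "X \<in> B.VF"
    have "(\<lambda>x. X (fst x) (\<lambda>p. b (p, snd x))) = der (LB X) b"
      by (auto simp: der_def lift_base_apply[OF b_smooth])
    then show "(\<lambda>x. X (fst x) (\<lambda>p. b (p, snd x))) \<in> P.SF"
      using P.vfield_smooth[OF lift_base_vfield[OF X] b_smooth] by simp
  qed blast+
  from someI_ex[OF this, folded gradB_def]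
  show "gradB \<in> fst.along"
    and "u \<in> tangent AB (fst x) \<Longrightarrow> gB (fst x) (gradB x) u = u (\<lambda>p. b (p, snd x))" by blast+
qed

lemma
  shows gradF_along: "gradF \<in> snd.along"
    and gradF: "u \<in> tangent AF (snd x) \<Longrightarrow> gF (snd x) (gradF x) u = u (\<lambda>q. b (fst x, q))"
proof -
  have "\<exists>G. G \<in> snd.along \<and>
     (\<forall>x. \<forall>u\<in>tangent AF (snd x). gF (snd x) (G x) u = u (\<lambda>q. b (fst x, q)))"
  proof (rule snd.sharp_exists[OF ndF, of "\<lambda>x u. u (\<lambda>q. b (fst x, q))"])
    fix X assume X: "X \<in> F.VF"
    have "(\<lambda>x. X (snd x) (\<lambda>q. b (fst x, q))) = der (LF X) b"
      by (auto simp: der_def lift_fibre_apply[OF b_smooth])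
    then show "(\<lambda>x. X (snd x) (\<lambda>q. b (fst x, q))) \<in> P.SF"
      using P.vfield_smooth[OF lift_fibre_vfield[OF X] b_smooth] by simp
  qed blast+
  from someI_ex[OF this, folded gradF_def]
  show "gradF \<in> snd.along"
    and "u \<in> tangent AF (snd x) \<Longrightarrow> gF (snd x) (gradF x) u = u (\<lambda>q. b (fst x, q))" by blast+
qed

lemma gradB_lift: "X \<in> B.VF \<Longrightarrow> gB (fst x) (gradB x) (X (fst x)) = der (LB X) b x"
  using gradB[OF B.vfield_tangent, of X x] lift_base_apply[OF b_smooth, of X x]
  by (simp add: der_def)

lemma gradF_lift: "U \<in> F.VF \<Longrightarrow> gF (snd x) (gradF x) (U (snd x)) = der (LF U) b x"
  using gradF[OF F.vfield_tangent, of U x] lift_fibre_apply[OF b_smooth, of U x]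
  by (simp add: der_def)

lemma der_b_zero: "X \<in> P.VF \<Longrightarrow> b x = 0 \<Longrightarrow> der X b x = 0"
  using b_zero P.vfield_tangent by (simp add: der_def)

text \<open>\<open>gradF\<close> enters the third component of the forms of two fibre fields, which
  has to vanish with \<open>b\<close>.\<close>

lemma gradF_zero:
  assumes "b x = 0"
  shows "gradF x = (\<lambda>f. 0)"
proof (rule F.nondegenerate_unique[OF ndF snd.along_tangent[OF gradF_along] F.tangent_zero])
  fix w assume w: "w \<in> tangent AF (snd x)"
  obtain W where W: "W \<in> F.VF" "W (snd x) = w" using F.vfield_extend[OF w] by blast
  show "gF (snd x) (gradF x) w = gF (snd x) (\<lambda>f. 0) w"
    using gradF_lift[OF W(1), of x] W(2) der_b_zero[OF lift_fibre_vfield[OF W(1)] assms]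
    by (simp add: F.g_left_zero[OF w])
qed

end

context twisted_product
begin

section \<open>Evaluation rules for the curvature computation\<close>

lemma nablaB_apply:
  assumes "X \<in> B.VF" "Y \<in> B.VF" "Z \<in> B.VF"
  shows "gB p (B.nabla X Y p) (Z p) = koszul gB X Y Z p"
  unfolding B.ip_nabla[OF ndB assms, symmetric] by (simp add: ip_def)

lemma nablaF_apply:
  assumes "X \<in> F.VF" "Y \<in> F.VF" "Z \<in> F.VF"
  shows "gF p (F.nabla X Y p) (Z p) = koszul gF X Y Z p"
  unfolding F.ip_nabla[OF ndF assms, symmetric] by (simp add: ip_def)

lemma nablaB_apply_right:
  assumes "X \<in> B.VF" "Y \<in> B.VF" "Z \<in> B.VF"
  shows "gB p (Z p) (B.nabla X Y p) = koszul gB X Y Z p"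
  using nablaB_apply[OF assms] B.g_sym B.vfield_tangent B.vfield_nabla[OF ndB] assms by metis

lemma nablaF_apply_right:
  assumes "X \<in> F.VF" "Y \<in> F.VF" "Z \<in> F.VF"
  shows "gF p (Z p) (F.nabla X Y p) = koszul gF X Y Z p"
  using nablaF_apply[OF assms] F.g_sym F.vfield_tangent F.vfield_nabla[OF ndF] assms by metis

lemma gradB_lift_right: "X \<in> B.VF \<Longrightarrow> gB (fst x) (X (fst x)) (gradB x) = der (LB X) b x"
  using gradB_lift B.g_sym B.vfield_tangent fst.along_tangent[OF gradB_along] by metis

lemma gradF_lift_right: "U \<in> F.VF \<Longrightarrow> gF (snd x) (U (snd x)) (gradF x) = der (LF U) b x"
  using gradF_lift F.g_sym F.vfield_tangent snd.along_tangent[OF gradF_along] by metis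

lemma der_bracket_fibre:
  assumes "U \<in> F.VF" "V \<in> F.VF"
  shows "der (LF (lie_bracket U V)) b x = der (LF U) (der (LF V) b) x - der (LF V) (der (LF U) b) x"
  unfolding bracket_lift_fibre[OF assms, symmetric] by (simp add: der_def lie_bracket_def)

lemma der_bracket_base:
  assumes "U \<in> B.VF" "V \<in> B.VF"
  shows "der (LB (lie_bracket U V)) b x = der (LB U) (der (LB V) b) x - der (LB V) (der (LB U) b) x"
  unfolding bracket_lift_base[OF assms, symmetric] by (simp add: der_def lie_bracket_def)

lemma der_commute:
  assumes "X \<in> B.VF" "U \<in> F.VF"
  shows "der (LF U) (der (LB X) b) x = der (LB X) (der (LF U) b) x"
  using fun_cong[OF fun_cong[OF bracket_lift_mixed(1)[OF assms], of x], of b]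
  by (simp add: der_def lie_bracket_def)

lemmas tangent_rules = B.vfield_tangent F.vfield_tangent fst.along_tangent[OF gradB_along]
  snd.along_tangent[OF gradF_along] B.vfield_nabla[OF ndB] F.vfield_nabla[OF ndF]
  B.tcomb_tangent F.tcomb_tangent B.tangent_zero F.tangent_zero

text \<open>With both orders of each product listed, a lifted field paired with a Levi-Civita
  derivative or a gradient always reduces to a Koszul value or a derivative of
  \<open>b\<close>.\<close>

lemmas metric_rules = B.g_tcomb_left B.g_tcomb_right F.g_tcomb_left F.g_tcomb_right
  B.g_left_zero B.g_right_zero F.g_left_zero F.g_right_zero gradB_lift gradF_lift
  nablaB_apply nablaF_apply nablaB_apply_right nablaF_apply_right gradB_lift_right gradF_lift_right

lemmas smooth_rules = P.smooth_add P.smooth_mult P.smooth_power P.smooth_diff P.smooth_minus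
  P.smooth_const b_smooth smooth_fst smooth_snd P.vfield_smooth lift_base_vfield lift_fibre_vfield
  B.ip_smooth F.ip_smooth B.koszul_smooth F.koszul_smooth

lemmas along_rules = fst.along_tcomb snd.along_tcomb fst.along_pullback snd.along_pullback
  fst.along_zero snd.along_zero gradB_along gradF_along

text \<open>Turns the inverse metric applied to \<open>db\<close> into an ordinary metric product
  with the gradient, by way of \<open>bullet_inner_flat\<close>.\<close>

lemma db_base_flat: "db_base AB b p q = flat AB gB p (gradB (p, q))"
  using gradB[of _ "(p, q)"] by (auto simp: db_base_def diff_fun_def flat_def)

lemma db_fibre_flat: "db_fibre AF b p q = flat AF gF q (gradF (p, q))"
  using gradF[of _ "(p, q)"] by (auto simp: db_fibre_def diff_fun_def flat_def)

lemma bullet_base: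
  shows "X \<in> B.VF \<Longrightarrow> Y \<in> B.VF \<Longrightarrow>
      bullet_inner AB gB p (value_at AB (koszul gB X Y) p) (db_base AB b p q)
        = gB p (B.nabla X Y p) (gradB (p, q))"
    and "bullet_inner AB gB p (db_base AB b p q) (db_base AB b p q) = gB p (gradB (p, q)) (gradB (p, q))"
  using fst.along_tangent[OF gradB_along, of "(p, q)"] B.vfield_tangent[OF B.vfield_nabla[OF ndB]]
  by (simp_all add: B.value_at_koszul[OF ndB] db_base_flat B.bullet_inner_flat)

lemma bullet_fibre:
  shows "U \<in> F.VF \<Longrightarrow> V \<in> F.VF \<Longrightarrow>
      bullet_inner AF gF q (value_at AF (koszul gF U V) q) (db_fibre AF b p q)
        = gF q (F.nabla U V q) (gradF (p, q))"
    and "bullet_inner AF gF q (db_fibre AF b p q) (db_fibre AF b p q) = gF q (gradF (p, q)) (gradF (p, q))"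
  using snd.along_tangent[OF gradF_along, of "(p, q)"] F.vfield_tangent[OF F.vfield_nabla[OF ndF]]
  by (simp_all add: F.value_at_koszul[OF ndF] db_fibre_flat F.bullet_inner_flat)

section \<open>Components of the semi-symmetric non-metric form for each pair of lifts\<close>

context
  fixes P assumes P: "P \<in> F.VF"
begin

abbreviation "Kh \<equiv> ssnm_koszul gP (LF P)"

text \<open>Each conclusion of \<open>ssnm_lift\<close> mentions only some of the fields; the zero
  field is substituted for the remaining variables, which turns the facts into rewrite rules whose
  premises can be discharged.\<close>

lemmas Kh_lift =
  ssnm_lift(1)[OF _ _ _ F.vfield_zero F.vfield_zero F.vfield_zero P]
  ssnm_lift(2)[OF _ _ B.vfield_zero F.vfield_zero F.vfield_zero _ P]
  ssnm_lift(3)[OF _ B.vfield_zero _ F.vfield_zero _ F.vfield_zero P]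
  ssnm_lift(4)[OF _ B.vfield_zero B.vfield_zero F.vfield_zero _ _ P]
  ssnm_lift(5)[OF _ B.vfield_zero _ F.vfield_zero _ F.vfield_zero P]
  ssnm_lift(6)[OF _ B.vfield_zero B.vfield_zero F.vfield_zero _ _ P]
  ssnm_lift(7)[OF _ B.vfield_zero B.vfield_zero F.vfield_zero _ _ P]
  ssnm_lift(8)[OF B.vfield_zero B.vfield_zero B.vfield_zero _ _ _ P]

text \<open>\<open>P\<close> is tangent to the fibre, so the added term vanishes and only the
  Levi-Civita derivative of the base is left.\<close>

lemma represents_BB:
  assumes "X \<in> B.VF" "Y \<in> B.VF"
  shows "represents (Kh (LB X) (LB Y)) (\<lambda>x. B.nabla X Y (fst x)) (\<lambda>x f. 0) (\<lambda>x f. 0)"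
  unfolding represents_def
  using assms P
  by (simp add: ssnm_tensorial lift_base_vfield lift_fibre_vfield along_rules tangent_rules
      metric_rules Kh_lift)

text \<open>The fibre part \<open>b X(b) g_F(V, .)\<close> is of first order in \<open>b\<close>, so
  \<open>X(b) V\<close> is the third component, and it vanishes with \<open>b\<close>. The summand
  with coefficient 0 merely gives it the shape of a \<open>tcomb\<close>.\<close>

lemma represents_FB:
  assumes "V \<in> F.VF" "X \<in> B.VF"
  shows "represents (Kh (LF V) (LB X)) (\<lambda>x f. 0) (\<lambda>x f. 0)
    (\<lambda>x. tcomb (der (LB X) b x) (V (snd x)) 0 (V (snd x)))"
proof -
  have "tcomb (der (LB X) b x) (V (snd x)) 0 (V (snd x)) = (\<lambda>f. 0)" if "b x = 0" for x
    using der_b_zero[OF lift_base_vfield[OF assms(2)] that] by (simp add: tcomb_def)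
  then show ?thesis
    unfolding represents_def
    using assms P
    by (simp add: ssnm_tensorial smooth_rules along_rules tangent_rules
        metric_rules Kh_lift ip_def)
qed

text \<open>Differs from the reversed order of arguments by the base component
  \<open>b^2 g_F(V, P) X\<close>, the contribution of the added term.\<close>

lemma represents_BF:
  assumes "X \<in> B.VF" "V \<in> F.VF"
  shows "represents (Kh (LB X) (LF V))
    (\<lambda>x. tcomb ((b x)\<^sup>2 * ip gF V P (snd x)) (X (fst x)) 0 (X (fst x))) (\<lambda>x f. 0)
    (\<lambda>x. tcomb (der (LB X) b x) (V (snd x)) 0 (V (snd x)))"
proof -
  have "tcomb (der (LB X) b x) (V (snd x)) 0 (V (snd x)) = (\<lambda>f. 0)" if "b x = 0" for x
    using der_b_zero[OF lift_base_vfield[OF assms(1)] that] by (simp add: tcomb_def)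
  then show ?thesis
    unfolding represents_def
    using assms P
    by (simp add: ssnm_tensorial smooth_rules along_rules tangent_rules
        metric_rules Kh_lift) (simp add: ip_def)
qed

text \<open>Sorted by powers of \<open>b\<close> on fibre vectors: orders 2 and 4 give the second
  component, order 1 gives the third, \<open>U(b) V + V(b) U - g_F(U, V) grad_F b\<close>. On base
  vectors the form is \<open>-b g_F(U, V) db\<close>.\<close>

lemma represents_FF:
  assumes "U \<in> F.VF" "V \<in> F.VF"
  shows "represents (Kh (LF U) (LF V))
    (\<lambda>x. tcomb (- (b x * ip gF U V (snd x))) (gradB x) 0 (gradB x))
    (\<lambda>x. tcomb 1 (F.nabla U V (snd x)) ((b x)\<^sup>2 * ip gF V P (snd x)) (U (snd x)))
    (\<lambda>x. tcomb (der (LF U) b x) (V (snd x)) 1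
       (tcomb (der (LF V) b x) (U (snd x)) (- ip gF U V (snd x)) (gradF x)))"
proof -
  have "tcomb (der (LF U) b x) (V (snd x)) 1
       (tcomb (der (LF V) b x) (U (snd x)) (- ip gF U V (snd x)) (gradF x)) = (\<lambda>f. 0)" if "b x = 0" for x
    using der_b_zero[OF lift_fibre_vfield[OF assms(1)] that] der_b_zero[OF lift_fibre_vfield[OF assms(2)] that]
      gradF_zero[OF that] by (simp add: tcomb_def)
  then show ?thesis
    unfolding represents_def
    using assms P
    by (simp add: ssnm_tensorial smooth_rules along_rules tangent_rules
        metric_rules Kh_lift) (simp add: ip_def algebra_simps power2_eq_square power4_eq_xxxx)
qed

text \<open>Mixed lifts commute, so the bracket term of the curvature has the zero field as its
  first argument.\<close>

lemma ssnm_zero: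
  assumes "Y \<in> P.VF" "Z \<in> P.VF"
  shows "Kh (\<lambda>x f. 0) Y Z x = 0"
proof -
  have br: "lie_bracket Z (\<lambda>x f. 0) = (\<lambda>x f. 0)" "lie_bracket (\<lambda>x f. 0) Z = (\<lambda>x f. 0)"
    if "Z \<in> P.VF" for Z
    using P.tangent_const[OF P.vfield_tangent[OF that]] by (simp_all add: lie_bracket_def der_def)
  have zl: "ip gP (\<lambda>x f. 0) Z = (\<lambda>x. 0)" if "Z \<in> P.VF" for Z
    using that by (simp add: ip_def P.g_left_zero P.vfield_tangent)
  have "der (\<lambda>x f. 0) h x = 0" for h :: "'m \<times> 'n \<Rightarrow> real" by (simp add: der_def)
  then show ?thesis
    using assms
    by (simp add: ssnm_koszul_def koszul_def br zl ip_zero_right P.der_const P.vfield_bracket)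
qed

lemmas contraction_rules =
  contraction_represents[OF represents_BB represents_BB] contraction_represents[OF represents_BB represents_BF]
  contraction_represents[OF represents_BB represents_FB] contraction_represents[OF represents_BB represents_FF]
  contraction_represents[OF represents_BF represents_BB] contraction_represents[OF represents_BF represents_BF]
  contraction_represents[OF represents_BF represents_FB] contraction_represents[OF represents_BF represents_FF]
  contraction_represents[OF represents_FB represents_BB] contraction_represents[OF represents_FB represents_BF]
  contraction_represents[OF represents_FB represents_FB] contraction_represents[OF represents_FB represents_FF]
  contraction_represents[OF represents_FF represents_BB] contraction_represents[OF represents_FF represents_BF]
  contraction_represents[OF represents_FF represents_FB] contraction_represents[OF represents_FF represents_FF]

text \<open>Derivatives of metric products on the factors are split by metric compatibility, and
  brackets inside such products are removed by the torsion-free rule. The rest is a comparison of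
  polynomials.\<close>

lemmas curvature_rules = ssnm_curvature_def curvature_of_def ssnm_zero Kh_lift P
  contraction_rules lift_simps metric_rules tangent_rules smooth_rules B.vfield_zero F.vfield_zero
  P.der_add P.der_diff P.der_mult P.der_minus P.der_power
  der_lift_base_fst der_lift_base_snd der_lift_fibre_fst der_lift_fibre_snd
  der_bracket_base der_bracket_fibre der_commute
  B.koszul_metric F.koszul_metric
  B.koszul_torsion_free[symmetric] F.koszul_torsion_free[symmetric]

lemmas polynomial_rules = ip_def algebra_simps power2_eq_square power3_eq_cube power4_eq_xxxx

section \<open>The curvature on lifts, case by case\<close>

context
  fixes X Y Z T U V W Q
  assumes X: "X \<in> B.VF" and Y: "Y \<in> B.VF"
    and Z: "Z \<in> B.VF" and T: "T \<in> B.VF"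
    and U: "U \<in> F.VF" and V: "V \<in> F.VF"
    and W: "W \<in> F.VF" and Q: "Q \<in> F.VF"
begin

lemmas vfields = X Y Z T U V W Q

text \<open>Orients the symmetric products of the fixed fields, so that equal monomials become
  syntactically equal.\<close>

lemma metric_sym:
  "gB p (Y p) (X p) = gB p (X p) (Y p)" "gF q (V q) (U q) = gF q (U q) (V q)"
  "gF q (W q) (U q) = gF q (U q) (W q)" "gF q (W q) (V q) = gF q (V q) (W q)"
  "gF q (Q q) (U q) = gF q (U q) (Q q)" "gF q (Q q) (V q) = gF q (V q) (Q q)"
  "gF q (Q q) (W q) = gF q (W q) (Q q)" "gF q (P q) (Q q) = gF q (Q q) (P q)"
  by (simp_all only: B.g_sym F.g_sym B.vfield_tangent F.vfield_tangent vfields P)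

abbreviation "R \<xi> \<eta> \<zeta> \<theta> \<equiv> ssnm_curvature AP gP (LF P) \<xi> \<eta> \<zeta> \<theta>"

text \<open>All forms involved have only a base component, so the contractions are those of the base
  metric.\<close>

lemma ssnm_curvature_BBBB: "R (LB X) (LB Y) (LB Z) (LB T) x = riemann AB gB X Y Z T (fst x)"
  by (simp add: curvature_rules vfields riemann_def B.contraction_koszul[OF ndB])
    (simp add: ip_def metric_rules vfields B.vfield_nabla[OF ndB])

text \<open>The differentiated forms vanish; the contractions pair the \<open>P\<close>-term of a
  base and a fibre field with a Levi-Civita derivative of the base.\<close>

lemma ssnm_curvature_BBBF:
  "R (LB X) (LB Y) (LB Z) (LF W) x =
    (b x)\<^sup>2 * ip gF W P (snd x) * (koszul gB X Z Y (fst x) - koszul gB Y Z X (fst x))"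
  by (simp add: curvature_rules vfields) (simp add: polynomial_rules)

text \<open>Metric compatibility and vanishing torsion cancel all Koszul values of the base; only
  the derivatives of \<open>b^2\<close> survive.\<close>

lemma ssnm_curvature_BBFB:
  "R (LB X) (LB Y) (LF W) (LB Z) x =
    2 * b x * ip gF W P (snd x) * (der (LB X) b x * ip gB Y Z (fst x) - der (LB Y) b x * ip gB X Z (fst x))"
  by (simp add: curvature_rules vfields) (simp add: polynomial_rules)

text \<open>Each contraction pairs a form with only a base component and one with only a fibre
  component.\<close>

lemma ssnm_curvature_BFBB: "R (LB Z) (LF W) (LB X) (LB Y) x = 0"
  by (simp add: curvature_rules vfields)

text \<open>The two contractions are exchanged by swapping the leading fields and are symmetric, so
  they cancel. For leading base fields the second derivatives of \<open>b\<close> combine to that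
  along their bracket.\<close>

lemma ssnm_curvature_BBFF_FFBB:
  "R (LB X) (LB Y) (LF V) (LF W) x = 0"
  "R (LF V) (LF W) (LB X) (LB Y) x = 0"
  by (simp_all add: curvature_rules vfields) (simp_all add: polynomial_rules metric_sym)

text \<open>The bracket of the leading fields is 0, and the remaining terms change sign when the two
  are swapped.\<close>

lemma ssnm_curvature_BF_antisym:
  "\<zeta> \<in> P.VF \<Longrightarrow> \<theta> \<in> P.VF \<Longrightarrow> R (LB X) (LF V) \<zeta> \<theta> x = - R (LF V) (LB X) \<zeta> \<theta> x"
  by (simp add: ssnm_curvature_def curvature_of_def bracket_lift_mixed ssnm_zero vfields)

text \<open>Both terms with \<open>P\<close> come from differentiating
  \<open>b^2 g_F(W, P) g_B(X, Y)\<close> along \<open>V\<close>. The products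
  \<open>X(b) Y(b)\<close> from the derivative and from the contraction cancel.\<close>

lemma ssnm_curvature_BFFB:
  "R (LB X) (LF V) (LF W) (LB Y) x =
    - b x * der (LB X) (der (LB Y) b) x * ip gF V W (snd x)
    + b x * gB (fst x) (B.nabla X Y (fst x)) (gradB x) * ip gF V W (snd x)
    - 2 * b x * der (LF V) b x * ip gB X Y (fst x) * ip gF W P (snd x)
    - (b x)\<^sup>2 * der V (ip gF W P) (snd x) * ip gB X Y (fst x)"
  by (simp add: curvature_rules vfields) (simp add: polynomial_rules metric_sym)

text \<open>Components containing \<open>P\<close> meet a form without a component in the same
  factor, so \<open>P\<close> disappears.\<close>

lemma ssnm_curvature_BFBF:
  "R (LB X) (LF V) (LB Y) (LF W) x =
    b x * der (LB X) (der (LB Y) b) x * ip gF V W (snd x)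
    - b x * gB (fst x) (B.nabla X Y (fst x)) (gradB x) * ip gF V W (snd x)"
  by (simp add: curvature_rules vfields) (simp add: polynomial_rules metric_sym)

text \<open>The coefficient 2 of \<open>b^3\<close> is 4 - 1 - 1 for the first product, from
  differentiating \<open>b^4\<close> and from the two contractions, and 1 + 1 for the second, from
  the contractions alone.\<close>

lemma ssnm_curvature_BFFF:
  "R (LB X) (LF V) (LF U) (LF W) x =
    b x * der (LB X) (der (LF U) b) x * ip gF W V (snd x) - der (LB X) b x * der (LF U) b x * ip gF W V (snd x)
    - b x * der (LB X) (der (LF W) b) x * ip gF V U (snd x) + der (LB X) b x * der (LF W) b x * ip gF V U (snd x)
    + 2 * (b x)^3 * der (LB X) b x *
      (ip gF U P (snd x) * ip gF V W (snd x) + ip gF W P (snd x) * ip gF U V (snd x))"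
  by (simp add: curvature_rules vfields) (simp add: polynomial_rules metric_sym)

text \<open>The contributions of \<open>P\<close> to the two contractions are equal and cancel.
  Second derivatives along a base and a fibre lift are interchangeable by
  \<open>der_commute\<close>.\<close>

lemma ssnm_curvature_FFBF:
  "R (LF U) (LF W) (LB X) (LF V) x = - R (LF U) (LF W) (LF V) (LB X) x"
  "R (LF U) (LF W) (LB X) (LF V) x =
    b x * der (LB X) (der (LF U) b) x * ip gF W V (snd x) - der (LB X) b x * der (LF U) b x * ip gF W V (snd x)
    - b x * der (LB X) (der (LF W) b) x * ip gF V U (snd x) + der (LB X) b x * der (LF W) b x * ip gF V U (snd x)"
  by (simp_all add: curvature_rules vfields) (simp_all add: polynomial_rules metric_sym)

text \<open>The norm of \<open>gradB\<close> comes from the base components of the forms and that of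
  \<open>gradF\<close> from their third components; products of \<open>gradF\<close> with
  Levi-Civita derivatives come from the mixed terms of order \<open>b\<close>.\<close>

lemma ssnm_curvature_FFFF:
  "R (LF U) (LF V) (LF W) (LF Q) x =
    (b x)\<^sup>2 * riemann AF gF U V W Q (snd x)
    + ((b x)\<^sup>2 * gB (fst x) (gradB x) (gradB x) + gF (snd x) (gradF x) (gradF x))
      * (ip gF U W (snd x) * ip gF V Q (snd x) - ip gF V W (snd x) * ip gF U Q (snd x))
    + (b x * der (LF U) (der (LF W) b) x - 2 * der (LF U) b x * der (LF W) b x
        - b x * gF (snd x) (F.nabla U W (snd x)) (gradF x)) * ip gF V Q (snd x)
    + (b x * der (LF V) (der (LF Q) b) x - 2 * der (LF V) b x * der (LF Q) b x
        - b x * gF (snd x) (F.nabla V Q (snd x)) (gradF x)) * ip gF U W (snd x)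
    - (b x * der (LF V) (der (LF W) b) x - 2 * der (LF V) b x * der (LF W) b x
        - b x * gF (snd x) (F.nabla V W (snd x)) (gradF x)) * ip gF U Q (snd x)
    - (b x * der (LF U) (der (LF Q) b) x - 2 * der (LF U) b x * der (LF Q) b x
        - b x * gF (snd x) (F.nabla U Q (snd x)) (gradF x)) * ip gF V W (snd x)
    + 2 * (b x)^3 * der (LF U) b x * (ip gF W P (snd x) * ip gF V Q (snd x) + ip gF Q P (snd x) * ip gF V W (snd x))
    - 2 * (b x)^3 * der (LF V) b x * (ip gF W P (snd x) * ip gF U Q (snd x) + ip gF Q P (snd x) * ip gF U W (snd x))
    + (b x)^4 * der U (ip gF W P) (snd x) * ip gF V Q (snd x)
    - (b x)^4 * der V (ip gF W P) (snd x) * ip gF U Q (snd x)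
    + (b x)^4 * ip gF P Q (snd x) * (koszul gF U W V (snd x) - koszul gF V W U (snd x))"
proof -
  \<comment> \<open>The contractions inside \<open>riemann\<close> yield \<open>ip\<close> of
    Levi-Civita fields, those of the product yield metric values at \<open>snd x\<close>; both are
    brought to the second shape.\<close>
  have "ip gF (F.nabla U' V') (F.nabla W' Q') (snd x) = gF (snd x) (F.nabla U' V' (snd x)) (F.nabla W' Q' (snd x))"
    for U' V' W' Q' by (simp add: ip_def)
  then show ?thesis
    by (simp add: curvature_rules vfields riemann_def F.contraction_koszul[OF ndF])
      (simp add: polynomial_rules metric_sym)
qed

end

end

end


theorem theorem6p4:
  fixes AB :: "('m::{t2_space, second_countable_topology}, 'e::euclidean_space) atlas"
    and AF :: "('n::{t2_space, second_countable_topology}, 'f::euclidean_space) atlas"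
    and gB :: "'m metric" and gF :: "'n metric"
    and b :: "'m \<times> 'n \<Rightarrow> real"
    and X Y Z T :: "'m vfield" and P U V W Q :: "'n vfield"
    and p :: 'm and q :: 'n
  assumes "singular_semi_riemannian AB gB" and "non_degenerate AB gB"
    and "singular_semi_riemannian AF gF" and "non_degenerate AF gF"
    and "b \<in> smooth_funs (prod_atlas AB AF)"
    and "\<And>x v. b x = 0 \<Longrightarrow> v \<in> tangent (prod_atlas AB AF) x \<Longrightarrow>
           diff_fun (prod_atlas AB AF) b x v = 0"
    and "P \<in> vector_fields AF"
    and "X \<in> vector_fields AB" and "Y \<in> vector_fields AB"
    and "Z \<in> vector_fields AB" and "T \<in> vector_fields AB"
    and "U \<in> vector_fields AF" and "V \<in> vector_fields AF"
    and "W \<in> vector_fields AF" and "Q \<in> vector_fields AF"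
  shows "let
      LB = lift_base AB AF;
      LF = lift_fibre AB AF;
      R = (\<lambda>\<xi> \<eta> \<zeta> \<theta>. ssnm_curvature (prod_atlas AB AF) (twisted_metric AB AF gB gF b) (LF P)
             \<xi> \<eta> \<zeta> \<theta> (p, q));
      \<beta> = b (p, q);
      D = (\<lambda>\<xi>. der \<xi> b (p, q));
      DD = (\<lambda>\<xi> \<eta>. der \<xi> (der \<eta> b) (p, q));
      hB = (\<lambda>X Y. ip gB X Y p);
      hF = (\<lambda>U V. ip gF U V q);
      kB = (\<lambda>X Y. bullet_inner AB gB p (value_at AB (koszul gB X Y) p) (db_base AB b p q));
      kF = (\<lambda>U V. bullet_inner AF gF q (value_at AF (koszul gF U V) q) (db_fibre AF b p q));
      nB = bullet_inner AB gB p (db_base AB b p q) (db_base AB b p q);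
      nF = bullet_inner AF gF q (db_fibre AF b p q) (db_fibre AF b p q)
    in
      R (LB X) (LB Y) (LB Z) (LB T) = riemann AB gB X Y Z T p
    \<and>
      R (LB X) (LB Y) (LB Z) (LF W) =
        \<beta>^2 * hF W P * (koszul gB X Z Y p - koszul gB Y Z X p)
    \<and>
      R (LB X) (LB Y) (LF W) (LB Z) =
        2 * \<beta> * hF W P * (D (LB X) * hB Y Z - D (LB Y) * hB X Z)
    \<and>
      R (LB Z) (LF W) (LB X) (LB Y) = 0
    \<and>
      R (LB X) (LB Y) (LF V) (LF W) = 0 \<and>
      R (LF V) (LF W) (LB X) (LB Y) = 0
    \<and>
      R (LB X) (LF V) (LF W) (LB Y) = - R (LF V) (LB X) (LF W) (LB Y) \<and>
      R (LB X) (LF V) (LF W) (LB Y) =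
        - \<beta> * DD (LB X) (LB Y) * hF V W
        + \<beta> * kB X Y * hF V W
        - 2 * \<beta> * D (LF V) * hB X Y * hF W P
        - \<beta>^2 * der V (ip gF W P) q * hB X Y
    \<and>
      R (LB X) (LF V) (LB Y) (LF W) = - R (LF V) (LB X) (LB Y) (LF W) \<and>
      R (LB X) (LF V) (LB Y) (LF W) =
        \<beta> * DD (LB X) (LB Y) * hF V W - \<beta> * kB X Y * hF V W
    \<and>
      R (LB X) (LF V) (LF U) (LF W) = - R (LF V) (LB X) (LF U) (LF W) \<and>
      R (LB X) (LF V) (LF U) (LF W) =
        \<beta> * DD (LB X) (LF U) * hF W V - D (LB X) * D (LF U) * hF W V
        - \<beta> * DD (LB X) (LF W) * hF V U + D (LB X) * D (LF W) * hF V U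
        + 2 * \<beta>^3 * D (LB X) * (hF U P * hF V W + hF W P * hF U V)
    \<and>
      R (LF U) (LF W) (LB X) (LF V) = - R (LF U) (LF W) (LF V) (LB X) \<and>
      R (LF U) (LF W) (LB X) (LF V) =
        \<beta> * DD (LB X) (LF U) * hF W V - D (LB X) * D (LF U) * hF W V
        - \<beta> * DD (LB X) (LF W) * hF V U + D (LB X) * D (LF W) * hF V U
    \<and>
      R (LF U) (LF V) (LF W) (LF Q) =
        \<beta>^2 * riemann AF gF U V W Q q
        + (\<beta>^2 * nB + nF) * (hF U W * hF V Q - hF V W * hF U Q)
        + (\<beta> * DD (LF U) (LF W) - 2 * D (LF U) * D (LF W) - \<beta> * kF U W) * hF V Q
        + (\<beta> * DD (LF V) (LF Q) - 2 * D (LF V) * D (LF Q) - \<beta> * kF V Q) * hF U W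
        - (\<beta> * DD (LF V) (LF W) - 2 * D (LF V) * D (LF W) - \<beta> * kF V W) * hF U Q
        - (\<beta> * DD (LF U) (LF Q) - 2 * D (LF U) * D (LF Q) - \<beta> * kF U Q) * hF V W
        + 2 * \<beta>^3 * D (LF U) * (hF W P * hF V Q + hF Q P * hF V W)
        - 2 * \<beta>^3 * D (LF V) * (hF W P * hF U Q + hF Q P * hF U W)
        + \<beta>^4 * der U (ip gF W P) q * hF V Q
        - \<beta>^4 * der V (ip gF W P) q * hF U Q
        + \<beta>^4 * hF P Q * (koszul gF U W V q - koszul gF V W U q)"
proof -
  have "smooth_manifold AB" "smooth_manifold AF"
    using assms(1,3) by (simp_all add: singular_semi_riemannian_def)
  \<comment> \<open>On tangent vectors \<open>diff_fun\<close> is evaluation at \<open>b\<close>,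
    which turns the hypothesis on \<open>db\<close> into \<open>b_zero\<close>.\<close>
  then interpret twisted_product AB AF gB gF b
    using assms(1-6) by unfold_locales (auto simp: diff_fun_def)
  note X = assms(8) and Y = assms(9) and U = assms(12) and V = assms(13) and W = assms(14) and Q = assms(15)
  note curvature = ssnm_curvature_BBBB ssnm_curvature_BBBF ssnm_curvature_BBFB ssnm_curvature_BFBB
    ssnm_curvature_BBFF_FFBB ssnm_curvature_BFFB ssnm_curvature_BFBF ssnm_curvature_BFFF ssnm_curvature_FFBF
    ssnm_curvature_FFFF
  show ?thesis
    unfolding Let_def bullet_base(1)[OF X Y] bullet_fibre(1)[OF U W] bullet_fibre(1)[OF V Q]
      bullet_fibre(1)[OF V W] bullet_fibre(1)[OF U Q] bullet_base(2) bullet_fibre(2)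
    by (intro conjI curvature[OF assms(7-15), of "(p, q)", unfolded fst_conv snd_conv]
        ssnm_curvature_BF_antisym[OF assms(7-15)] lift_base_vfield lift_fibre_vfield X Y U V W)
qed

end
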